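(* Assume that Conjecture NW (stated in the context) holds and that an exponentially hard one-way permutation exists. Then for some constant $c\ge1$ the search task $\mathbf{Cert}(c)$ is only partially defined for infinitely many lengths $k\ge1$; that is, for infinitely many $k$ there is an input $(1^{(k)},D)$ of $\mathbf{Cert}(c)$ for which the task has no solution.
   Context: TAUT is the set of propositional tautologies in the DeMorgan language. Formulas are encoded by binary strings, so a formula of size $k$ is an element of $\{0,1\}^k$. $1^{(k)}$ is the string of $k$ ones. **Search task $\mathbf{Cert}(c)$**, for a constant $c\ge1$: - Input: $1^{(k)}$ and a size $k^{c^2}$ Boolean circuit $D(x,y)$ in $k$ variables $x=(x_1,\dots,x_k)$ and $k^c$ variables $y=(y_1,\dots,y_{k^c})$. - Required output: either a size $k$ falsifiable formula $\varphi$ such that $D(\varphi,y)$ is satisfiable (as a circuit in $y$), or a size $k$ tautology $\tau$ such that $D(\tau,y)$ is unsatisfiable. **Exponentially hard one-way permutation.** A polynomial-time computable permutation $h:\{0,1\}^*\to\{0,1\}^*$ (permuting each $\{0,1\}^\ell$) is $\epsilon(\ell)$ one-way with security parameter $t(\ell)$ if for all $\ell$ and every Boolean circuit $D$ with $\ell$ inputs and size at most $t(\ell)$, $\mathrm{Prob}_{v\in\{0,1\}^\ell}[D(h(v))=v]\le\epsilon(\ell)$. It is exponentially hard if it is $2^{-\ell^{\Omega(1)}}$ one-way with security parameter $2^{\ell^{\Omega(1)}}$ (that is, for some constant $\gamma>0$ this holds with $\epsilon(\ell)=2^{-\ell^\gamma}$ and $t(\ell)=2^{\ell^\gamma}$ for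 all sufficiently large $\ell$). **$\mathrm{NP}\cap\mathrm{coNP}$ functions with unique witnesses.** A function $f:\{0,1\}^*\to\{0,1\}$ is an $\mathrm{NP}\cap\mathrm{coNP}$ function if there are polynomial-time relations $F_0,F_1$ and a constant $c$ such that for $a=0,1$: $f(u)=a$ iff $\exists y\,(|y|\le|u|^c\wedge F_a(u,y))$. Any such $y$ is a witness for $f(u)$; $f$ has unique witnesses if each $f(u)$ has exactly one witness. **Hardness $H_f$.** $f$ is $(\epsilon,S)$-hard at length $\ell$ if every circuit $C$ with $\ell$ inputs and size at most $S$ satisfies $\mathrm{Prob}_{u\in\{0,1\}^\ell}[C(u)=f(u)]<1/2+\epsilon/2$. $H_f(\ell)$ is the maximal $S$ such that $f$ is $(1/S,S)$-hard at length $\ell$. **Nisan–Wigderson generator.** For $0<\delta\le1/3$ and $n\ge1$ put $\ell=n^{1/3}$, $m=m(n)=2^{n^\delta}$, $d=\log m$ (rounding is ignored). $A_n=\{J_i\subseteq[n]\}_{i\in[m]}$ is a fixed $(d,\ell)$-design: $|J_i|=\ell$ for all $i$ and $|J_i\cap J_j|\le d$ for $i\ne j$. It is constructed in time $m^{O(1)}$ from $1^{(n)},1^{(m)}$ and $J_i$ is computable from $i$ and $1^{(n)}$ in polynomial time (the Nisan–Wigderson design has these properties). For $J_i=\{j_1<\dots<j_\ell\}$ and $x\in\{0,1\}^n$ let $x(J_i)=x_{j_1}\dots x_{j_\ell}$. Then $NW_{A_n,f}:\{0,1\}^n\to\{0,1\}^m$ is the map whose $i$-th output bit on $x$ is $f(x(J_i))$;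 $Rng$ denotes its range. **Conjecture NW.** Assume $f$ is an $\mathrm{NP}\cap\mathrm{coNP}$ function with unique witnesses and $H_f(\ell)=2^{\ell^{\Omega(1)}}$. Then there is $\delta>0$ such that for $m(n)=2^{n^\delta}$ and for any infinite NP set $R$ that has infinitely many elements whose length equals $m(n)$ for $n\ge1$ it holds that $Rng(NW_{A_n,f})\cap R\ne\emptyset$ (for some $n$). *)

theory Defs
  imports "HOL-Probability.Probability_Mass_Function"
begin

definition strings :: "nat \<Rightarrow> bool list set" where
  "strings l = {u. length u = l}"

abbreviation ones :: "nat \<Rightarrow> bool list" where
  "ones k \<equiv> replicate k True"

text \<open>Binary notation with exactly \<open>d\<close> bits, least significant bit first.\<close>

definition bin :: "nat \<Rightarrow> nat \<Rightarrow> bool list" where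
  "bin d i = map (bit i) [0..<d]"

abbreviation unif_prob :: "nat \<Rightarrow> (bool list \<Rightarrow> bool) \<Rightarrow> real" where
  "unif_prob l P \<equiv> measure_pmf.prob (pmf_of_set (strings l)) {u. P u}"


section \<open>Polynomial time\<close>

text \<open>Deterministic Turing machines with finitely many two-way infinite tapes over the alphabet
  \<open>{0, 1, blank}\<close>, where \<^const>\<open>None\<close> is the blank. The states are \<open>0, \<dots>, nstates\<close>;
  \<open>0\<close> is initial and \<open>nstates\<close> is the halting state.\<close>

datatype dir = MoveLeft | Stay | MoveRight

datatype tm = TM (ntapes: nat) (nstates: nat)
  (trans: "nat \<Rightarrow> bool option list \<Rightarrow> nat \<times> (bool option \<times> dir) list")

definition wf_tm :: "tm \<Rightarrow> bool" where
  "wf_tm M \<longleftrightarrow> ntapes M \<ge> 1 \<and>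
     (\<forall>q < nstates M. \<forall>ss. length ss = ntapes M \<longrightarrow>
        fst (trans M q ss) \<le> nstates M \<and> length (snd (trans M q ss)) = ntapes M)"

type_synonym tape = "int \<times> (int \<Rightarrow> bool option)"
type_synonym config = "nat \<times> tape list"

fun move :: "dir \<Rightarrow> int \<Rightarrow> int" where
  "move MoveLeft p = p - 1"
| "move Stay p = p"
| "move MoveRight p = p + 1"

fun act :: "bool option \<times> dir \<Rightarrow> tape \<Rightarrow> tape" where
  "act (s, a) (p, T) = (move a p, T(p := s))"

fun step :: "tm \<Rightarrow> config \<Rightarrow> config" where
  "step M (q, ts) =
     (if q < nstates M
      then let (q', as) = trans M q (map (\<lambda>(p, T). T p) ts) in (q', map2 act as ts)
      else (q, ts))"

definition tape_of :: "bool list \<Rightarrow> tape" where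
  "tape_of w = (0, \<lambda>p. if 0 \<le> p \<and> p < int (length w) then Some (w ! nat p) else None)"

text \<open>The arguments are written on the first tapes, the remaining tapes are blank.\<close>

definition init :: "tm \<Rightarrow> bool list list \<Rightarrow> config" where
  "init M xs = (0, map (\<lambda>j. tape_of (if j < length xs then xs ! j else [])) [0..<ntapes M])"

text \<open>The output is read off the first tape, from cell \<open>0\<close> up to the first blank.
  A halted configuration no longer changes, so \<open>t\<close> is an upper bound on the running time.\<close>

definition outputs_within :: "tm \<Rightarrow> bool list list \<Rightarrow> bool list \<Rightarrow> nat \<Rightarrow> bool" where
  "outputs_within M xs w t \<longleftrightarrow>
     (let (q, ts) = (step M ^^ t) (init M xs); T = snd (hd ts) in
        q = nstates M \<and> (\<forall>j < length w. T (int j) = Some (w ! j)) \<and> T (int (length w)) = None)"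

text \<open>\<open>G\<close> is the graph of a (possibly partial) function of tuples of strings; the machine is
  only required to work on the domain of that function.\<close>

definition polytime :: "(bool list list \<times> bool list) set \<Rightarrow> bool" where
  "polytime G \<longleftrightarrow>
     (\<exists>M a. wf_tm M \<and>
        (\<forall>(xs, w) \<in> G. length xs \<le> ntapes M \<and>
           outputs_within M xs w (sum_list (map length xs) ^ a + a)))"

definition polytime_fun :: "(bool list \<Rightarrow> bool list) \<Rightarrow> bool" where
  "polytime_fun h \<longleftrightarrow> polytime {([x], h x) | x. True}"

definition polytime_rel :: "(bool list \<Rightarrow> bool list \<Rightarrow> bool) \<Rightarrow> bool" where
  "polytime_rel V \<longleftrightarrow> polytime {([u, y], [V u y]) | u y. True}"

definition NP_set :: "bool list set \<Rightarrow> bool" where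
  "NP_set R \<longleftrightarrow>
     (\<exists>V c. polytime_rel V \<and> (\<forall>b. b \<in> R \<longleftrightarrow> (\<exists>y. length y \<le> length b ^ c + c \<and> V b y)))"


section \<open>Boolean circuits\<close>

text \<open>Straight-line programs over the DeMorgan basis. With \<open>n\<close> inputs, the wires
  \<open>0, \<dots>, n - 1\<close> carry the inputs and the \<open>j\<close>-th gate (from \<open>0\<close>) defines wire \<open>n + j\<close>.
  The size is the number of gates.\<close>

datatype gate = Const bool | Neg nat | Conj nat nat | Disj nat nat

fun gate_wires :: "gate \<Rightarrow> nat set" where
  "gate_wires (Const b) = {}"
| "gate_wires (Neg i) = {i}"
| "gate_wires (Conj i j) = {i, j}"
| "gate_wires (Disj i j) = {i, j}"

fun gate_val :: "bool list \<Rightarrow> gate \<Rightarrow> bool" where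
  "gate_val ws (Const b) = b"
| "gate_val ws (Neg i) = (\<not> ws ! i)"
| "gate_val ws (Conj i j) = (ws ! i \<and> ws ! j)"
| "gate_val ws (Disj i j) = (ws ! i \<or> ws ! j)"

datatype circuit = Circuit (gates: "gate list") (outs: "nat list")

definition is_circuit :: "nat \<Rightarrow> nat \<Rightarrow> circuit \<Rightarrow> bool" where
  "is_circuit n m C \<longleftrightarrow>
     (\<forall>j < length (gates C). gate_wires (gates C ! j) \<subseteq> {..<n + j}) \<and>
     length (outs C) = m \<and> set (outs C) \<subseteq> {..<n + length (gates C)}"

definition csize :: "circuit \<Rightarrow> nat" where
  "csize C = length (gates C)"

definition ceval :: "circuit \<Rightarrow> bool list \<Rightarrow> bool list" where
  "ceval C u = (let ws = foldl (\<lambda>ws g. ws @ [gate_val ws g]) u (gates C) in map ((!) ws) (outs C))"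


section \<open>Propositional formulas in the DeMorgan language\<close>

text \<open>Variables are indexed by binary strings.\<close>

datatype fm = FVar "bool list" | FConst bool | FNot fm | FAnd fm fm | FOr fm fm

fun fval :: "(bool list \<Rightarrow> bool) \<Rightarrow> fm \<Rightarrow> bool" where
  "fval e (FVar v) = e v"
| "fval e (FConst b) = b"
| "fval e (FNot A) = (\<not> fval e A)"
| "fval e (FAnd A B) = (fval e A \<and> fval e B)"
| "fval e (FOr A B) = (fval e A \<or> fval e B)"

definition tautology :: "fm \<Rightarrow> bool" where
  "tautology A \<longleftrightarrow> (\<forall>e. fval e A)"

definition falsifiable :: "fm \<Rightarrow> bool" where
  "falsifiable A \<longleftrightarrow> (\<exists>e. \<not> fval e A)"

text \<open>Formulas are written in prefix notation; the tokens form a prefix-free code, in which the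
  index of a variable is made self-delimiting by putting \<open>1\<close> before each of its bits and \<open>0\<close> at
  its end. The token lengths are chosen so that all but finitely many numbers \<open>k\<close> are sizes of
  tautologies as well as of falsifiable formulas, see \<open>ex_formulas_of_size\<close> below. Otherwise the
  search task could fail to have solutions for the trivial reason that there are no formulas of
  size \<open>k\<close>.\<close>

fun code :: "fm \<Rightarrow> bool list" where
  "code (FAnd A B) = [False, False] @ code A @ code B"
| "code (FOr A B) = [False, True] @ code A @ code B"
| "code (FNot A) = [True, False, False] @ code A"
| "code (FConst b) = [True, False, True, b]"
| "code (FVar v) = [True, True] @ concat (map (\<lambda>b. [True, b]) v) @ [False]"

lemma index_code_prefix_free:
  "concat (map (\<lambda>b. [True, b]) v) @ False # s = concat (map (\<lambda>b. [True, b]) v') @ False # s' \<Longrightarrow>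
   v = v' \<and> s = s'"
proof (induction v arbitrary: v')
  case Nil
  then show ?case by (cases v') auto
next
  case (Cons a v)
  then show ?case by (cases v') auto
qed

lemma code_prefix_free: "code A @ s = code B @ s' \<Longrightarrow> A = B \<and> s = s'"
proof (induction A arbitrary: B s s')
  case (FVar v)
  then show ?case by (cases B) (auto dest: index_code_prefix_free)
next
  case (FConst b)
  then show ?case by (cases B) auto
next
  case (FNot A)
  from FNot.prems obtain B' where B: "B = FNot B'" and eq: "code A @ s = code B' @ s'"
    by (cases B) auto
  from FNot.IH[OF eq] B show ?case by blast
next
  case (FAnd A1 A2)
  from FAnd.prems obtain B1 B2 where B: "B = FAnd B1 B2"
    and eq: "code A1 @ code A2 @ s = code B1 @ code B2 @ s'"
    by (cases B) auto
  from FAnd.IH(1)[OF eq] have "A1 = B1" "code A2 @ s = code B2 @ s'"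
    by blast+
  with FAnd.IH(2) B show ?case by blast
next
  case (FOr A1 A2)
  from FOr.prems obtain B1 B2 where B: "B = FOr B1 B2"
    and eq: "code A1 @ code A2 @ s = code B1 @ code B2 @ s'"
    by (cases B) auto
  from FOr.IH(1)[OF eq] have "A1 = B1" "code A2 @ s = code B2 @ s'"
    by blast+
  with FOr.IH(2) B show ?case by blast
qed

lemma inj_code: "inj code"
  using code_prefix_free[of _ "[]" _ "[]"] by (auto intro: injI)

lemma ex_formulas_of_size:
  assumes "k \<ge> 24"
  shows "\<exists>A. length (code A) = k \<and> tautology A" and "\<exists>A. length (code A) = k \<and> falsifiable A"
proof -
  have "(\<exists>A. length (code A) = k \<and> tautology A) \<and> (\<exists>A. length (code A) = k \<and> falsifiable A)"
    using assms
  proof (induction k rule: less_induct)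
    case (less k)
    have pad: "\<exists>A. length (code A) = n + 5 \<and> tautology A" "\<exists>A. length (code A) = n + 6 \<and> tautology A"
      if ex: "\<exists>A. length (code A) = n \<and> tautology A" for n
    proof -
      obtain A where A: "length (code A) = n" "tautology A" using ex by blast
      show "\<exists>A. length (code A) = n + 5 \<and> tautology A"
        by (rule exI[of _ "FOr A (FVar [])"]) (use A in \<open>auto simp: tautology_def\<close>)
      show "\<exists>A. length (code A) = n + 6 \<and> tautology A"
        by (rule exI[of _ "FOr A (FConst True)"]) (use A in \<open>auto simp: tautology_def\<close>)
    qed
    have pad': "\<exists>A. length (code A) = n + 5 \<and> falsifiable A" "\<exists>A. length (code A) = n + 6 \<and> falsifiable A"
      if ex: "\<exists>A. length (code A) = n \<and> falsifiable A" for n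
    proof -
      obtain A where A: "length (code A) = n" "falsifiable A" using ex by blast
      show "\<exists>A. length (code A) = n + 5 \<and> falsifiable A"
        by (rule exI[of _ "FAnd A (FVar [])"]) (use A in \<open>auto simp: falsifiable_def\<close>)
      show "\<exists>A. length (code A) = n + 6 \<and> falsifiable A"
        by (rule exI[of _ "FAnd A (FConst True)"]) (use A in \<open>auto simp: falsifiable_def\<close>)
    qed
    have t4: "\<exists>A. length (code A) = 4 \<and> tautology A"
      by (rule exI[of _ "FConst True"]) (auto simp: tautology_def)
    have f4: "\<exists>A. length (code A) = 4 \<and> falsifiable A"
      by (rule exI[of _ "FConst False"]) (auto simp: falsifiable_def)
    note t9 = pad(1)[OF t4, simplified] and t10 = pad(2)[OF t4, simplified]
    note t14 = pad(1)[OF t9, simplified] and t15 = pad(2)[OF t9, simplified]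
      and t16 = pad(2)[OF t10, simplified]
    note t19 = pad(1)[OF t14, simplified] and t20 = pad(1)[OF t15, simplified]
      and t21 = pad(1)[OF t16, simplified] and t22 = pad(2)[OF t16, simplified]
    note f9 = pad'(1)[OF f4, simplified] and f10 = pad'(2)[OF f4, simplified]
    note f14 = pad'(1)[OF f9, simplified] and f15 = pad'(2)[OF f9, simplified]
      and f16 = pad'(2)[OF f10, simplified]
    note f19 = pad'(1)[OF f14, simplified] and f20 = pad'(1)[OF f15, simplified]
      and f21 = pad'(1)[OF f16, simplified] and f22 = pad'(2)[OF f16, simplified]
    consider "k = 19 + 5" | "k = 20 + 5" | "k = 21 + 5" | "k = 22 + 5" | "k = 22 + 6"
      | n where "k = n + 5" "n \<ge> 24"
    proof -
      assume "k = 19 + 5 \<Longrightarrow> thesis" "k = 20 + 5 \<Longrightarrow> thesis" "k = 21 + 5 \<Longrightarrow> thesis"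
        "k = 22 + 5 \<Longrightarrow> thesis" "k = 22 + 6 \<Longrightarrow> thesis"
        "\<And>n. k = n + 5 \<Longrightarrow> 24 \<le> n \<Longrightarrow> thesis"
      moreover from less.prems have "k \<in> {24, 25, 26, 27, 28} \<or> (k = (k - 5) + 5 \<and> k - 5 \<ge> 24)"
        by auto
      ultimately show thesis by auto
    qed
    then show ?case
    proof cases
      case 1
      then show ?thesis using pad(1)[OF t19] pad'(1)[OF f19] by metis
    next
      case 2
      then show ?thesis using pad(1)[OF t20] pad'(1)[OF f20] by metis
    next
      case 3
      then show ?thesis using pad(1)[OF t21] pad'(1)[OF f21] by metis
    next
      case 4
      then show ?thesis using pad(1)[OF t22] pad'(1)[OF f22] by metis
    next
      case 5
      then show ?thesis using pad(2)[OF t22] pad'(2)[OF f22] by metis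
    next
      case 6
      then show ?thesis using less.IH[of n] pad(1)[of n] pad'(1)[of n] by simp
    qed
  qed
  then show "\<exists>A. length (code A) = k \<and> tautology A" and "\<exists>A. length (code A) = k \<and> falsifiable A"
    by auto
qed


section \<open>The search task\<close>

definition cert_input :: "nat \<Rightarrow> nat \<Rightarrow> circuit \<Rightarrow> bool" where
  "cert_input c k D \<longleftrightarrow> is_circuit (k + k ^ c) 1 D \<and> csize D = k ^ (c ^ 2)"

definition satisfiable_in_y :: "nat \<Rightarrow> nat \<Rightarrow> circuit \<Rightarrow> bool list \<Rightarrow> bool" where
  "satisfiable_in_y c k D x \<longleftrightarrow> (\<exists>y \<in> strings (k ^ c). ceval D (x @ y) = [True])"

definition cert_solution :: "nat \<Rightarrow> nat \<Rightarrow> circuit \<Rightarrow> fm \<Rightarrow> bool" where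
  "cert_solution c k D A \<longleftrightarrow> length (code A) = k \<and>
     (falsifiable A \<and> satisfiable_in_y c k D (code A) \<or>
      tautology A \<and> \<not> satisfiable_in_y c k D (code A))"


section \<open>One-way permutations\<close>

definition one_way_at :: "(bool list \<Rightarrow> bool list) \<Rightarrow> real \<Rightarrow> real \<Rightarrow> nat \<Rightarrow> bool" where
  "one_way_at h \<epsilon> t l \<longleftrightarrow>
     (\<forall>D. is_circuit l l D \<and> real (csize D) \<le> t \<longrightarrow> unif_prob l (\<lambda>v. ceval D (h v) = v) \<le> \<epsilon>)"

definition exp_hard_owp :: "(bool list \<Rightarrow> bool list) \<Rightarrow> bool" where
  "exp_hard_owp h \<longleftrightarrow> polytime_fun h \<and> (\<forall>l. bij_betw h (strings l) (strings l)) \<and>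
     (\<exists>\<gamma>>0. \<forall>\<^sub>F l in sequentially.
        one_way_at h (2 powr - (real l powr \<gamma>)) (2 powr (real l powr \<gamma>)) l)"


section \<open>Functions in NP and coNP, and their hardness\<close>

definition NPcoNP_unique :: "(bool list \<Rightarrow> bool) \<Rightarrow> bool" where
  "NPcoNP_unique f \<longleftrightarrow>
     (\<exists>F c. (\<forall>a. polytime_rel (F a)) \<and>
        (\<forall>a u. f u = a \<longleftrightarrow> (\<exists>y. length y \<le> length u ^ c \<and> F a u y)) \<and>
        (\<forall>u. \<exists>!y. length y \<le> length u ^ c \<and> F (f u) u y))"

definition hard_at :: "(bool list \<Rightarrow> bool) \<Rightarrow> real \<Rightarrow> nat \<Rightarrow> nat \<Rightarrow> bool" where
  "hard_at f \<epsilon> S l \<longleftrightarrow>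
     (\<forall>C. is_circuit l 1 C \<and> csize C \<le> S \<longrightarrow> unif_prob l (\<lambda>u. ceval C u = [f u]) < 1 / 2 + \<epsilon> / 2)"

text \<open>The set is finite, because some circuit computes \<open>f\<close> on inputs of length \<open>l\<close>; hence the
  supremum is its maximum, and it is \<open>0\<close> if the set is empty.\<close>

definition hardness :: "(bool list \<Rightarrow> bool) \<Rightarrow> nat \<Rightarrow> nat" where
  "hardness f l = Sup {S. S \<ge> 1 \<and> hard_at f (1 / real S) S l}"

definition exp_hard :: "(bool list \<Rightarrow> bool) \<Rightarrow> bool" where
  "exp_hard f \<longleftrightarrow> (\<exists>\<gamma>>0. \<forall>\<^sub>F l in sequentially. 2 powr (real l powr \<gamma>) \<le> real (hardness f l))"


section \<open>Nisan--Wigderson generators\<close>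

text \<open>Rounding: \<open>n\<^sup>1\<^sup>/\<^sup>3\<close> and \<open>n\<^sup>\<delta>\<close> are rounded down. Thus \<open>m\<close> is a power of two and
  \<open>d = log m\<close> holds exactly. The sets \<open>[n]\<close> and \<open>[m]\<close> are \<open>{0..<n}\<close> and \<open>{0..<m}\<close>.\<close>

definition nw_l :: "nat \<Rightarrow> nat" where
  "nw_l n = nat \<lfloor>real n powr (1 / 3)\<rfloor>"

definition nw_d :: "real \<Rightarrow> nat \<Rightarrow> nat" where
  "nw_d \<delta> n = nat \<lfloor>real n powr \<delta>\<rfloor>"

definition nw_m :: "real \<Rightarrow> nat \<Rightarrow> nat" where
  "nw_m \<delta> n = 2 ^ nw_d \<delta> n"

definition design :: "nat \<Rightarrow> nat \<Rightarrow> nat \<Rightarrow> nat \<Rightarrow> (nat \<Rightarrow> nat set) \<Rightarrow> bool" where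
  "design d l n m J \<longleftrightarrow>
     (\<forall>i<m. J i \<subseteq> {0..<n} \<and> card (J i) = l) \<and>
     (\<forall>i<m. \<forall>j<m. i \<noteq> j \<longrightarrow> card (J i \<inter> J j) \<le> d)"

definition char_vec :: "nat \<Rightarrow> nat set \<Rightarrow> bool list" where
  "char_vec n J = map (\<lambda>j. j \<in> J) [0..<n]"

text \<open>\<open>A \<delta> n i\<close> is the set \<open>J\<^sub>i\<close> of the design \<open>A\<^sub>n\<close> for the parameter \<open>\<delta>\<close>. In the
  second clause the machine runs in time polynomial in \<open>n + m\<close>, which is the same as \<open>m\<^sup>O\<^sup>(\<^sup>1\<^sup>)\<close>
  because \<open>\<delta>\<close> is a constant.\<close>

definition design_family :: "(real \<Rightarrow> nat \<Rightarrow> nat \<Rightarrow> nat set) \<Rightarrow> bool" where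
  "design_family A \<longleftrightarrow> (\<forall>\<delta>. 0 < \<delta> \<and> \<delta> \<le> 1 / 3 \<longrightarrow>
     (\<forall>n\<ge>1. design (nw_d \<delta> n) (nw_l n) n (nw_m \<delta> n) (A \<delta> n)) \<and>
     polytime {([ones n, ones (nw_m \<delta> n)],
                concat (map (\<lambda>i. char_vec n (A \<delta> n i)) [0..<nw_m \<delta> n])) | n. n \<ge> 1} \<and>
     polytime {([bin (nw_d \<delta> n) i, ones n], char_vec n (A \<delta> n i)) | n i. n \<ge> 1 \<and> i < nw_m \<delta> n})"

definition NW :: "(nat \<Rightarrow> nat set) \<Rightarrow> nat \<Rightarrow> (bool list \<Rightarrow> bool) \<Rightarrow> bool list \<Rightarrow> bool list" where
  "NW J m f x = map (\<lambda>i. f (nths x (J i))) [0..<m]"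

definition Rng_NW :: "(real \<Rightarrow> nat \<Rightarrow> nat \<Rightarrow> nat set) \<Rightarrow> real \<Rightarrow> nat \<Rightarrow> (bool list \<Rightarrow> bool) \<Rightarrow>
    bool list set" where
  "Rng_NW A \<delta> n f = NW (A \<delta> n) (nw_m \<delta> n) f ` strings n"

definition Conjecture_NW :: "(real \<Rightarrow> nat \<Rightarrow> nat \<Rightarrow> nat set) \<Rightarrow> bool" where
  "Conjecture_NW A \<longleftrightarrow>
     (\<forall>f. NPcoNP_unique f \<and> exp_hard f \<longrightarrow>
        (\<exists>\<delta>. 0 < \<delta> \<and> \<delta> \<le> 1 / 3 \<and>
           (\<forall>R. NP_set R \<and> infinite R \<and>
                infinite {b \<in> R. \<exists>n\<ge>1. length b = nw_m \<delta> n} \<longrightarrow>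
                (\<exists>n\<ge>1. Rng_NW A \<delta> n f \<inter> R \<noteq> {}))))"

end

(* The Goldreich-Levin bit f of a one-way permutation h, f(u) = <h^-1(u0), u1> where u0 and u1 are
   interleaved in u, lies in NP and coNP with unique witnesses h^-1(u0), and it is exponentially
   hard. Let b_k be the string of length 2^(2k) whose entry at the index (a, x), |a| = |x| = k, is
   the conjunction of the values of the formula x under the assignments up to a; its entries with
   a = 1...1 tell which formulas of size k are tautologies. As consecutive entries are linked by a
   counter, the set of the b_k with k >= k0 is decidable in time polynomial in the length of b_k,
   and NW yields some b_k = NW(z). Then a formula x is a tautology iff f(z(J_i)) = 1 for the index
   i = (1...1, x). The circuit D(x, y) with z hardwired that computes z(J_i) and tests whether y
   contains a witness for f(z(J_i)) = 1 has size polynomial in n, hence in k, since 2k is n^delta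
   rounded down. It accepts some y iff x is a tautology, so Cert has no solution on D. *)

theory Submission imports Defs "HOL-Real_Asymp.Real_Asymp"
begin

section \<open>Circuits\<close>

text \<open>The conjecture promises an intersection for some n only, for each NP set separately.
  Infinitely many k are obtained by applying it once for every lower bound \<open>k0\<close>. This
  works because \<delta>, and with it the exponent \<open>c\<close>, depends only on the designs and
  on h and is fixed before the set is chosen. The two polynomial bounds in n, one on the witnesses
  and one on the size of D, are met by one large \<open>c\<close>; circuits are padded to the exact
  size. Assignments of k bits suffice in the table, since a code of size k already has room for the
  names of all its variables. Interleaving u0 and u1 spares a machine the search for the middle of
  u; at odd lengths f ignores the last bit. Polynomial time refers to concrete Turing machines, so
  machines are treated from both sides: arbitrary ones are simulated by circuits, while the
  verifiers for witnesses of f and for tables are programmed, the latter as a program on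
  stacks.\<close>

definition wires :: "bool list \<Rightarrow> gate list \<Rightarrow> bool list" where
  "wires u gs = foldl (\<lambda>ws g. ws @ [gate_val ws g]) u gs"

lemma wires_Nil [simp]: "wires u [] = u"
  and wires_snoc [simp]: "wires u (gs @ [g]) = wires u gs @ [gate_val (wires u gs) g]"
  by (simp_all add: wires_def)

lemma length_wires [simp]: "length (wires u gs) = length u + length gs"
  by (induction gs rule: rev_induct) auto

lemma nth_wires_append: "i < length u + length gs \<Longrightarrow> wires u (gs @ gs') ! i = wires u gs ! i"
proof (induction gs' rule: rev_induct)
  case (snoc g gs')
  then show ?case by (simp add: nth_append flip: append_assoc)
qed simp

lemma ceval_wires: "ceval C u = map ((!) (wires u (gates C))) (outs C)"
  by (simp add: ceval_def wires_def Let_def)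

definition wf_gates :: "nat \<Rightarrow> gate list \<Rightarrow> bool" where
  "wf_gates n gs \<longleftrightarrow> (\<forall>j < length gs. gate_wires (gs ! j) \<subseteq> {..<n + j})"

lemma wf_gates_Nil [simp]: "wf_gates n []"
  by (simp add: wf_gates_def)

lemma wf_gates_snoc [simp]:
  "wf_gates n (gs @ [g]) \<longleftrightarrow> wf_gates n gs \<and> gate_wires g \<subseteq> {..<n + length gs}"
  by (auto simp: wf_gates_def nth_append less_Suc_eq)

text \<open>The domain is abstract so that inputs may carry structure, for instance pairs of a
  formula and a witness that only \<open>enc\<close> concatenates. Functions have to be right on
  \<open>X\<close> alone, so promises about the inputs need not be tested by the circuits.\<close>

locale encoded_domain =
  fixes n :: nat and enc :: "'a \<Rightarrow> bool list" and X :: "'a set"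
  assumes length_enc: "x \<in> X \<Longrightarrow> length (enc x) = n"
begin

definition computed :: "gate list \<Rightarrow> ('a \<Rightarrow> bool) set" where
  "computed gs = {f. \<exists>i < n + length gs. \<forall>x\<in>X. wires (enc x) gs ! i = f x}"

lemma computedE:
  assumes "f \<in> computed gs"
  obtains i where "i < n + length gs" "\<And>x. x \<in> X \<Longrightarrow> wires (enc x) gs ! i = f x"
  using assms by (auto simp: computed_def)

lemma computed_append: "computed gs \<subseteq> computed (gs @ gs')"
proof
  fix f assume "f \<in> computed gs"
  then obtain i where i: "i < n + length gs" "\<forall>x\<in>X. wires (enc x) gs ! i = f x"
    by (auto simp: computed_def)
  then have "\<forall>x\<in>X. wires (enc x) (gs @ gs') ! i = f x"
    by (auto simp: nth_wires_append length_enc)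
  with i(1) show "f \<in> computed (gs @ gs')"
    by (auto simp: computed_def intro!: exI[of _ i])
qed

text \<open>Circuits only ever grow at their end, so no wire has to be renumbered.\<close>

definition ext :: "nat \<Rightarrow> ('a \<Rightarrow> bool) set \<Rightarrow> ('a \<Rightarrow> bool) set \<Rightarrow> bool" where
  "ext k F G \<longleftrightarrow> (\<forall>gs. wf_gates n gs \<and> F \<subseteq> computed gs \<longrightarrow>
     (\<exists>gs'. wf_gates n (gs @ gs') \<and> length gs' \<le> k \<and> G \<subseteq> computed (gs @ gs')))"

lemma extI:
  assumes "\<And>gs. wf_gates n gs \<Longrightarrow> F \<subseteq> computed gs \<Longrightarrow>
     \<exists>gs'. wf_gates n (gs @ gs') \<and> length gs' \<le> k \<and> G \<subseteq> computed (gs @ gs')"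
  shows "ext k F G"
  using assms by (auto simp: ext_def)

lemma extE:
  assumes "ext k F G" "wf_gates n gs" "F \<subseteq> computed gs"
  obtains gs' where "wf_gates n (gs @ gs')" "length gs' \<le> k" "G \<subseteq> computed (gs @ gs')"
  using assms by (auto simp: ext_def)

lemma ext_subset: "G \<subseteq> F \<Longrightarrow> ext k F G"
  by (rule extI, rule exI[of _ "[]"]) auto

lemma ext_mono: "ext k F G \<Longrightarrow> k \<le> k' \<Longrightarrow> F \<subseteq> F' \<Longrightarrow> G' \<subseteq> G \<Longrightarrow> ext k' F' G'"
  unfolding ext_def
proof (intro allI impI)
  fix gs
  assume *: "\<forall>gs. wf_gates n gs \<and> F \<subseteq> computed gs \<longrightarrow>
     (\<exists>gs'. wf_gates n (gs @ gs') \<and> length gs' \<le> k \<and> G \<subseteq> computed (gs @ gs'))"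
    and "k \<le> k'" "F \<subseteq> F'" "G' \<subseteq> G" "wf_gates n gs \<and> F' \<subseteq> computed gs"
  moreover from this obtain gs' where "wf_gates n (gs @ gs')" "length gs' \<le> k" "G \<subseteq> computed (gs @ gs')"
    by blast
  ultimately show "\<exists>gs'. wf_gates n (gs @ gs') \<and> length gs' \<le> k' \<and> G' \<subseteq> computed (gs @ gs')"
    by (intro exI[of _ gs']) auto
qed

text \<open>Only values on \<open>X\<close> count. Hence a Boolean combination of wires may be
  replaced by any predicate that agrees with it on \<open>X\<close>; this is how facts about
  machines and designs enter.\<close>

lemma ext_cong:
  assumes "ext k F G" "\<And>g. g \<in> G' \<Longrightarrow> \<exists>g'\<in>G. \<forall>x\<in>X. g' x = g x"
  shows "ext k F G'"
proof (rule extI)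
  fix gs assume "wf_gates n gs" "F \<subseteq> computed gs"
  with assms(1) obtain gs' where gs': "wf_gates n (gs @ gs')" "length gs' \<le> k"
    "G \<subseteq> computed (gs @ gs')"
    by (rule extE)
  have "G' \<subseteq> computed (gs @ gs')"
  proof
    fix g assume "g \<in> G'"
    then obtain g' where "g' \<in> G" "\<forall>x\<in>X. g' x = g x" using assms(2) by blast
    then show "g \<in> computed (gs @ gs')"
      using gs'(3) by (force simp: computed_def)
  qed
  with gs' show "\<exists>gs'. wf_gates n (gs @ gs') \<and> length gs' \<le> k \<and> G' \<subseteq> computed (gs @ gs')"
    by blast
qed

lemma ext_cong1: "ext k F {f} \<Longrightarrow> (\<And>x. x \<in> X \<Longrightarrow> f x = g x) \<Longrightarrow> ext k F {g}"
  by (erule ext_cong) auto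

text \<open>Appended gates leave the old wires intact, so the second extension may use
  \<open>F\<close> as well as \<open>G\<close>, and \<open>G\<close> is still available at the
  end.\<close>

lemma ext_trans:
  assumes "ext k F G" "ext k' (F \<union> G) H"
  shows "ext (k + k') F (G \<union> H)"
proof (rule extI)
  fix gs assume gs: "wf_gates n gs" "F \<subseteq> computed gs"
  with assms(1) obtain gs' where gs': "wf_gates n (gs @ gs')" "length gs' \<le> k"
    "G \<subseteq> computed (gs @ gs')"
    by (rule extE)
  have "F \<union> G \<subseteq> computed (gs @ gs')"
    using gs(2) gs'(3) computed_append by blast
  with assms(2) gs'(1) obtain hs where "wf_gates n ((gs @ gs') @ hs)" "length hs \<le> k'"
    "H \<subseteq> computed ((gs @ gs') @ hs)"
    by (rule extE)
  moreover from this gs'(3) have "G \<subseteq> computed ((gs @ gs') @ hs)"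
    using computed_append by blast
  ultimately show "\<exists>gs'. wf_gates n (gs @ gs') \<and> length gs' \<le> k + k' \<and> G \<union> H \<subseteq> computed (gs @ gs')"
    using gs'(2) by (intro exI[of _ "gs' @ hs"]) auto
qed

lemma ext_comp: "ext k F G \<Longrightarrow> ext k' G H \<Longrightarrow> ext (k + k') F H"
proof -
  assume "ext k F G" and "ext k' G H"
  then have "ext k' (F \<union> G) H" by (elim ext_mono) auto
  with \<open>ext k F G\<close> have "ext (k + k') F (G \<union> H)" by (rule ext_trans)
  then show ?thesis by (elim ext_mono) auto
qed

lemma ext_Un: "ext k F G \<Longrightarrow> ext k' F H \<Longrightarrow> ext (k + k') F (G \<union> H)"
  by (rule ext_trans) (auto elim: ext_mono)

lemma ext_UN:
  assumes "finite I" "\<And>i. i \<in> I \<Longrightarrow> ext k F (G i)"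
  shows "ext (card I * k) F (\<Union>i\<in>I. G i)"
  using assms
proof (induction I rule: finite_induct)
  case (insert i I)
  then show ?case using ext_Un[of k F "G i" "card I * k" "\<Union>i\<in>I. G i"] by simp
qed (simp add: ext_subset)

lemma ext_gate:
  assumes "\<And>gs. F \<subseteq> computed gs \<Longrightarrow> \<exists>g. gate_wires g \<subseteq> {..<n + length gs} \<and>
      (\<forall>x\<in>X. gate_val (wires (enc x) gs) g = f x)"
  shows "ext 1 F {f}"
proof (rule extI)
  fix gs assume gs: "wf_gates n gs" "F \<subseteq> computed gs"
  then obtain g where g: "gate_wires g \<subseteq> {..<n + length gs}"
    "\<forall>x\<in>X. gate_val (wires (enc x) gs) g = f x"
    using assms by blast
  have "\<forall>x\<in>X. wires (enc x) (gs @ [g]) ! (n + length gs) = f x"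
    using g(2) by (auto simp: nth_append length_enc)
  then have "f \<in> computed (gs @ [g])"
    by (auto simp: computed_def)
  with g gs show "\<exists>gs'. wf_gates n (gs @ gs') \<and> length gs' \<le> 1 \<and> {f} \<subseteq> computed (gs @ gs')"
    by (intro exI[of _ "[g]"]) auto
qed

lemma ext_const: "ext 1 F {\<lambda>x. b}"
  by (rule ext_gate) (auto intro!: exI[of _ "Const b"])

lemma ext_not1: "f \<in> F \<Longrightarrow> ext 1 F {\<lambda>x. \<not> f x}"
proof (rule ext_gate)
  fix gs assume "f \<in> F" "F \<subseteq> computed gs"
  then obtain i where "i < n + length gs" "\<forall>x\<in>X. wires (enc x) gs ! i = f x"
    by (auto simp: computed_def)
  then show "\<exists>g. gate_wires g \<subseteq> {..<n + length gs} \<and>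
      (\<forall>x\<in>X. gate_val (wires (enc x) gs) g = (\<not> f x))"
    by (intro exI[of _ "Neg i"]) auto
qed

lemma ext_binary1:
  assumes "f \<in> F" "g \<in> F"
  shows "ext 1 F {\<lambda>x. f x \<and> g x}" "ext 1 F {\<lambda>x. f x \<or> g x}"
proof -
  have *: "\<exists>i j. i < n + length gs \<and> j < n + length gs \<and>
    (\<forall>x\<in>X. wires (enc x) gs ! i = f x \<and> wires (enc x) gs ! j = g x)" if "F \<subseteq> computed gs" for gs
  proof -
    from that assms have "f \<in> computed gs" "g \<in> computed gs" by auto
    then show ?thesis by (elim computedE) blast
  qed
  show "ext 1 F {\<lambda>x. f x \<and> g x}"
  proof (rule ext_gate)
    fix gs assume "F \<subseteq> computed gs"
    from *[OF this] obtain i j where "i < n + length gs" "j < n + length gs"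
      "\<forall>x\<in>X. wires (enc x) gs ! i = f x \<and> wires (enc x) gs ! j = g x" by blast
    then show "\<exists>h. gate_wires h \<subseteq> {..<n + length gs} \<and>
        (\<forall>x\<in>X. gate_val (wires (enc x) gs) h = (f x \<and> g x))"
      by (intro exI[of _ "Conj i j"]) auto
  qed
  show "ext 1 F {\<lambda>x. f x \<or> g x}"
  proof (rule ext_gate)
    fix gs assume "F \<subseteq> computed gs"
    from *[OF this] obtain i j where "i < n + length gs" "j < n + length gs"
      "\<forall>x\<in>X. wires (enc x) gs ! i = f x \<and> wires (enc x) gs ! j = g x" by blast
    then show "\<exists>h. gate_wires h \<subseteq> {..<n + length gs} \<and>
        (\<forall>x\<in>X. gate_val (wires (enc x) gs) h = (f x \<or> g x))"
      by (intro exI[of _ "Disj i j"]) auto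
  qed
qed

lemma ext_not: "ext k F {f} \<Longrightarrow> ext (k + 1) F {\<lambda>x. \<not> f x}"
  using ext_comp[OF _ ext_not1, of k F "{f}" f] by simp

lemma ext_conj: "ext k F {f} \<Longrightarrow> ext k' F {g} \<Longrightarrow> ext (k + k' + 1) F {\<lambda>x. f x \<and> g x}"
  using ext_comp[OF ext_Un ext_binary1(1), of k F "{f}" k' "{g}" f g] by simp

lemma ext_disj: "ext k F {f} \<Longrightarrow> ext k' F {g} \<Longrightarrow> ext (k + k' + 1) F {\<lambda>x. f x \<or> g x}"
  using ext_comp[OF ext_Un ext_binary1(2), of k F "{f}" k' "{g}" f g] by simp

lemma ext_Bex:
  assumes "finite I" "\<And>i. i \<in> I \<Longrightarrow> ext k F {f i}"
  shows "ext (card I * (k + 1) + 1) F {\<lambda>x. \<exists>i\<in>I. f i x}"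
  using assms
proof (induction I rule: finite_induct)
  case empty
  then show ?case using ext_const[of F False] by simp
next
  case (insert i I)
  then have "ext (k + (card I * (k + 1) + 1) + 1) F {\<lambda>x. f i x \<or> (\<exists>i\<in>I. f i x)}"
    by (intro ext_disj) auto
  then show ?case using insert by (simp add: algebra_simps)
qed

lemma ext_Ball:
  assumes "finite I" "\<And>i. i \<in> I \<Longrightarrow> ext k F {f i}"
  shows "ext (card I * (k + 1) + 1) F {\<lambda>x. \<forall>i\<in>I. f i x}"
  using assms
proof (induction I rule: finite_induct)
  case empty
  then show ?case using ext_const[of F True] by simp
next
  case (insert i I)
  then have "ext (k + (card I * (k + 1) + 1) + 1) F {\<lambda>x. f i x \<and> (\<forall>i\<in>I. f i x)}"
    by (intro ext_conj) auto
  then show ?case using insert by (simp add: algebra_simps)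
qed

text \<open>Shannon expansion on the first variable. Exponential size is acceptable here, as the
  bound only serves to cap the hardness of a function.\<close>

lemma ext_fun: "set fs \<subseteq> F \<Longrightarrow> ext (6 * 2 ^ length fs) F {\<lambda>x. \<phi> (map (\<lambda>f. f x) fs)}"
proof -
  \<comment> \<open>The induction needs the bound lowered by 4: one expansion turns size k into 2 *
    k + 4, and k = 6 * 2^j - 4 solves this recursion.\<close>
  have "set fs \<subseteq> F \<Longrightarrow> ext (6 * 2 ^ length fs - 4) F {\<lambda>x. \<phi> (map (\<lambda>f. f x) fs)}"
  proof (induction fs arbitrary: \<phi>)
    case Nil
    then show ?case using ext_mono[OF ext_const[of F "\<phi> []"], of 2] by simp
  next
    case (Cons f fs)
    let ?k = "6 * 2 ^ length fs - 4 :: nat"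
    have f: "ext 0 F {f}" using Cons.prems by (intro ext_subset) auto
    have IH: "ext ?k F {\<lambda>x. \<phi> (b # map (\<lambda>f. f x) fs)}" for b
      using Cons.IH[of "\<lambda>xs. \<phi> (b # xs)"] Cons.prems by simp
    have "ext ((0 + ?k + 1) + (0 + 1 + ?k + 1) + 1) F
      {\<lambda>x. (f x \<and> \<phi> (True # map (\<lambda>f. f x) fs)) \<or> (\<not> f x \<and> \<phi> (False # map (\<lambda>f. f x) fs))}"
      by (intro ext_disj ext_conj ext_not f IH)
    then have "ext ((0 + ?k + 1) + (0 + 1 + ?k + 1) + 1) F {\<lambda>x. \<phi> (map (\<lambda>f. f x) (f # fs))}"
    proof (rule ext_cong1)
      fix x
      show "((f x \<and> \<phi> (True # map (\<lambda>f. f x) fs)) \<or> (\<not> f x \<and> \<phi> (False # map (\<lambda>f. f x) fs)))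
         = \<phi> (map (\<lambda>f. f x) (f # fs))"
        by (cases "f x") auto
    qed
    moreover have "(0 + ?k + 1) + (0 + 1 + ?k + 1) + 1 \<le> 6 * 2 ^ length (f # fs) - 4"
    proof -
      have "1 \<le> (2::nat) ^ length fs" by simp
      then show ?thesis unfolding length_Cons power_Suc by linarith
    qed
    ultimately show ?case by (rule ext_mono) auto
  qed
  then show "set fs \<subseteq> F \<Longrightarrow> ?thesis" by (rule ext_mono) auto
qed

text \<open>A given circuit is spliced in behind arbitrary wires, which need be neither adjacent nor
  distinct. Its wires are therefore tracked as the functions \<open>W j i\<close> that they compute
  and not by their numbers.\<close>

lemma ext_ceval:
  assumes "is_circuit p m C" "length fs = p" "set fs \<subseteq> F"
  shows "ext (csize C) F ((\<lambda>i x. ceval C (map (\<lambda>f. f x) fs) ! i) ` {..<m})"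
proof -
  define w where "w j x = wires (map (\<lambda>f. f x) fs) (take j (gates C))" for j x
  define W where "W j i = (\<lambda>x. w j x ! i)" for j i
  have "ext j F (W j ` {..<p + j})" if "j \<le> csize C" for j
    using that
  proof (induction j)
    case 0
    have "W 0 ` {..<p + 0} \<subseteq> F"
      using assms(2,3) by (auto simp: subset_iff W_def w_def)
    then show ?case by (rule ext_subset)
  next
    case (Suc j)
    define g where "g = gates C ! j"
    let ?G = "W j ` {..<p + j}" and ?v = "\<lambda>x. gate_val (w j x) g"
    have w_Suc: "w (Suc j) x = w j x @ [?v x]" for x
      using Suc.prems by (simp add: take_Suc_conv_app_nth g_def csize_def w_def)
    have len: "length (w j x) = p + j" for x
      using Suc.prems assms(2) by (simp add: csize_def w_def)
    have gw: "gate_wires g \<subseteq> {..<p + j}"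
      using assms(1) Suc.prems by (auto simp: is_circuit_def g_def csize_def Suc_le_eq)
    have mem: "W j i \<in> ?G" if "i < p + j" for i
      using that by auto
    have gx: "ext 1 ?G {?v}"
    proof (cases g)
      case (Const b)
      then show ?thesis using ext_const by simp
    next
      case (Neg i)
      then show ?thesis using gw ext_not1[OF mem] by (simp add: W_def)
    next
      case (Conj i i')
      then show ?thesis using gw ext_binary1(1)[OF mem mem] by (simp add: W_def)
    next
      case (Disj i i')
      then show ?thesis using gw ext_binary1(2)[OF mem mem] by (simp add: W_def)
    qed
    have "ext j F ?G" using Suc by simp
    moreover have "ext 1 (F \<union> ?G) {?v}" by (rule ext_mono[OF gx]) auto
    ultimately have "ext (j + 1) F (?G \<union> {?v})" by (rule ext_trans)
    moreover have "W (Suc j) ` {..<p + Suc j} \<subseteq> ?G \<union> {?v}"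
    proof (rule image_subsetI)
      fix i assume "i \<in> {..<p + Suc j}"
      then consider "i < p + j" | "i = p + j" by fastforce
      then show "W (Suc j) i \<in> ?G \<union> {?v}"
      proof cases
        case 1
        then have "W (Suc j) i = W j i"
          by (simp add: W_def w_Suc nth_append len)
        with mem[OF 1] show ?thesis by simp
      qed (simp add: W_def w_Suc nth_append len)
    qed
    ultimately show ?case by (simp add: ext_mono[OF _ order_refl order_refl])
  qed
  from this[of "csize C"]
  have "ext (csize C) F (W (csize C) ` {..<p + csize C})"
    by simp
  moreover have "(\<lambda>i x. ceval C (map (\<lambda>f. f x) fs) ! i) ` {..<m} \<subseteq> W (csize C) ` {..<p + csize C}"
  proof (rule image_subsetI)
    fix i assume i: "i \<in> {..<m}"
    then have "outs C ! i < p + csize C"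
      using assms(1) by (auto simp: is_circuit_def csize_def dest!: nth_mem)
    moreover have "(\<lambda>x. ceval C (map (\<lambda>f. f x) fs) ! i) = W (csize C) (outs C ! i)"
      using i assms(1) by (simp add: ceval_wires is_circuit_def W_def w_def csize_def)
    ultimately show "(\<lambda>x. ceval C (map (\<lambda>f. f x) fs) ! i) \<in> W (csize C) ` {..<p + csize C}"
      by simp
  qed
  ultimately show ?thesis by (simp add: ext_mono[OF _ order_refl order_refl])
qed

lemma ext_circuit:
  assumes "ext k ((\<lambda>i x. enc x ! i) ` {..<n}) (set fs)" "k \<le> s"
  shows "\<exists>C. is_circuit n (length fs) C \<and> csize C = s \<and> (\<forall>x\<in>X. ceval C (enc x) = map (\<lambda>f. f x) fs)"
proof -
  have "(\<lambda>i x. enc x ! i) ` {..<n} \<subseteq> computed []"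
  proof (rule image_subsetI)
    fix i assume "i \<in> {..<n}"
    then show "(\<lambda>x. enc x ! i) \<in> computed []"
      unfolding computed_def by (intro CollectI exI[of _ i]) simp
  qed
  then obtain gs where gs: "wf_gates n ([] @ gs)" "length gs \<le> k" "set fs \<subseteq> computed ([] @ gs)"
    by (rule extE[OF assms(1) wf_gates_Nil])
  note gs = gs[unfolded append_Nil]
  define gs' where "gs' = gs @ replicate (s - length gs) (Const True)"
  have len: "length gs' = s" using gs(2) assms(2) by (simp add: gs'_def)
  have wf: "wf_gates n gs'"
    using gs(1) unfolding wf_gates_def gs'_def by (simp add: nth_append)
  have "set fs \<subseteq> computed gs'"
    using gs(3) computed_append unfolding gs'_def by (rule order_trans)
  then have "\<forall>f\<in>set fs. \<exists>i<n + s. \<forall>x\<in>X. wires (enc x) gs' ! i = f x"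
    unfolding computed_def len by blast
  then obtain w where w: "\<And>f. f \<in> set fs \<Longrightarrow> w f < n + s"
    "\<And>f x. f \<in> set fs \<Longrightarrow> x \<in> X \<Longrightarrow> wires (enc x) gs' ! w f = f x"
    unfolding Bex_def bchoice_iff by blast
  have "is_circuit n (length fs) (Circuit gs' (map w fs))"
    using wf w(1) by (auto simp: is_circuit_def wf_gates_def len)
  moreover have "ceval (Circuit gs' (map w fs)) (enc x) = map (\<lambda>f. f x) fs" if "x \<in> X" for x
    using w(2) that by (simp add: ceval_wires)
  ultimately show ?thesis
    using len by (intro exI[of _ "Circuit gs' (map w fs)"]) (simp add: csize_def)
qed

end

section \<open>Simulation of Turing machines by circuits\<close>

text \<open>With base N + 2 instead of N, powers grow with the exponent even at N = 0 and N = 1.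
  Hence constants are absorbed and the class is closed under sums.\<close>

definition poly_bounded :: "(nat \<Rightarrow> nat) \<Rightarrow> bool" where
  "poly_bounded g \<longleftrightarrow> (\<exists>e. \<forall>N. g N \<le> (N + 2) ^ e)"

lemma poly_bounded_mono: "poly_bounded g \<Longrightarrow> (\<And>N. f N \<le> g N) \<Longrightarrow> poly_bounded f"
  unfolding poly_bounded_def by (meson order_trans)

lemma poly_bounded_const [simp]: "poly_bounded (\<lambda>N. c)"
proof -
  have "c \<le> (N + 2) ^ c" for N
  proof -
    have "c \<le> 2 ^ c" by simp
    also have "\<dots> \<le> (N + 2) ^ c" by (rule power_mono) auto
    finally show ?thesis .
  qed
  then show ?thesis unfolding poly_bounded_def by blast
qed

lemma poly_bounded_id [simp]: "poly_bounded (\<lambda>N. N)"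
  by (auto simp: poly_bounded_def intro!: exI[of _ 1])

lemma poly_bounded_mult:
  assumes "poly_bounded f" "poly_bounded g"
  shows "poly_bounded (\<lambda>N. f N * g N)"
proof -
  obtain d e where "\<And>N. f N \<le> (N + 2) ^ d" "\<And>N. g N \<le> (N + 2) ^ e"
    using assms by (auto simp: poly_bounded_def)
  then have "f N * g N \<le> (N + 2) ^ (d + e)" for N
    by (simp only: power_add mult_le_mono)
  then show ?thesis by (auto simp: poly_bounded_def)
qed

lemma poly_bounded_add:
  assumes "poly_bounded f" "poly_bounded g"
  shows "poly_bounded (\<lambda>N. f N + g N)"
proof -
  obtain d e where de: "\<And>N. f N \<le> (N + 2) ^ d" "\<And>N. g N \<le> (N + 2) ^ e"
    using assms by (auto simp: poly_bounded_def)
  have "f N + g N \<le> (N + 2) ^ Suc (d + e)" for N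
  proof -
    have "(N + 2) ^ d \<le> (N + 2) ^ (d + e)" "(N + 2) ^ e \<le> (N + 2) ^ (d + e)"
      by (rule power_increasing; simp)+
    then have "f N + g N \<le> 2 * (N + 2) ^ (d + e)"
      using de[of N] by linarith
    also have "\<dots> \<le> (N + 2) * (N + 2) ^ (d + e)" by (rule mult_right_mono) auto
    finally show ?thesis by simp
  qed
  then show ?thesis unfolding poly_bounded_def by blast
qed

lemma poly_bounded_power: "poly_bounded f \<Longrightarrow> poly_bounded (\<lambda>N. f N ^ a)"
  by (induction a) (auto intro: poly_bounded_mult)

lemma poly_bounded_Suc: "poly_bounded f \<Longrightarrow> poly_bounded (\<lambda>N. Suc (f N))"
  using poly_bounded_add[of f "\<lambda>_. 1"] by simp

lemmas poly_bounded_intros =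
  poly_bounded_const poly_bounded_id poly_bounded_add poly_bounded_mult poly_bounded_power
  poly_bounded_Suc

section \<open>Configurations of a machine and what it sees of them\<close>

definition rd :: "tape \<Rightarrow> bool option" where
  "rd tp = snd tp (fst tp)"

text \<open>In the halting state the machine is made to rewrite what it reads and to stay, so that
  \<open>step\<close> becomes one formula without a case for halting.\<close>

definition next_move :: "tm \<Rightarrow> nat \<Rightarrow> bool option list \<Rightarrow> nat \<times> (bool option \<times> dir) list" where
  "next_move M q ss = (if q < nstates M then trans M q ss else (q, map (\<lambda>s. (s, Stay)) ss))"

lemma act_eq: "act a tp = (move (snd a) (fst tp), (snd tp)(fst tp := fst a))"
  by (cases a; cases tp) simp

lemma step_next_move:
  "step M c = (fst (next_move M (fst c) (map rd (snd c))),
     map2 act (snd (next_move M (fst c) (map rd (snd c)))) (snd c))"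
proof -
  have rd_eq: "rd = (\<lambda>(p, T). T p)"
    by (auto simp: rd_def)
  have stay: "map2 act (map (\<lambda>s. (s, Stay)) (map rd ts)) ts = ts" for ts
    by (induction ts) (auto simp: rd_def)
  obtain q ts where c: "c = (q, ts)" by (cases c)
  show ?thesis
  proof (cases "q < nstates M")
    case True
    then show ?thesis by (simp add: c next_move_def rd_eq case_prod_beta' Let_def)
  next
    case False
    then show ?thesis unfolding c by (simp add: next_move_def stay del: map_map)
  qed
qed

definition tm_view :: "config \<Rightarrow> nat \<times> bool option list" where
  "tm_view c = (fst c, map rd (snd c))"

definition cfg :: "tm \<Rightarrow> bool list list \<Rightarrow> nat \<Rightarrow> config" where
  "cfg M xs t = (step M ^^ t) (init M xs)"

lemma cfg_0: "cfg M xs 0 = init M xs"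
  and cfg_Suc: "cfg M xs (Suc t) = step M (cfg M xs t)"
  by (simp_all add: cfg_def)

lemma next_move_wf:
  assumes "wf_tm M" "q \<le> nstates M" "length ss = ntapes M"
  shows "fst (next_move M q ss) \<le> nstates M" "length (snd (next_move M q ss)) = ntapes M"
  using assms by (auto simp: next_move_def wf_tm_def)

lemma cfg_wf:
  assumes "wf_tm M"
  shows "fst (cfg M xs t) \<le> nstates M \<and> length (snd (cfg M xs t)) = ntapes M"
proof (induction t)
  case 0
  then show ?case by (simp add: cfg_0 init_def)
next
  case (Suc t)
  then show ?case
    using next_move_wf[OF assms, of "fst (cfg M xs t)" "map rd (snd (cfg M xs t))"]
    by (simp add: cfg_Suc step_next_move)
qed

lemma cfg_Suc_tape:
  assumes "wf_tm M" "j < ntapes M"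
  shows "snd (cfg M xs (Suc t)) ! j =
    act (snd (next_move M (fst (tm_view (cfg M xs t))) (snd (tm_view (cfg M xs t)))) ! j)
      (snd (cfg M xs t) ! j)"
  using assms cfg_wf[OF assms(1), of xs t]
    next_move_wf[OF assms(1), of "fst (cfg M xs t)" "map rd (snd (cfg M xs t))"]
  by (simp add: cfg_Suc step_next_move[of M "cfg M xs t"] tm_view_def)

lemma head_bound:
  assumes "wf_tm M" "j < ntapes M"
  shows "\<bar>fst (snd (cfg M xs t) ! j)\<bar> \<le> int t"
proof (induction t)
  case 0
  then show ?case using assms by (simp add: cfg_0 init_def tape_of_def)
next
  case (Suc t)
  have "\<bar>move d p\<bar> \<le> \<bar>p\<bar> + 1" for d p by (cases d) auto
  from this[of "snd (snd (next_move M (fst (tm_view (cfg M xs t))) (snd (tm_view (cfg M xs t)))) ! j)"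
      "fst (snd (cfg M xs t) ! j)"] Suc
  show ?case by (simp add: cfg_Suc_tape[OF assms] act_eq)
qed

text \<open>The next action depends on the view alone. The number of views is a constant of the
  machine and enters the size of the circuit as a factor.\<close>

definition views :: "tm \<Rightarrow> (nat \<times> bool option list) set" where
  "views M = {..nstates M} \<times> {ss. length ss = ntapes M}"

lemma finite_views [simp]: "finite (views M)"
  using finite_lists_length_eq[of "UNIV :: bool option set" "ntapes M"] by (simp add: views_def)

lemma view_in_views: "wf_tm M \<Longrightarrow> tm_view (cfg M xs t) \<in> views M"
  using cfg_wf[of M xs t] by (auto simp: views_def tm_view_def)

text \<open>\<open>B\<close> bounds the distance from the origin of the cells that are taken into account.\<close>

definition view_cost :: "tm \<Rightarrow> nat \<Rightarrow> nat" where
  "view_cost M B = ntapes M * (2 * (2 * B + 1) + 2) + 2"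

text \<open>The dearest bit is a head position, a disjunction over pairs of a cell and a view. The
  summand 6 covers the few extra gates for the content of a cell.\<close>

definition bit_cost :: "tm \<Rightarrow> nat \<Rightarrow> nat" where
  "bit_cost M B = (2 * B + 1) * card (views M) * (view_cost M B + 2) + 6"

definition num_bits :: "tm \<Rightarrow> nat \<Rightarrow> nat" where
  "num_bits M B = (nstates M + 1) + ntapes M * (2 * B + 1) + ntapes M * ((2 * B + 1) * 3)"

definition tm_cost :: "tm \<Rightarrow> nat \<Rightarrow> nat \<Rightarrow> nat" where
  "tm_cost M T B = num_bits M B + T * (num_bits M B * bit_cost M B)"

lemma poly_bounded_tm_cost:
  "poly_bounded T \<Longrightarrow> poly_bounded B \<Longrightarrow> poly_bounded (\<lambda>N. tm_cost M (T N) (B N))"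
  unfolding tm_cost_def num_bits_def bit_cost_def view_cost_def
  by (intro poly_bounded_intros)

context encoded_domain
begin

context
  fixes M :: tm and xs :: "'a \<Rightarrow> bool list list" and B :: nat
  assumes wf: "wf_tm M"
begin

definition St :: "nat \<Rightarrow> nat \<Rightarrow> 'a \<Rightarrow> bool" where
  "St t q x \<longleftrightarrow> fst (cfg M (xs x) t) = q"

definition Hd :: "nat \<Rightarrow> nat \<Rightarrow> int \<Rightarrow> 'a \<Rightarrow> bool" where
  "Hd t j p x \<longleftrightarrow> fst (snd (cfg M (xs x) t) ! j) = p"

definition Cl :: "nat \<Rightarrow> nat \<Rightarrow> int \<Rightarrow> bool option \<Rightarrow> 'a \<Rightarrow> bool" where
  "Cl t j p s x \<longleftrightarrow> snd (snd (cfg M (xs x) t) ! j) p = s"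

definition Vw :: "nat \<Rightarrow> nat \<times> bool option list \<Rightarrow> 'a \<Rightarrow> bool" where
  "Vw t v x \<longleftrightarrow> tm_view (cfg M (xs x) t) = v"

definition cells :: "int set" where "cells = {- int B..int B}"

lemma finite_cells: "finite cells" and card_cells: "card cells = 2 * B + 1"
  by (simp_all add: cells_def)

text \<open>Unary rather than binary notation: there is a wire for each possible state, head
  position and cell content, so that a transition reduces to disjunctions.\<close>

definition Cfg :: "nat \<Rightarrow> ('a \<Rightarrow> bool) set" where
  "Cfg t = (\<Union>q\<in>{..nstates M}. {St t q}) \<union> (\<Union>jp\<in>{..<ntapes M} \<times> cells. {Hd t (fst jp) (snd jp)})
     \<union> (\<Union>jps\<in>{..<ntapes M} \<times> (cells \<times> UNIV). {Cl t (fst jps) (fst (snd jps)) (snd (snd jps))})"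

lemma ext_St: "q \<le> nstates M \<Longrightarrow> ext 0 (Cfg t) {St t q}"
  and ext_Hd: "j < ntapes M \<Longrightarrow> p \<in> cells \<Longrightarrow> ext 0 (Cfg t) {Hd t j p}"
  and ext_Cl: "j < ntapes M \<Longrightarrow> p \<in> cells \<Longrightarrow> ext 0 (Cfg t) {Cl t j p s}"
  by (rule ext_subset; force simp: Cfg_def)+

lemma ext_Cfg:
  assumes "\<And>q. q \<le> nstates M \<Longrightarrow> ext k F {St t q}"
    and "\<And>j p. j < ntapes M \<Longrightarrow> p \<in> cells \<Longrightarrow> ext k F {Hd t j p}"
    and "\<And>j p s. j < ntapes M \<Longrightarrow> p \<in> cells \<Longrightarrow> ext k F {Cl t j p s}"
  shows "ext (num_bits M B * k) F (Cfg t)"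
proof -
  have "card (UNIV :: bool option set) = 3"
    by (simp add: UNIV_option_conv card_image)
  then have eq: "num_bits M B * k = card {..nstates M} * k + card ({..<ntapes M} \<times> cells) * k +
      card ({..<ntapes M} \<times> (cells \<times> (UNIV :: bool option set))) * k"
    by (simp add: num_bits_def card_cells card_cartesian_product algebra_simps)
  show ?thesis unfolding eq Cfg_def
    by (intro ext_Un ext_UN) (auto simp: finite_cells intro: assms)
qed

lemma ext_Vw:
  assumes "t \<le> B" "v \<in> views M"
  shows "ext (view_cost M B) (Cfg t) {Vw t v}"
proof -
  obtain q ss where v: "v = (q, ss)" "q \<le> nstates M" "length ss = ntapes M"
    using assms(2) by (auto simp: views_def)
  have rd: "ext (card cells * (0 + 0 + 1 + 1) + 1) (Cfg t) {\<lambda>x. rd (snd (cfg M (xs x) t) ! j) = s}"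
    if j: "j < ntapes M" for j s
  proof (rule ext_cong1)
    show "ext (card cells * (0 + 0 + 1 + 1) + 1) (Cfg t) {\<lambda>x. \<exists>p\<in>cells. Hd t j p x \<and> Cl t j p s x}"
      using j by (intro ext_Bex ext_conj ext_Hd ext_Cl finite_cells)
    fix x
    have "fst (snd (cfg M (xs x) t) ! j) \<in> cells"
      using head_bound[OF wf j, of "xs x" t] assms(1) by (auto simp: cells_def)
    then show "(\<exists>p\<in>cells. Hd t j p x \<and> Cl t j p s x) = (rd (snd (cfg M (xs x) t) ! j) = s)"
      by (auto simp: Hd_def Cl_def rd_def)
  qed
  have "ext (0 + (card {..<ntapes M} * ((card cells * (0 + 0 + 1 + 1) + 1) + 1) + 1) + 1) (Cfg t)
    {\<lambda>x. St t q x \<and> (\<forall>j\<in>{..<ntapes M}. rd (snd (cfg M (xs x) t) ! j) = ss ! j)}"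
    by (intro ext_conj ext_Ball ext_St v rd) auto
  then have "ext (0 + (card {..<ntapes M} * ((card cells * (0 + 0 + 1 + 1) + 1) + 1) + 1) + 1) (Cfg t)
    {Vw t v}"
  proof (rule ext_cong1)
    fix x
    show "(St t q x \<and> (\<forall>j\<in>{..<ntapes M}. rd (snd (cfg M (xs x) t) ! j) = ss ! j)) = Vw t v x"
      using cfg_wf[OF wf, of "xs x" t] v
      by (auto simp: St_def Vw_def tm_view_def list_eq_iff_nth_eq)
  qed
  then show ?thesis by (rule ext_mono) (auto simp: view_cost_def card_cells)
qed

lemma ext_Bex_le:
  assumes "finite I" "I \<subseteq> I'" "finite I'" "\<And>i. i \<in> I \<Longrightarrow> ext k F {f i}"
  shows "ext (card I' * (k + 1) + 1) F {\<lambda>x. \<exists>i\<in>I. f i x}"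
proof -
  have "ext (card I * (k + 1) + 1) F {\<lambda>x. \<exists>i\<in>I. f i x}"
    using assms(1,4) by (rule ext_Bex)
  moreover have "card I * (k + 1) + 1 \<le> card I' * (k + 1) + 1"
    using card_mono[OF assms(3,2)] by (intro add_right_mono mult_right_mono) auto
  ultimately show ?thesis by (simp add: ext_mono[OF _ _ order_refl order_refl])
qed

text \<open>The tableau argument of Cook and Levin. A new state or head position is a disjunction
  over the views, and old positions, that lead to it; a cell keeps its content unless the head is on
  it.\<close>

lemma ext_Cfg_Suc:
  assumes t: "t \<le> B"
  shows "ext (num_bits M B * bit_cost M B) (Cfg t) (Cfg (Suc t))"
proof (rule ext_Cfg)
  let ?vc = "view_cost M B" and ?V = "views M"
  let ?nx = "\<lambda>v. next_move M (fst v) (snd v)"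
  have view: "tm_view (cfg M (xs x) t) \<in> ?V" for x by (rule view_in_views[OF wf])
  have small: "card ?V * (?vc + 1) + 5 \<le> bit_cost M B"
    by (simp add: bit_cost_def add_mult_distrib add_mult_distrib2)
  {
    fix q assume "q \<le> nstates M"
    have "ext (card ?V * (?vc + 1) + 1) (Cfg t) {\<lambda>x. \<exists>v\<in>{v \<in> ?V. fst (?nx v) = q}. Vw t v x}"
      using t by (intro ext_Bex_le ext_Vw) auto
    then have "ext (card ?V * (?vc + 1) + 1) (Cfg t) {St (Suc t) q}"
    proof (rule ext_cong1)
      fix x
      show "(\<exists>v\<in>{v \<in> ?V. fst (?nx v) = q}. Vw t v x) = St (Suc t) q x"
        using view[of x] by (auto simp: Vw_def St_def cfg_Suc step_next_move tm_view_def)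
    qed
    then show "ext (bit_cost M B) (Cfg t) {St (Suc t) q}"
      by (rule ext_mono) (use small in auto)
  next
    fix j p assume j: "j < ntapes M" and p: "p \<in> cells"
    let ?I = "{pv \<in> cells \<times> ?V. move (snd (snd (?nx (snd pv)) ! j)) (fst pv) = p}"
    have "ext (card (cells \<times> ?V) * ((0 + ?vc + 1) + 1) + 1) (Cfg t)
        {\<lambda>x. \<exists>pv\<in>?I. Hd t j (fst pv) x \<and> Vw t (snd pv) x}"
      using t j by (intro ext_Bex_le ext_conj ext_Vw ext_Hd) (auto simp: finite_cells)
    then have "ext (card (cells \<times> ?V) * ((0 + ?vc + 1) + 1) + 1) (Cfg t) {Hd (Suc t) j p}"
    proof (rule ext_cong1)
      fix x
      let ?pv = "(fst (snd (cfg M (xs x) t) ! j), tm_view (cfg M (xs x) t))"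
      have "fst (snd (cfg M (xs x) t) ! j) \<in> cells"
        using head_bound[OF wf j, of "xs x" t] t by (auto simp: cells_def)
      moreover have "Hd t j (fst pv) x \<and> Vw t (snd pv) x \<longleftrightarrow> pv = ?pv" for pv
        by (cases pv) (auto simp: Hd_def Vw_def)
      ultimately show "(\<exists>pv\<in>?I. Hd t j (fst pv) x \<and> Vw t (snd pv) x) = Hd (Suc t) j p x"
        using view[of x] by (simp add: Hd_def cfg_Suc_tape[OF wf j] act_eq)
    qed
    then show "ext (bit_cost M B) (Cfg t) {Hd (Suc t) j p}"
      by (rule ext_mono) (auto simp: bit_cost_def card_cartesian_product card_cells algebra_simps)
  next
    fix j p s assume j: "j < ntapes M" and p: "p \<in> cells"
    let ?I = "{v \<in> ?V. fst (snd (?nx v) ! j) = s}"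
    have "ext ((0 + 1 + 0 + 1) + (0 + (card ?V * (?vc + 1) + 1) + 1) + 1) (Cfg t)
        {\<lambda>x. (\<not> Hd t j p x \<and> Cl t j p s x) \<or> (Hd t j p x \<and> (\<exists>v\<in>?I. Vw t v x))}"
      using t j p by (intro ext_disj ext_conj ext_not ext_Bex_le ext_Vw ext_Hd ext_Cl) auto
    then have "ext ((0 + 1 + 0 + 1) + (0 + (card ?V * (?vc + 1) + 1) + 1) + 1) (Cfg t)
        {Cl (Suc t) j p s}"
    proof (rule ext_cong1)
      fix x
      show "((\<not> Hd t j p x \<and> Cl t j p s x) \<or> (Hd t j p x \<and> (\<exists>v\<in>?I. Vw t v x))) = Cl (Suc t) j p s x"
        using view[of x] by (auto simp: Vw_def Hd_def Cl_def cfg_Suc_tape[OF wf j] act_eq)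
    qed
    then show "ext (bit_cost M B) (Cfg t) {Cl (Suc t) j p s}"
      by (rule ext_mono) (use small in auto)
  }
qed

lemma ext_Cfg_steps: "t \<le> B \<Longrightarrow> ext (t * (num_bits M B * bit_cost M B)) (Cfg 0) (Cfg t)"
proof (induction t)
  case (Suc t)
  then have "ext (t * (num_bits M B * bit_cost M B) + num_bits M B * bit_cost M B) (Cfg 0) (Cfg (Suc t))"
    by (intro ext_comp[OF Suc.IH ext_Cfg_Suc]) auto
  then show ?case by (simp add: algebra_simps)
qed (simp add: ext_subset)

lemma ext_Cfg_0:
  assumes len: "\<And>x. x \<in> X \<Longrightarrow> map length (xs x) = Ls"
    and bits: "\<And>j p. j < length Ls \<Longrightarrow> p < Ls ! j \<Longrightarrow> (\<lambda>x. xs x ! j ! p) \<in> F"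
  shows "ext (num_bits M B * 1) F (Cfg 0)"
proof (rule ext_Cfg)
  fix q show "ext 1 F {St 0 q}"
    by (rule ext_cong1[OF ext_const[of F "q = 0"]]) (auto simp: St_def cfg_0 init_def)
next
  fix j p assume "j < ntapes M"
  then show "ext 1 F {Hd 0 j p}"
    by (intro ext_cong1[OF ext_const[of F "p = 0"]]) (auto simp: Hd_def cfg_0 init_def tape_of_def)
next
  fix j p s assume j: "j < ntapes M"
  have cell: "Cl 0 j p s x \<longleftrightarrow> (if j < length Ls \<and> 0 \<le> p \<and> p < int (Ls ! j)
      then Some (xs x ! j ! nat p) else None) = s" if "x \<in> X" for x
  proof -
    have "length (xs x) = length Ls" "j < length Ls \<longrightarrow> length (xs x ! j) = Ls ! j"
      using len[OF that] by (metis length_map, metis length_map nth_map)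
    then show ?thesis using j by (auto simp: Cl_def cfg_0 init_def tape_of_def)
  qed
  show "ext 1 F {Cl 0 j p s}"
  proof (cases "j < length Ls \<and> 0 \<le> p \<and> p < int (Ls ! j)")
    case True
    let ?f = "\<lambda>x. xs x ! j ! nat p"
    have f: "?f \<in> F" using True by (intro bits) auto
    show ?thesis
    proof (cases s)
      case None
      show ?thesis by (rule ext_cong1[OF ext_const[of F False]]) (use cell True None in auto)
    next
      case (Some b)
      show ?thesis
      proof (cases b)
        case True
        have "ext 1 F {?f}" using f by (intro ext_subset) auto
        then show ?thesis
          by (rule ext_cong1) (use cell True Some \<open>j < length Ls \<and> _\<close> in auto)
      next
        case False
        show ?thesis
          by (rule ext_cong1[OF ext_not1[OF f]]) (use cell False Some \<open>j < length Ls \<and> _\<close> in auto)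
      qed
    qed
  next
    case False
    then show ?thesis by (intro ext_cong1[OF ext_const[of F "s = None"]]) (auto simp: cell)
  qed
qed

end

text \<open>The single bound \<open>B\<close> covers both the cells that are within reach in
  \<open>T\<close> steps and the \<open>m\<close> output cells.\<close>

lemma ext_tm:
  assumes wf: "wf_tm M"
    and len: "\<And>x. x \<in> X \<Longrightarrow> map length (xs x) = Ls"
    and bits: "\<And>j p. j < length Ls \<Longrightarrow> p < Ls ! j \<Longrightarrow> (\<lambda>x. xs x ! j ! p) \<in> F"
    and out: "\<And>x. x \<in> X \<Longrightarrow> outputs_within M (xs x) (w x) T \<and> length (w x) = m"
    and B: "T \<le> B" "m \<le> B"
  shows "ext (tm_cost M T B) F ((\<lambda>i x. w x ! i) ` {..<m})"
proof -
  have "ext (num_bits M B * 1 + T * (num_bits M B * bit_cost M B)) F (Cfg M xs B T)"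
    by (rule ext_comp[OF ext_Cfg_0[OF wf len bits] ext_Cfg_steps[OF wf B(1)]])
  then have "ext (tm_cost M T B) F (Cfg M xs B T)"
    by (simp add: tm_cost_def)
  then show ?thesis
  proof (rule ext_cong)
    fix g assume "g \<in> (\<lambda>i x. w x ! i) ` {..<m}"
    then obtain i where i: "i < m" and g: "g = (\<lambda>x. w x ! i)" by (elim imageE) simp
    have r: "0 < ntapes M" using wf by (simp add: wf_tm_def)
    \<comment> \<open>An output bit is 1 iff its cell holds 1 at time \<open>T\<close>, and that
      cell is among those represented because of \<open>m \<le> B\<close>.\<close>
    show "\<exists>g'\<in>Cfg M xs B T. \<forall>x\<in>X. g' x = g x"
    proof (rule bexI[of _ "Cl M xs T 0 (int i) (Some True)"])
      show "Cl M xs T 0 (int i) (Some True) \<in> Cfg M xs B T"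
        using r i B(2) unfolding Cfg_def[OF wf] by (force simp: cells_def[OF wf])
      show "\<forall>x\<in>X. Cl M xs T 0 (int i) (Some True) x = g x"
      proof
        fix x assume "x \<in> X"
        then have "outputs_within M (xs x) (w x) T" "length (w x) = m" using out by auto
        moreover have "snd (cfg M (xs x) T) \<noteq> []"
          using cfg_wf[OF wf, of "xs x" T] r by auto
        ultimately show "Cl M xs T 0 (int i) (Some True) x = g x"
          using i unfolding Cl_def[OF wf] g
          by (simp add: outputs_within_def cfg_def Let_def case_prod_unfold hd_conv_nth)
      qed
    qed
  qed
qed

end

section \<open>The Goldreich--Levin theorem\<close>

lemma finite_strings [simp]: "finite (strings n)"
  using finite_lists_length_eq[of "UNIV :: bool set" n] by (simp add: strings_def)

lemma card_strings: "card (strings n) = 2 ^ n"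
  using card_lists_length_eq[of "UNIV :: bool set" n] by (simp add: strings_def)

lemma unif_prob_eq: "unif_prob l P = real (card {u \<in> strings l. P u}) / 2 ^ l"
proof -
  have "strings l \<noteq> {}" using card_strings[of l] by (metis card.empty power_not_zero zero_neq_numeral)
  then show ?thesis
    by (simp add: measure_pmf_of_set card_strings Int_def)
qed

section \<open>Signs, and vectors over the field with two elements\<close>

definition sg :: "bool \<Rightarrow> real" where
  "sg b = (if b then -1 else 1)"

lemma sg_simps [simp]: "sg True = -1" "sg False = 1" "sg b * sg b = 1" "(sg b)\<^sup>2 = 1" "\<bar>sg b\<bar> = 1"
  by (auto simp: sg_def)

definition xorv :: "bool list \<Rightarrow> bool list \<Rightarrow> bool list" where
  "xorv u w = map2 (\<noteq>) u w"

lemma length_xorv [simp]: "length (xorv u w) = min (length u) (length w)"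
  by (simp add: xorv_def)

fun ip :: "bool list \<Rightarrow> bool list \<Rightarrow> bool" where
  "ip (a # v) (b # r) = ((a \<and> b) \<noteq> ip v r)"
| "ip _ _ = False"

lemma ip_xorv: "length v = length r \<Longrightarrow> length r = length r' \<Longrightarrow> ip v (xorv r r') = (ip v r \<noteq> ip v r')"
proof (induction v r r' rule: list_induct3)
  case (Cons a v b r c r')
  then show ?case by (auto simp: xorv_def)
qed simp

definition unit_vec :: "nat \<Rightarrow> nat \<Rightarrow> bool list" where
  "unit_vec n i = (replicate n False)[i := True]"

lemma length_unit_vec [simp]: "length (unit_vec n i) = n"
  by (simp add: unit_vec_def)

lemma ip_zero [simp]: "ip v (replicate n False) = False"
proof (induction v arbitrary: n)
  case (Cons a v)
  then show ?case by (cases n) auto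
qed simp

lemma ip_unit_vec: "i < length v \<Longrightarrow> ip v (unit_vec (length v) i) = v ! i"
proof (induction v arbitrary: i)
  case (Cons a v)
  then show ?case by (cases i) (auto simp: unit_vec_def)
qed simp

lemma xorv_cancel: "length r = length w \<Longrightarrow> xorv r (xorv r w) = w"
  by (induction r w rule: list_induct2) (auto simp: xorv_def)

lemma xorv_commute: "length r = length w \<Longrightarrow> xorv r w = xorv w r"
  by (induction r w rule: list_induct2) (auto simp: xorv_def)

lemma xorv_zero: "length w = n \<Longrightarrow> xorv w (replicate n False) = w"
  by (induction w arbitrary: n) (auto simp: xorv_def)

lemma bij_xorv: "length r = n \<Longrightarrow> bij_betw (xorv r) (strings n) (strings n)"
  by (rule bij_betw_byWitness[where f' = "xorv r"]) (auto simp: strings_def xorv_cancel)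

lemma sum_xorv: "length r = n \<Longrightarrow> (\<Sum>w\<in>strings n. \<phi> (xorv r w)) = (\<Sum>w\<in>strings n. \<phi> w)"
  by (rule sum.reindex_bij_betw[OF bij_xorv])

lemma sum_xorv': "length r = n \<Longrightarrow> (\<Sum>w\<in>strings n. \<phi> (xorv w r)) = (\<Sum>w\<in>strings n. \<phi> w)"
proof -
  assume r: "length r = n"
  have "(\<Sum>w\<in>strings n. \<phi> (xorv w r)) = (\<Sum>w\<in>strings n. \<phi> (xorv r w))"
    using r by (intro sum.cong refl arg_cong[where f = \<phi>] xorv_commute) (auto simp: strings_def)
  then show ?thesis using sum_xorv[OF r, of \<phi>] by simp
qed

text \<open>All linear combinations of a list of vectors, and in the same order those of the values that
  a linear form takes on them.\<close>

fun lin_combs :: "nat \<Rightarrow> bool list list \<Rightarrow> bool list list" where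
  "lin_combs n [] = [replicate n False]"
| "lin_combs n (r # \<rho>) = lin_combs n \<rho> @ map (xorv r) (lin_combs n \<rho>)"

fun bit_combs :: "bool list \<Rightarrow> bool list" where
  "bit_combs [] = [False]"
| "bit_combs (b # \<beta>) = bit_combs \<beta> @ map ((\<noteq>) b) (bit_combs \<beta>)"

lemma length_combs [simp]:
  "length (lin_combs n \<rho>) = 2 ^ length \<rho>" "length (bit_combs \<beta>) = 2 ^ length \<beta>"
  by (induction \<rho>; simp) (induction \<beta>; simp)

definition tuples :: "nat \<Rightarrow> nat \<Rightarrow> bool list list set" where
  "tuples n t = {\<rho>. length \<rho> = t \<and> set \<rho> \<subseteq> strings n}"

lemma finite_tuples [simp]: "finite (tuples n t)"
  using finite_lists_length_eq[of "strings n" t] by (simp add: tuples_def conj_commute)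

lemma card_tuples: "card (tuples n t) = (2 ^ n) ^ t"
  using card_lists_length_eq[of "strings n" t] by (simp add: tuples_def card_strings conj_commute)

lemma lin_combs_strings: "\<rho> \<in> tuples n t \<Longrightarrow> set (lin_combs n \<rho>) \<subseteq> strings n"
proof (induction \<rho> arbitrary: t)
  case Nil
  then show ?case by (auto simp: strings_def)
next
  case (Cons r \<rho>)
  then have "set (lin_combs n \<rho>) \<subseteq> strings n" by (auto simp: tuples_def)
  with Cons.prems show ?case by (auto simp: tuples_def strings_def)
qed

text \<open>Linearity of the inner product: correct values at the t vectors of \<rho> determine
  those at all 2^t combinations, so only t bits have to be guessed.\<close>

lemma bit_combs_ip:
  "\<rho> \<in> tuples n t \<Longrightarrow> v \<in> strings n \<Longrightarrow> bit_combs (map (ip v) \<rho>) = map (ip v) (lin_combs n \<rho>)"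
proof (induction \<rho> arbitrary: t)
  case (Cons r \<rho>)
  then have \<rho>: "\<rho> \<in> tuples n (t - 1)" and r: "length r = n" by (auto simp: tuples_def strings_def)
  have "ip v (xorv r w) = (ip v r \<noteq> ip v w)" if "w \<in> set (lin_combs n \<rho>)" for w
    using that lin_combs_strings[OF \<rho>] Cons.prems(2) r by (intro ip_xorv) (auto simp: strings_def)
  then show ?case using Cons.IH[OF \<rho> Cons.prems(2)] by simp
qed simp

lemma sum_tuples_Suc:
  "(\<Sum>\<rho>\<in>tuples n (Suc t). g \<rho>) = (\<Sum>\<rho>\<in>tuples n t. \<Sum>r\<in>strings n. g (r # \<rho>))"
proof -
  have eq: "tuples n (Suc t) = (\<lambda>(\<rho>, r). r # \<rho>) ` (tuples n t \<times> strings n)"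
  proof (intro equalityI subsetI)
    fix \<rho> assume "\<rho> \<in> tuples n (Suc t)"
    then show "\<rho> \<in> (\<lambda>(\<rho>, r). r # \<rho>) ` (tuples n t \<times> strings n)"
      by (cases \<rho>) (auto simp: tuples_def image_iff)
  qed (auto simp: tuples_def)
  have "inj_on (\<lambda>(\<rho>, r). r # \<rho>) (tuples n t \<times> strings n)"
    by (auto simp: inj_on_def)
  then show ?thesis
    unfolding eq by (simp add: sum.reindex sum.cartesian_product case_prod_unfold)
qed

text \<open>The shifts of \<open>\<phi>\<close> by a uniformly random vector have the same mean and variance as
  \<open>\<phi>\<close>, which makes the induction work.\<close>

lemma second_moment:
  assumes "(\<Sum>w\<in>strings n. \<phi> w) = 0"
  shows "(\<Sum>\<rho>\<in>tuples n t. (sum_list (map \<phi> (lin_combs n \<rho>)))\<^sup>2) =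
    (2 ^ n) ^ t * ((\<phi> (replicate n False))\<^sup>2 + (2 ^ t - 1) * (\<Sum>w\<in>strings n. (\<phi> w)\<^sup>2) / 2 ^ n :: real)"
  using assms
proof (induction t arbitrary: \<phi>)
  case 0
  have "tuples n 0 = {[]}" by (auto simp: tuples_def)
  then show ?case by simp
next
  case (Suc t)
  let ?N = "2 ^ n :: real" and ?V = "strings n"
  let ?\<phi> = "\<lambda>r w. \<phi> (xorv r w)" and ?s = "\<Sum>w\<in>?V. (\<phi> w)\<^sup>2"
  define S where "S \<phi> \<rho> = sum_list (map \<phi> (lin_combs n \<rho>))" for \<phi> :: "bool list \<Rightarrow> real" and \<rho>
  have S_Cons: "S \<phi> (r # \<rho>) = S \<phi> \<rho> + S (?\<phi> r) \<rho>" for r \<rho>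
    by (simp add: S_def o_def)
  \<comment> \<open>Averaged over r, each term of the shifted sum is the mean of \<phi>, which is 0.
    Hence the cross term in \<open>inner\<close> vanishes.\<close>
  have mean: "(\<Sum>r\<in>?V. S (?\<phi> r) \<rho>) = 0" if \<rho>: "\<rho> \<in> tuples n t" for \<rho>
  proof -
    have "(\<Sum>r\<in>?V. sum_list (map (?\<phi> r) ws)) = 0" if "set ws \<subseteq> ?V" for ws
      using that
    proof (induction ws)
      case (Cons w ws)
      then show ?case using sum_xorv'[of w n \<phi>] Suc.prems by (simp add: sum.distrib strings_def)
    qed simp
    then show ?thesis using lin_combs_strings[OF \<rho>] by (simp add: S_def)
  qed
  have inner: "(\<Sum>r\<in>?V. (S \<phi> (r # \<rho>))\<^sup>2) = ?N * (S \<phi> \<rho>)\<^sup>2 + (\<Sum>r\<in>?V. (S (?\<phi> r) \<rho>)\<^sup>2)"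
    if \<rho>: "\<rho> \<in> tuples n t" for \<rho>
  proof -
    have "(\<Sum>r\<in>?V. (S \<phi> (r # \<rho>))\<^sup>2) = (\<Sum>r\<in>?V. (S \<phi> \<rho>)\<^sup>2 + (S (?\<phi> r) \<rho>)\<^sup>2 + 2 * S \<phi> \<rho> * S (?\<phi> r) \<rho>)"
      by (simp add: S_Cons power2_sum)
    also have "\<dots> = ?N * (S \<phi> \<rho>)\<^sup>2 + (\<Sum>r\<in>?V. (S (?\<phi> r) \<rho>)\<^sup>2) + 2 * S \<phi> \<rho> * (\<Sum>r\<in>?V. S (?\<phi> r) \<rho>)"
      by (simp add: sum.distrib card_strings sum_distrib_left)
    finally show ?thesis using mean[OF \<rho>] by simp
  qed
  \<comment> \<open>The induction hypothesis is applied to the shifts of \<phi>. Only their value at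
    0, which is \<open>\<phi> r\<close>, depends on the shift.\<close>
  have IH_shift: "(\<Sum>\<rho>\<in>tuples n t. (S (?\<phi> r) \<rho>)\<^sup>2) = ?N ^ t * ((\<phi> r)\<^sup>2 + (2 ^ t - 1) * ?s / ?N)"
    if "r \<in> ?V" for r
  proof -
    have r: "length r = n" using that by (simp add: strings_def)
    have "(\<Sum>w\<in>?V. ?\<phi> r w) = 0" using sum_xorv[OF r, of \<phi>] Suc.prems by simp
    from Suc.IH[OF this] show ?thesis
      using sum_xorv[OF r, of "\<lambda>w. (\<phi> w)\<^sup>2"] r by (simp add: S_def xorv_zero)
  qed
  have "(\<Sum>\<rho>\<in>tuples n (Suc t). (S \<phi> \<rho>)\<^sup>2) =
      (\<Sum>\<rho>\<in>tuples n t. ?N * (S \<phi> \<rho>)\<^sup>2 + (\<Sum>r\<in>?V. (S (?\<phi> r) \<rho>)\<^sup>2))"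
    by (simp add: sum_tuples_Suc inner cong: sum.cong)
  also have "\<dots> = ?N * (\<Sum>\<rho>\<in>tuples n t. (S \<phi> \<rho>)\<^sup>2) + (\<Sum>r\<in>?V. \<Sum>\<rho>\<in>tuples n t. (S (?\<phi> r) \<rho>)\<^sup>2)"
    by (simp add: sum.distrib sum_distrib_left sum.swap[of _ "tuples n t"])
  also have "(\<Sum>\<rho>\<in>tuples n t. (S \<phi> \<rho>)\<^sup>2) = ?N ^ t * ((\<phi> (replicate n False))\<^sup>2 + (2 ^ t - 1) * ?s / ?N)"
    using Suc.IH[OF Suc.prems] by (simp add: S_def)
  also have "(\<Sum>r\<in>?V. \<Sum>\<rho>\<in>tuples n t. (S (?\<phi> r) \<rho>)\<^sup>2) = ?N ^ t * (?s + ?N * ((2 ^ t - 1) * ?s / ?N))"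
    by (simp add: IH_shift sum.distrib card_strings flip: sum_distrib_left)
  finally show ?case
    by (simp add: S_def field_simps)
qed

text \<open>Chebyshev's inequality. The nonzero combinations of random vectors are uniform and
  pairwise independent, and a sum that is \<le> 0 lies at least 2^t * \<eta> below 2^t times the
  mean.\<close>

lemma card_bad_tuples:
  assumes \<eta>: "0 < \<eta>" "\<eta> * 2 ^ n \<le> (\<Sum>w\<in>strings n. \<psi> w)"
    and \<psi>: "\<And>w. w \<in> strings n \<Longrightarrow> \<bar>\<psi> w\<bar> = 1"
  shows "real (card {\<rho> \<in> tuples n t. sum_list (map \<psi> (lin_combs n \<rho>)) \<le> 0}) * (2 ^ t * \<eta>\<^sup>2)
    \<le> 4 * (2 ^ n) ^ t"
proof -
  let ?N = "2 ^ n :: real"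
  define b where "b = (\<Sum>w\<in>strings n. \<psi> w) / ?N"
  define \<phi> where "\<phi> w = \<psi> w - b" for w
  let ?B = "{\<rho> \<in> tuples n t. sum_list (map \<psi> (lin_combs n \<rho>)) \<le> 0}"
  let ?S = "\<lambda>\<rho>. sum_list (map \<phi> (lin_combs n \<rho>))"
  have b: "\<eta> \<le> b" using \<eta> by (simp add: b_def field_simps)
  have mean: "(\<Sum>w\<in>strings n. \<phi> w) = 0"
    by (simp add: \<phi>_def sum_subtractf card_strings b_def)
  have sq: "(\<psi> w)\<^sup>2 = 1" if "w \<in> strings n" for w
    using \<psi>[OF that] by (metis power2_abs one_power2)
  have var: "(\<Sum>w\<in>strings n. (\<phi> w)\<^sup>2) \<le> ?N"
  proof -
    have "(\<Sum>w\<in>strings n. (\<phi> w)\<^sup>2) = (\<Sum>w\<in>strings n. (1 + b\<^sup>2) - 2 * b * \<psi> w)"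
      by (rule sum.cong) (simp_all add: \<phi>_def power2_diff sq algebra_simps)
    also have "\<dots> = ?N * (1 + b\<^sup>2) - 2 * b * (\<Sum>w\<in>strings n. \<psi> w)"
      by (simp add: sum_subtractf card_strings flip: sum_distrib_left)
    also have "(\<Sum>w\<in>strings n. \<psi> w) = ?N * b" by (simp add: b_def)
    finally have "(\<Sum>w\<in>strings n. (\<phi> w)\<^sup>2) = ?N - ?N * b\<^sup>2" by (simp add: algebra_simps power2_eq_square)
    then show ?thesis by simp
  qed
  have "(\<Sum>w\<in>strings n. \<psi> w) \<le> (\<Sum>w\<in>strings n. 1)"
    by (intro sum_mono) (use \<psi> in force)
  then have b1: "b \<le> 1" by (simp add: b_def card_strings)
  \<comment> \<open>The zero combination is not random, but its value deviates from the mean by at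
    most 2. This is the origin of the factor 4.\<close>
  have "replicate n False \<in> strings n" by (simp add: strings_def)
  then have "\<bar>\<phi> (replicate n False)\<bar> \<le> 2"
    using \<psi> b b1 \<eta>(1) by (fastforce simp: \<phi>_def)
  then have zero: "(\<phi> (replicate n False))\<^sup>2 \<le> 4"
    using power_mono[of "\<bar>\<phi> (replicate n False)\<bar>" 2 2] by simp
  have "real (card ?B) * (2 ^ t * \<eta>)\<^sup>2 = (\<Sum>\<rho>\<in>?B. (2 ^ t * \<eta>)\<^sup>2)" by simp
  also have "\<dots> \<le> (\<Sum>\<rho>\<in>?B. (?S \<rho>)\<^sup>2)"
  proof (rule sum_mono)
    fix \<rho> assume \<rho>: "\<rho> \<in> ?B"
    then have "length \<rho> = t" by (simp add: tuples_def)
    moreover have "sum_list (map \<phi> ws) = sum_list (map \<psi> ws) - real (length ws) * b" for ws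
      by (induction ws) (simp_all add: \<phi>_def algebra_simps)
    ultimately have "?S \<rho> \<le> - (2 ^ t * b)" using \<rho> by simp
    moreover have "2 ^ t * \<eta> \<le> 2 ^ t * b" using b by simp
    ultimately have "2 ^ t * \<eta> \<le> \<bar>?S \<rho>\<bar>" by linarith
    then show "(2 ^ t * \<eta>)\<^sup>2 \<le> (?S \<rho>)\<^sup>2"
      using power_mono[of "2 ^ t * \<eta>" "\<bar>?S \<rho>\<bar>" 2] \<eta>(1) by simp
  qed
  also have "\<dots> \<le> (\<Sum>\<rho>\<in>tuples n t. (?S \<rho>)\<^sup>2)" by (rule sum_mono2) auto
  also have "\<dots> = ?N ^ t * ((\<phi> (replicate n False))\<^sup>2 + (2 ^ t - 1) * (\<Sum>w\<in>strings n. (\<phi> w)\<^sup>2) / ?N)"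
    by (rule second_moment[OF mean])
  also have "\<dots> \<le> ?N ^ t * (4 + (2 ^ t - 1))"
  proof (intro mult_left_mono add_mono zero)
    have "(2 ^ t - 1) * (\<Sum>w\<in>strings n. (\<phi> w)\<^sup>2) \<le> (2 ^ t - 1) * ?N"
      by (intro mult_left_mono var) simp
    then show "(2 ^ t - 1) * (\<Sum>w\<in>strings n. (\<phi> w)\<^sup>2) / ?N \<le> 2 ^ t - 1" by (simp add: field_simps)
  qed simp
  also have "\<dots> \<le> ?N ^ t * (4 * 2 ^ t)"
  proof -
    have "1 \<le> (2::real) ^ t" by simp
    then show ?thesis by (intro mult_left_mono) auto
  qed
  finally have "(real (card ?B) * (2 ^ t * \<eta>\<^sup>2)) * 2 ^ t \<le> (4 * ?N ^ t) * 2 ^ t"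
    by (simp add: power_mult_distrib power2_eq_square algebra_simps)
  then show ?thesis by (simp only: mult_le_cancel_right_pos zero_less_power zero_less_numeral)
qed

text \<open>Each combination w casts a vote: the predictor at w plus the i-th unit vector estimates
  <v, w> plus bit i of v, and the guess for <v, w> derived from \<beta> is subtracted.\<close>

definition majority_bit :: "nat \<Rightarrow> (bool list \<Rightarrow> bool) \<Rightarrow> bool list list \<Rightarrow> bool list \<Rightarrow> nat \<Rightarrow> bool" where
  "majority_bit n q \<rho> \<beta> i \<longleftrightarrow> 2 ^ length \<rho> <
     2 * length (filter (\<lambda>(w, b). q (xorv w (unit_vec n i)) \<noteq> b) (zip (lin_combs n \<rho>) (bit_combs \<beta>)))"

lemma sum_list_sg: "sum_list (map sg bs) = real (length bs) - 2 * real (length (filter id bs))"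
  by (induction bs) (auto simp: sg_def)

lemma majority_bit_correct:
  assumes v: "v \<in> strings n" and \<rho>: "\<rho> \<in> tuples n t" and i: "i < n"
    and pos: "sum_list (map (\<lambda>w. sg (q (xorv w (unit_vec n i))) * sg (ip v (xorv w (unit_vec n i))))
      (lin_combs n \<rho>)) > 0"
  shows "majority_bit n q \<rho> (map (ip v) \<rho>) i = v ! i"
proof -
  let ?q = "\<lambda>w. q (xorv w (unit_vec n i))"
  let ?bs = "map (\<lambda>w. ?q w \<noteq> ip v w) (lin_combs n \<rho>)"
  \<comment> \<open>The predictor is right at the shifted point iff the vote of w equals
    \<open>v ! i\<close>. Up to the common sign of this bit, correlation therefore counts
    votes.\<close>
  have "sg (?q w) * sg (ip v (xorv w (unit_vec n i))) = sg (v ! i) * sg (?q w \<noteq> ip v w)"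
    if "w \<in> set (lin_combs n \<rho>)" for w
  proof -
    have "length w = n" using that lin_combs_strings[OF \<rho>] by (auto simp: strings_def)
    then have "ip v (xorv w (unit_vec n i)) = (ip v w \<noteq> v ! i)"
      using v i ip_unit_vec[of i v] by (simp add: ip_xorv strings_def)
    then show ?thesis by (auto simp: sg_def)
  qed
  then have "sum_list (map (\<lambda>w. sg (?q w) * sg (ip v (xorv w (unit_vec n i)))) (lin_combs n \<rho>))
      = sum_list (map (\<lambda>w. sg (v ! i) * sg (?q w \<noteq> ip v w)) (lin_combs n \<rho>))"
    by (intro arg_cong[where f = sum_list] map_cong) auto
  also have "\<dots> = sg (v ! i) * sum_list (map sg ?bs)"
    by (simp add: sum_list_const_mult o_def)
  finally have "sg (v ! i) * sum_list (map sg ?bs) > 0" using pos by simp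
  moreover have "length \<rho> = t" using \<rho> by (simp add: tuples_def)
  moreover have "length (filter (\<lambda>(w, b). ?q w \<noteq> b) (zip (lin_combs n \<rho>) (map (ip v) (lin_combs n \<rho>))))
      = length (filter id ?bs)"
    by (simp add: zip_map2 zip_same_conv_map filter_map o_def)
  moreover define c where "c = length (filter id ?bs)"
  moreover have "(2 ^ t < 2 * c) = (2 ^ t < 2 * real c)"
    by (metis of_nat_less_iff of_nat_mult of_nat_numeral of_nat_power)
  ultimately show ?thesis
    unfolding majority_bit_def bit_combs_ip[OF \<rho> v] sum_list_sg
    by (cases "v ! i") (simp_all del: filter_map)
qed

text \<open>Averaging three times. A fraction \<epsilon> / 2 of all v keeps the advantage \<epsilon>
  / 2. For each of these, at least half of the tuples recover every bit, so a single tuple serves a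
  fraction \<epsilon> / 4. Fixing the most successful guess of its t values costs the factor
  2^t.\<close>

lemma goldreich_levin:
  fixes \<epsilon> :: real
  assumes \<epsilon>: "0 < \<epsilon>"
    and adv: "\<epsilon> * (2 ^ n)\<^sup>2 \<le> (\<Sum>v\<in>strings n. \<Sum>r\<in>strings n. sg (G (h v) r) * sg (ip v r))"
    and t: "32 * real n \<le> 2 ^ t * \<epsilon>\<^sup>2"
  shows "\<exists>\<rho>\<in>tuples n t. \<exists>\<beta>. length \<beta> = t \<and>
    \<epsilon> * 2 ^ n \<le> 4 * 2 ^ t * real (card {v \<in> strings n. \<forall>i<n. majority_bit n (G (h v)) \<rho> \<beta> i = v ! i})"
proof -
  let ?N = "2 ^ n :: real" and ?V = "strings n" and ?T = "tuples n t"
  define bias where "bias v = (\<Sum>r\<in>?V. sg (G (h v) r) * sg (ip v r))" for v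
  define good where "good = {v \<in> ?V. \<epsilon> / 2 * ?N \<le> bias v}"
  define ok where "ok v = {\<rho> \<in> ?T. \<forall>i<n. majority_bit n (G (h v)) \<rho> (map (ip v) \<rho>) i = v ! i}" for v
  have fin: "finite good" by (simp add: good_def)
  have N: "?N > 0" by simp
  have "bias v \<le> (\<Sum>r\<in>?V. 1)" for v
    unfolding bias_def by (rule sum_mono) (auto simp: sg_def)
  then have bias: "bias v \<le> ?N" for v by (simp add: card_strings)
  \<comment> \<open>Strings outside \<open>good\<close> contribute less than \<epsilon> / 2 each on
    average over r, so the good ones must supply the other half of the advantage, with at most
    \<open>?N\<close> each.\<close>
  have card_good: "\<epsilon> / 2 * ?N \<le> real (card good)"
  proof -
    have "\<epsilon> * ?N\<^sup>2 \<le> (\<Sum>v\<in>?V. bias v)" using adv by (simp add: bias_def)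
    also have "\<dots> = (\<Sum>v\<in>good. bias v) + (\<Sum>v\<in>?V - good. bias v)"
      by (rule sum.subset_diff[THEN trans[OF _ add.commute]]) (auto simp: good_def)
    also have "\<dots> \<le> (\<Sum>v\<in>good. ?N) + (\<Sum>v\<in>?V - good. \<epsilon> / 2 * ?N)"
      using bias by (intro add_mono sum_mono) (auto simp: good_def)
    also have "(\<Sum>v\<in>?V - good. \<epsilon> / 2 * ?N) \<le> (\<Sum>v\<in>?V. \<epsilon> / 2 * ?N)"
      using \<epsilon> by (intro sum_mono2) auto
    finally have "\<epsilon> * ?N\<^sup>2 \<le> real (card good) * ?N + \<epsilon> / 2 * ?N * ?N"
      by (simp add: card_strings mult_ac)
    moreover have "\<epsilon> * ?N\<^sup>2 = \<epsilon> / 2 * ?N * ?N + \<epsilon> / 2 * ?N * ?N"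
      by (simp add: power2_eq_square)
    ultimately have "(\<epsilon> / 2 * ?N) * ?N \<le> real (card good) * ?N" by linarith
    then show ?thesis using N by (simp only: mult_le_cancel_right_pos)
  qed
  have card_ok: "?N ^ t \<le> 2 * real (card (ok v))" if v: "v \<in> good" for v
  proof -
    have vV: "v \<in> ?V" using v by (simp add: good_def)
    let ?\<psi> = "\<lambda>i w. sg (G (h v) (xorv w (unit_vec n i))) * sg (ip v (xorv w (unit_vec n i)))"
    let ?bad = "\<lambda>i. {\<rho> \<in> ?T. sum_list (map (?\<psi> i) (lin_combs n \<rho>)) \<le> 0}"
    \<comment> \<open>Shifting by a unit vector permutes the strings and so leaves the total
      correlation unchanged. Hence the previous estimate applies to every bit i with \<epsilon> / 2
      for \<eta>.\<close>
    have bad: "real (card (?bad i)) * (2 ^ t * (\<epsilon> / 2)\<^sup>2) \<le> 4 * ?N ^ t" for i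
    proof (rule card_bad_tuples)
      show "\<epsilon> / 2 * 2 ^ n \<le> sum (?\<psi> i) ?V"
        using v sum_xorv'[of "unit_vec n i" n "\<lambda>w. sg (G (h v) w) * sg (ip v w)"]
        by (simp add: good_def bias_def)
    qed (use \<epsilon> in \<open>auto simp: abs_mult\<close>)
    have "?T - ok v \<subseteq> (\<Union>i<n. ?bad i)"
    proof
      fix \<rho> assume "\<rho> \<in> ?T - ok v"
      then obtain i where "\<rho> \<in> ?T" "i < n" "majority_bit n (G (h v)) \<rho> (map (ip v) \<rho>) i \<noteq> v ! i"
        by (auto simp: ok_def)
      with majority_bit_correct[OF vV, of \<rho> t i "G (h v)"] show "\<rho> \<in> (\<Union>i<n. ?bad i)"
        by (force simp: not_le)
    qed
    then have "card (?T - ok v) \<le> card (\<Union>i<n. ?bad i)" by (intro card_mono) auto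
    also have "\<dots> \<le> (\<Sum>i<n. card (?bad i))" by (rule card_UN_le) simp
    finally have "real (card (?T - ok v)) \<le> (\<Sum>i<n. real (card (?bad i)))"
      by (simp only: of_nat_sum[symmetric] of_nat_le_iff)
    then have "real (card (?T - ok v)) * (2 ^ t * (\<epsilon> / 2)\<^sup>2)
        \<le> (\<Sum>i<n. real (card (?bad i))) * (2 ^ t * (\<epsilon> / 2)\<^sup>2)"
      by (rule mult_right_mono) simp
    also have "\<dots> = (\<Sum>i<n. real (card (?bad i)) * (2 ^ t * (\<epsilon> / 2)\<^sup>2))"
      by (rule sum_distrib_right)
    also have "\<dots> \<le> (\<Sum>i<n. 4 * ?N ^ t)" by (intro sum_mono bad)
    finally have le: "real (card (?T - ok v)) * (2 ^ t * (\<epsilon> / 2)\<^sup>2) \<le> real n * (4 * ?N ^ t)" by simp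
    \<comment> \<open>A single bit fails on at most a fraction 16 / (2^t * \<epsilon>^2) of the
      tuples. The hypothesis with the constant 32 makes this at most 1 / (2 n), so all n bits
      together fail on at most half.\<close>
    have "2 * real (card (?T - ok v)) \<le> ?N ^ t"
    proof (cases "n = 0")
      case True
      then show ?thesis by (simp add: ok_def)
    next
      case False
      have "real (card (?T - ok v)) * (8 * real n) \<le> real (card (?T - ok v)) * (2 ^ t * (\<epsilon> / 2)\<^sup>2)"
        using t by (intro mult_left_mono) (auto simp: power_divide)
      with le have "(2 * real (card (?T - ok v))) * (4 * real n) \<le> ?N ^ t * (4 * real n)"
        by (simp add: algebra_simps)
      moreover have "0 < 4 * real n" using False by simp
      ultimately show ?thesis using mult_le_cancel_right_pos by blast
    qed
    moreover have "card (?T - ok v) + card (ok v) = card ?T"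
      using card_mono[of ?T "ok v"] by (subst card_Diff_subset) (auto simp: ok_def)
    from arg_cong[OF this, of real] have "real (card (?T - ok v)) + real (card (ok v)) = ?N ^ t"
      by (simp add: card_tuples)
    ultimately show ?thesis by linarith
  qed
  \<comment> \<open>Double counting of the pairs of a good v and a tuple that recovers it.\<close>
  have "\<exists>\<rho>\<in>?T. \<epsilon> / 4 * ?N \<le> real (card {v \<in> good. \<rho> \<in> ok v})"
  proof (rule ccontr)
    assume "\<not> ?thesis"
    then have less: "real (card {v \<in> good. \<rho> \<in> ok v}) < \<epsilon> / 4 * ?N" if "\<rho> \<in> ?T" for \<rho>
      using that by (auto simp: not_le)
    have ne: "?T \<noteq> {}" using card_tuples[of n t] by auto
    have "\<epsilon> / 2 * ?N * ?N ^ t \<le> real (card good) * ?N ^ t"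
      by (rule mult_right_mono[OF card_good]) simp
    also have "\<dots> = (\<Sum>v\<in>good. ?N ^ t)" by simp
    also have "\<dots> \<le> (\<Sum>v\<in>good. 2 * real (card (ok v)))" by (intro sum_mono card_ok)
    also have "\<dots> = 2 * (\<Sum>v\<in>good. \<Sum>\<rho>\<in>?T. if \<rho> \<in> ok v then 1 else 0)"
      by (simp add: sum_distrib_left sum.If_cases ok_def Int_def)
    also have "\<dots> = 2 * (\<Sum>\<rho>\<in>?T. \<Sum>v\<in>good. if \<rho> \<in> ok v then 1 else 0)"
      by (subst sum.swap) simp
    also have "\<dots> = 2 * (\<Sum>\<rho>\<in>?T. real (card {v \<in> good. \<rho> \<in> ok v}))"
      using fin by (simp add: sum.If_cases Int_def)
    also have "\<dots> < 2 * (\<Sum>\<rho>\<in>?T. \<epsilon> / 4 * ?N)"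
      using less ne by (intro mult_strict_left_mono sum_strict_mono) auto
    also have "\<dots> = \<epsilon> / 2 * ?N * ?N ^ t" by (simp add: card_tuples)
    finally show False by simp
  qed
  then obtain \<rho> where \<rho>: "\<rho> \<in> ?T" "\<epsilon> / 4 * ?N \<le> real (card {v \<in> good. \<rho> \<in> ok v})" by blast
  define W where "W = {v \<in> good. \<rho> \<in> ok v}"
  define Wb where "Wb \<beta> = {v \<in> W. map (ip v) \<rho> = \<beta>}" for \<beta>
  \<comment> \<open>The inner products with the vectors of \<rho> split \<open>W\<close> into at
    most 2^t classes, of which the largest is taken.\<close>
  have "\<exists>\<beta>\<in>strings t. real (card W) \<le> 2 ^ t * real (card (Wb \<beta>))"
  proof (rule ccontr)
    assume "\<not> ?thesis"
    then have less: "2 ^ t * real (card (Wb \<beta>)) < real (card W)" if "\<beta> \<in> strings t" for \<beta>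
      using that by (auto simp: not_le)
    have ne: "strings t \<noteq> {}" using card_strings[of t] by auto
    have "W \<subseteq> (\<Union>\<beta>\<in>strings t. Wb \<beta>)"
      using \<rho>(1) by (auto simp: Wb_def strings_def tuples_def)
    moreover have "finite (\<Union>\<beta>\<in>strings t. Wb \<beta>)" using fin by (auto simp: Wb_def W_def)
    ultimately have "card W \<le> card (\<Union>\<beta>\<in>strings t. Wb \<beta>)" by (intro card_mono)
    also have "\<dots> \<le> (\<Sum>\<beta>\<in>strings t. card (Wb \<beta>))" by (rule card_UN_le) simp
    finally have "real (card W) \<le> (\<Sum>\<beta>\<in>strings t. real (card (Wb \<beta>)))"
      by (simp only: of_nat_sum[symmetric] of_nat_le_iff)
    then have "2 ^ t * real (card W) \<le> (\<Sum>\<beta>\<in>strings t. 2 ^ t * real (card (Wb \<beta>)))"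
      by (simp flip: sum_distrib_left)
    also have "\<dots> < (\<Sum>\<beta>\<in>strings t. real (card W))"
      using less ne by (intro sum_strict_mono) auto
    finally show False by (simp add: card_strings)
  qed
  then obtain \<beta> where \<beta>: "\<beta> \<in> strings t" "real (card W) \<le> 2 ^ t * real (card (Wb \<beta>))" by blast
  let ?R = "{v \<in> ?V. \<forall>i<n. majority_bit n (G (h v)) \<rho> \<beta> i = v ! i}"
  have "Wb \<beta> \<subseteq> ?R" by (auto simp: Wb_def W_def ok_def good_def)
  then have "card (Wb \<beta>) \<le> card ?R" by (intro card_mono) auto
  then have "2 ^ t * real (card (Wb \<beta>)) \<le> 2 ^ t * real (card ?R)" by simp
  moreover have "\<epsilon> / 4 * ?N \<le> real (card W)" using \<rho>(2) unfolding W_def .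
  ultimately have "\<epsilon> * 2 ^ n \<le> 4 * 2 ^ t * real (card ?R)" using \<beta>(2) by linarith
  with \<rho>(1) \<beta>(1) show ?thesis by (auto simp: strings_def)
qed

text \<open>The tail \<open>z\<close> takes up the last bit of a string of odd length.\<close>

definition mix :: "bool list \<Rightarrow> bool list \<Rightarrow> bool list \<Rightarrow> bool list" where
  "mix y r z = concat (map2 (\<lambda>a b. [a, b]) y r) @ z"

lemma mix_simps [simp]: "mix [] [] z = z" "mix (a # y) (b # r) z = a # b # mix y r z"
  by (simp_all add: mix_def)

lemma length_mix: "length y = length r \<Longrightarrow> length (mix y r z) = 2 * length y + length z"
  by (induction y r rule: list_induct2) auto

section \<open>Majority votes and the inverter as circuits\<close>

context encoded_domain
begin

definition at_least :: "nat \<Rightarrow> ('a \<Rightarrow> bool) list \<Rightarrow> 'a \<Rightarrow> bool" where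
  "at_least c fs x \<longleftrightarrow> c \<le> length (filter (\<lambda>f. f x) fs)"

text \<open>Dynamic programming along the list. All thresholds are computed together, because
  threshold c for the longer list needs c and c - 1 for the shorter one; each costs two
  gates.\<close>

lemma ext_at_least:
  "set fs \<subseteq> F \<Longrightarrow> ext (length fs * ((m + 1) * 2) + (m + 1)) F (\<Union>c\<in>{..m}. {at_least c fs})"
proof (induction fs)
  case Nil
  have "ext 1 F {at_least c []}" for c
    by (rule ext_cong1[OF ext_const[of F "c = 0"]]) (simp add: at_least_def)
  then have "ext (card {..m} * 1) F (\<Union>c\<in>{..m}. {at_least c []})"
    by (intro ext_UN[OF finite_atMost])
  then show ?case by simp
next
  case (Cons f fs)
  let ?G = "\<Union>c\<in>{..m}. {at_least c fs}"
  have "ext 2 (F \<union> ?G) {at_least c (f # fs)}" if "c \<in> {..m}" for c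
  proof (cases c)
    case 0
    show ?thesis
      by (rule ext_cong1[OF ext_mono[OF ext_const[of "F \<union> ?G" True]]]) (simp_all add: at_least_def 0)
  next
    case (Suc c')
    have mem: "at_least c fs \<in> F \<union> ?G" "at_least c' fs \<in> F \<union> ?G" "f \<in> F \<union> ?G"
      using that Suc Cons.prems by auto
    have "ext 1 (F \<union> ?G) {\<lambda>x. f x \<and> at_least c' fs x}"
      by (rule ext_binary1(1)[OF mem(3,2)])
    from ext_disj[OF ext_subset[of "{at_least c fs}" "F \<union> ?G" 0] this] mem(1)
    have "ext 2 (F \<union> ?G) {\<lambda>x. at_least c fs x \<or> (f x \<and> at_least c' fs x)}" by (simp add: eval_nat_numeral)
    then show ?thesis by (rule ext_cong1) (auto simp: Suc at_least_def)
  qed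
  then have "ext (card {..m} * 2) (F \<union> ?G) (\<Union>c\<in>{..m}. {at_least c (f # fs)})"
    by (intro ext_UN[OF finite_atMost])
  from ext_trans[OF _ this, of "length fs * ((m + 1) * 2) + (m + 1)"] Cons
  have "ext ((length fs * ((m + 1) * 2) + (m + 1)) + card {..m} * 2) F
     (?G \<union> (\<Union>c\<in>{..m}. {at_least c (f # fs)}))"
    by simp
  then show ?case by (rule ext_mono) (auto simp: algebra_simps)
qed

lemma ext_threshold:
  assumes "\<And>f. f \<in> set fs \<Longrightarrow> ext k F {f}"
  shows "ext (length fs * k + (length fs * ((c + 1) * 2) + (c + 1))) F {at_least c fs}"
proof -
  have "ext (card (set fs) * k) F (\<Union>f\<in>set fs. {f})"
    by (rule ext_UN[of "set fs" k F "\<lambda>f. {f}"]) (simp_all add: assms)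
  then have "ext (card (set fs) * k) F (set fs)" by (simp only: UN_singleton)
  then have "ext (length fs * k) F (set fs)"
    by (rule ext_mono[OF _ _ order_refl order_refl]) (intro mult_right_mono card_length, simp)
  from ext_comp[OF this ext_at_least[OF order_refl, of fs c]]
  show ?thesis by (rule ext_mono) auto
qed

end

text \<open>Each of the n bits is a threshold over \<open>M\<close> votes, at the strict majority
  \<open>M div 2 + 1\<close>. A vote costs the predictor of size \<open>s\<close>, two constants and
  possibly a negation.\<close>

definition inverter_cost :: "nat \<Rightarrow> nat \<Rightarrow> nat \<Rightarrow> nat" where
  "inverter_cost n M s = n * (M * (s + 3) + (M * ((M div 2 + 1 + 1) * 2) + (M div 2 + 1 + 1)))"

text \<open>The inverter is nonuniform: \<rho>, \<beta> and the last bit \<open>z\<close> are wired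
  in, so that no random choice is left.\<close>

lemma ex_inverter:
  assumes C: "is_circuit (2 * n + length z) 1 C" and \<rho>: "\<rho> \<in> tuples n t" and \<beta>: "length \<beta> = t"
  shows "\<exists>D. is_circuit n n D \<and> csize D = inverter_cost n (2 ^ t) (csize C) \<and>
    (\<forall>y\<in>strings n. ceval D y =
       map (majority_bit n (\<lambda>r. ceval C (mix y r z) = [True]) \<rho> \<beta>) [0..<n])"
proof -
  interpret encoded_domain n "\<lambda>y. y" "strings n"
    by unfold_locales (simp add: strings_def)
  let ?F = "(\<lambda>i y. y ! i) ` {..<n} :: (bool list \<Rightarrow> bool) set"
  let ?M = "2 ^ t :: nat"
  let ?bit = "\<lambda>i wb y. (ceval C (mix y (xorv (fst wb) (unit_vec n i)) z) = [True]) \<noteq> snd wb"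
  let ?wbs = "zip (lin_combs n \<rho>) (bit_combs \<beta>)"
  have t: "length \<rho> = t" using \<rho> by (simp add: tuples_def)
  have len_wbs: "length ?wbs = ?M" by (simp add: t \<beta>)
  have pred: "ext (csize C + 2) ?F {\<lambda>y. ceval C (mix y r z) = [True]}" if r: "length r = n" for r
  proof -
    let ?fs = "concat (map (\<lambda>j. [\<lambda>y. y ! j, \<lambda>y. r ! j]) [0..<n]) @ map (\<lambda>b y. b) z
      :: (bool list \<Rightarrow> bool) list"
    have bits: "ext (1 + 1) ?F ({\<lambda>y. True} \<union> {\<lambda>y. False})"
      by (intro ext_Un ext_const)
    have "set ?fs \<subseteq> ?F \<union> ({\<lambda>y. True} \<union> {\<lambda>y. False})" by auto
    moreover have "length ?fs = 2 * n + length z"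
      by (simp add: length_concat o_def sum_list_triv)
    ultimately have "ext (csize C) (?F \<union> ({\<lambda>y. True} \<union> {\<lambda>y. False}))
        ((\<lambda>i y. ceval C (map (\<lambda>f. f y) ?fs) ! i) ` {..<1})"
      by (intro ext_ceval[OF C])
    from ext_trans[OF bits this] have "ext (csize C + 2) ?F {\<lambda>y. ceval C (map (\<lambda>f. f y) ?fs) ! 0}"
    proof (rule ext_mono[OF _ _ order_refl])
      show "{\<lambda>y. ceval C (map (\<lambda>f. f y) ?fs) ! 0} \<subseteq>
          {\<lambda>y. True} \<union> {\<lambda>y. False} \<union> (\<lambda>i y. ceval C (map (\<lambda>f. f y) ?fs) ! i) ` {..<1}"
        by (rule subsetI, elim singletonE, rule UnI2, rule image_eqI[of _ _ 0]) simp_all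
    qed simp
    then show ?thesis
    proof (rule ext_cong1)
      fix y :: "bool list" assume "y \<in> strings n"
      then have "map2 (\<lambda>a b. [a, b]) y r = map (\<lambda>j. [y ! j, r ! j]) [0..<n]"
        using r by (intro nth_equalityI) (auto simp: strings_def)
      then have "map (\<lambda>f. f y) ?fs = mix y r z"
        by (simp add: mix_def map_concat o_def)
      moreover have "length (ceval C (mix y r z)) = 1"
        using C by (simp add: ceval_wires is_circuit_def)
      ultimately show "ceval C (map (\<lambda>f. f y) ?fs) ! 0 = (ceval C (mix y r z) = [True])"
        by (cases "ceval C (mix y r z)") auto
    qed
  qed
  have bit: "ext (csize C + 3) ?F {?bit i wb}" if wb: "wb \<in> set ?wbs" for i wb
  proof -
    have "fst wb \<in> strings n"
      using wb lin_combs_strings[OF \<rho>] set_zip_leftD[of "fst wb" "snd wb"] by (auto simp del: fst_conv)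
    then have len: "length (xorv (fst wb) (unit_vec n i)) = n" by (simp add: strings_def)
    show ?thesis
    proof (cases "snd wb")
      case True
      then have "?bit i wb = (\<lambda>y. \<not> (ceval C (mix y (xorv (fst wb) (unit_vec n i)) z) = [True]))"
        by simp
      moreover have "csize C + 2 + 1 = csize C + 3" by simp
      ultimately show ?thesis using ext_not[OF pred[OF len]] by (simp only:)
    next
      case False
      then have "?bit i wb = (\<lambda>y. ceval C (mix y (xorv (fst wb) (unit_vec n i)) z) = [True])"
        by simp
      with ext_mono[OF pred[OF len] _ order_refl order_refl, of "csize C + 3"] show ?thesis by simp
    qed
  qed
  let ?maj = "\<lambda>i y. majority_bit n (\<lambda>r. ceval C (mix y r z) = [True]) \<rho> \<beta> i"
  have maj: "ext (?M * (csize C + 3) + (?M * ((?M div 2 + 1 + 1) * 2) + (?M div 2 + 1 + 1))) ?F {?maj i}" for i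
  proof -
    have "ext (?M * (csize C + 3) + (?M * ((?M div 2 + 1 + 1) * 2) + (?M div 2 + 1 + 1))) ?F
        {at_least (?M div 2 + 1) (map (?bit i) ?wbs)}"
    proof -
      have "ext (csize C + 3) ?F {f}" if "f \<in> set (map (?bit i) ?wbs)" for f
      proof -
        from that obtain wb where "wb \<in> set ?wbs" "f = ?bit i wb" unfolding set_map by (rule imageE)
        then show ?thesis using bit[of wb i] by (simp only:)
      qed
      from ext_threshold[of "map (?bit i) ?wbs", OF this, where c = "?M div 2 + 1"] show ?thesis
        unfolding length_map len_wbs .
    qed
    then show ?thesis
      by (rule ext_cong1) (auto simp: at_least_def majority_bit_def filter_map o_def case_prod_unfold t)
  qed
  have "ext (card {..<n} * (?M * (csize C + 3) + (?M * ((?M div 2 + 1 + 1) * 2) + (?M div 2 + 1 + 1)))) ?F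
      (\<Union>i\<in>{..<n}. {?maj i})"
    by (intro ext_UN maj) simp
  moreover have "(\<Union>i\<in>{..<n}. {?maj i}) = set (map ?maj [0..<n])"
    by (simp only: set_map set_upt atLeast0LessThan UNION_singleton_eq_range)
  ultimately have "ext (inverter_cost n ?M (csize C)) ?F (set (map ?maj [0..<n]))"
    by (simp only: inverter_cost_def card_lessThan)
  from ext_circuit[OF this order_refl] show ?thesis by (simp add: o_def)
qed

lemma ex_circuit_of_fun:
  "\<exists>C. is_circuit l 1 C \<and> csize C = 6 * 2 ^ l \<and> (\<forall>u\<in>strings l. ceval C u = [f u])"
proof -
  interpret encoded_domain l "\<lambda>u. u" "strings l"
    by unfold_locales (simp add: strings_def)
  let ?fs = "map (\<lambda>i (u :: bool list). u ! i) [0..<l]"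
  have "ext (6 * 2 ^ length ?fs) ((\<lambda>i u. u ! i) ` {..<l}) {\<lambda>u. f (map (\<lambda>g. g u) ?fs)}"
    by (rule ext_fun) auto
  then have "ext (6 * 2 ^ l) ((\<lambda>i u. u ! i) ` {..<l}) {\<lambda>u. f (map (\<lambda>g. g u) ?fs)}"
    by (simp only: length_map length_upt diff_zero)
  then have "ext (6 * 2 ^ l) ((\<lambda>i u. u ! i) ` {..<l}) {f}"
  proof (rule ext_cong1)
    fix u :: "bool list" assume "u \<in> strings l"
    then have "map (\<lambda>g. g u) ?fs = u" by (intro nth_equalityI) (auto simp: strings_def)
    then show "f (map (\<lambda>g. g u) ?fs) = f u" by (rule arg_cong)
  qed
  then have "ext (6 * 2 ^ l) ((\<lambda>i u. u ! i) ` {..<l}) (set [f])" by simp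
  from ext_circuit[OF this order_refl] show ?thesis by simp
qed

text \<open>\<open>Sup\<close> is an upper bound only if the set is bounded. From size 6 * 2^l on,
  some circuit agrees with \<open>f\<close> everywhere, and its success probability 1 is not below 1
  / 2 + 1 / (2 S').\<close>

lemma hardness_ge:
  assumes "S \<ge> 1" "hard_at f (1 / real S) S l"
  shows "S \<le> hardness f l"
proof -
  have "S' < 6 * 2 ^ l" if S': "S' \<ge> 1" "hard_at f (1 / real S') S' l" for S'
  proof (rule ccontr)
    assume "\<not> S' < 6 * 2 ^ l"
    with ex_circuit_of_fun[of l f] obtain C where
      C: "is_circuit l 1 C" "csize C \<le> S'" "\<forall>u\<in>strings l. ceval C u = [f u]" by auto
    have "{u \<in> strings l. ceval C u = [f u]} = strings l" using C(3) by auto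
    then have "unif_prob l (\<lambda>u. ceval C u = [f u]) = 1" by (simp add: unif_prob_eq card_strings)
    moreover have "unif_prob l (\<lambda>u. ceval C u = [f u]) < 1 / 2 + 1 / real S' / 2"
      using S'(2) C by (auto simp: hard_at_def)
    moreover have "1 / real S' \<le> 1" using S'(1) by simp
    ultimately show False by simp
  qed
  then have "bdd_above {S. S \<ge> 1 \<and> hard_at f (1 / real S) S l}"
    by (intro bdd_aboveI[of _ "6 * 2 ^ l"]) (auto intro: less_imp_le)
  then show ?thesis
    unfolding hardness_def using assms by (intro cSup_upper) auto
qed

section \<open>The Goldreich-Levin bit of a permutation and its hardness\<close>

fun evens :: "bool list \<Rightarrow> bool list" where
  "evens (a # b # u) = a # evens u"
| "evens _ = []"

fun odds :: "bool list \<Rightarrow> bool list" where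
  "odds (a # b # u) = b # odds u"
| "odds _ = []"

lemma length_evens_odds [simp]: "length (evens u) = length u div 2" "length (odds u) = length u div 2"
  by (induction u rule: evens.induct) auto

lemma evens_odds_mix [simp]:
  "length y = length r \<Longrightarrow> length z \<le> 1 \<Longrightarrow> evens (mix y r z) = y"
  "length y = length r \<Longrightarrow> length z \<le> 1 \<Longrightarrow> odds (mix y r z) = r"
  by (induction y r rule: list_induct2; cases z; auto)+

lemma mix_evens_odds: "mix (evens u) (odds u) (drop (2 * (length u div 2)) u) = u"
  by (induction u rule: evens.induct) auto

text \<open>\<open>evens\<close> and \<open>odds\<close> drop a lone last bit, so the function has a
  sensible value at odd lengths too, as hardness at all large lengths demands.\<close>

definition gl_bit :: "(bool list \<Rightarrow> bool list) \<Rightarrow> bool list \<Rightarrow> bool" where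
  "gl_bit h u = ip (inv_into (strings (length u div 2)) h (evens u)) (odds u)"

lemma gl_bit_mix:
  assumes "bij_betw h (strings n) (strings n)" "v \<in> strings n" "r \<in> strings n" "length z \<le> 1"
  shows "gl_bit h (mix (h v) r z) = ip v r"
proof -
  have "length (h v) = n" "length r = n"
    using bij_betwE[OF assms(1)] assms(2,3) by (auto simp: strings_def)
  then have "gl_bit h (mix (h v) r z) = ip (inv_into (strings n) h (h v)) r"
    using assms(4) by (simp add: gl_bit_def length_mix)
  also have "inv_into (strings n) h (h v) = v"
    using assms(1,2) by (intro inv_into_f_f) (auto simp: bij_betw_def)
  finally show ?thesis .
qed

text \<open>As h permutes the strings of length n, a uniform u can be generated from uniform z, v
  and r. The preimage v of its first part is then known without inverting h.\<close>

lemma sum_strings_mix: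
  assumes h: "bij_betw h (strings n) (strings n)" and k: "k \<le> 1"
  shows "(\<Sum>u\<in>strings (2 * n + k). g u) =
    (\<Sum>z\<in>strings k. \<Sum>v\<in>strings n. \<Sum>r\<in>strings n. g (mix (h v) r z) :: real)"
proof -
  let ?m = "\<lambda>(z, v, r). mix (h v) r z"
  have len: "length (h v) = n" if "length v = n" for v
    using bij_betwE[OF h] that by (auto simp: strings_def)
  have "bij_betw ?m (strings k \<times> strings n \<times> strings n) (strings (2 * n + k))"
    unfolding bij_betw_def
  proof (intro conjI equalityI subsetI)
    have "z = z' \<and> v = v' \<and> r = r'"
      if *: "length z = k" "length v = n" "length r = n" "length z' = k" "length v' = n" "length r' = n"
        "mix (h v) r z = mix (h v') r' z'" for z v r z' v' r'
    proof -
      have "h v = h v'" "r = r'"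
        using evens_odds_mix[of "h v" r z] evens_odds_mix[of "h v'" r' z'] * k len by simp_all
      moreover from this * have "v = v'" using h by (auto simp: bij_betw_def inj_on_def strings_def)
      ultimately show ?thesis using *(7) by (simp add: mix_def)
    qed
    then show "inj_on ?m (strings k \<times> strings n \<times> strings n)"
      by (auto simp: inj_on_def strings_def)
    fix u assume "u \<in> strings (2 * n + k)"
    then have u: "length u = 2 * n + k" by (simp add: strings_def)
    with k have half: "length u div 2 = n" by linarith
    then have "evens u \<in> h ` strings n" using h by (auto simp: bij_betw_def strings_def)
    then obtain v where "v \<in> strings n" "evens u = h v" by blast
    moreover have "u = mix (evens u) (odds u) (drop (2 * n) u)" using mix_evens_odds[of u] half by simp
    moreover have "drop (2 * n) u \<in> strings k" "odds u \<in> strings n" using u half by (auto simp: strings_def)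
    ultimately show "u \<in> ?m ` (strings k \<times> strings n \<times> strings n)"
      by (intro image_eqI[of _ _ "(drop (2 * n) u, v, odds u)"]) auto
  next
    fix u assume "u \<in> ?m ` (strings k \<times> strings n \<times> strings n)"
    then show "u \<in> strings (2 * n + k)" by (auto simp: strings_def length_mix len)
  qed
  from sum.reindex_bij_betw[OF this, of g, symmetric] show ?thesis
    by (simp add: sum.cartesian_product case_prod_unfold)
qed

lemma ex_power_of_two_between: "x \<ge> 1 \<Longrightarrow> \<exists>t. x \<le> 2 ^ t \<and> 2 ^ t < 2 * (x::nat)"
proof (induction x rule: dec_induct)
  case (step x)
  then obtain t where "x \<le> 2 ^ t" "2 ^ t < 2 * x" by blast
  then show ?case
    by (cases "x = 2 ^ t") (auto intro: exI[of _ t] exI[of _ "Suc t"])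
qed (auto intro: exI[of _ 0])

lemma inverter_cost_le:
  assumes "1 \<le> M" "s \<le> M"
  shows "inverter_cost n M s \<le> n * (18 * M\<^sup>2)"
proof -
  have "M * (s + 3) \<le> M * (4 * M)" using assms by (intro mult_left_mono) auto
  then have 1: "M * (s + 3) \<le> 4 * M\<^sup>2" by (simp add: power2_eq_square)
  have "M * ((M div 2 + 1 + 1) * 2) \<le> M * (5 * M)" using assms by (intro mult_left_mono) auto
  then have 2: "M * ((M div 2 + 1 + 1) * 2) \<le> 5 * M\<^sup>2" by (simp only: power2_eq_square mult_ac)
  have "M div 2 + 1 + 1 \<le> 3 * M" using assms by linarith
  moreover have "M \<le> M\<^sup>2" by (simp add: power2_eq_square)
  ultimately have "M * (s + 3) + (M * ((M div 2 + 1 + 1) * 2) + (M div 2 + 1 + 1)) \<le> 18 * M\<^sup>2"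
    using 1 2 by linarith
  then show ?thesis unfolding inverter_cost_def by (rule mult_left_mono) simp
qed

text \<open>For advantage 1 / S the number 2^t of votes is taken between 32 n S^2 and 64 n S^2. The
  inverter then has size at most 18 n (64 n S^2)^2 = 73728 n^3 S^4, and its success probability is
  at least 1 / (4 S 2^t), hence at least 1 / (256 n S^3).\<close>

lemma one_way_imp_hard_at:
  assumes h: "bij_betw h (strings n) (strings n)" and ow: "one_way_at h \<delta> \<tau> n"
    and k: "k \<le> 1" and n: "n \<ge> 1" and S: "S \<ge> 1"
    and \<tau>: "73728 * real n ^ 3 * real S ^ 4 \<le> \<tau>" and \<delta>: "\<delta> * (256 * real n * real S ^ 3) < 1"
  shows "hard_at (gl_bit h) (1 / real S) S (2 * n + k)"
proof (rule ccontr)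
  let ?l = "2 * n + k" and ?f = "gl_bit h" and ?\<epsilon> = "1 / real S" and ?V = "strings n"
  assume "\<not> ?thesis"
  then obtain C where C: "is_circuit ?l 1 C" "csize C \<le> S"
    and prob: "1 / 2 + ?\<epsilon> / 2 \<le> unif_prob ?l (\<lambda>u. ceval C u = [?f u])"
    by (auto simp: hard_at_def not_less)
  define G where "G z y r \<longleftrightarrow> ceval C (mix y r z) = [True]" for z y r
  have C_bit: "ceval C u = [?f u] \<longleftrightarrow> (ceval C u = [True]) = ?f u" for u
  proof -
    have "length (ceval C u) = 1" using C(1) by (simp add: ceval_wires is_circuit_def)
    then show ?thesis by (cases "ceval C u") auto
  qed
  let ?good = "{u \<in> strings ?l. ceval C u = [?f u]}"
  have "?\<epsilon> * 2 ^ ?l \<le> 2 * real (card ?good) - 2 ^ ?l"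
    using prob by (simp add: unif_prob_eq field_simps)
  also have "\<dots> = (\<Sum>u\<in>strings ?l. (if ceval C u = [?f u] then 2 else 0) - 1)"
    by (simp add: sum_subtractf card_strings sum.If_cases Int_def)
  also have "\<dots> = (\<Sum>u\<in>strings ?l. sg (ceval C u = [True]) * sg (?f u))"
    by (rule sum.cong) (auto simp: C_bit sg_def)
  also have "\<dots> = (\<Sum>z\<in>strings k. \<Sum>v\<in>?V. \<Sum>r\<in>?V. sg (G z (h v) r) * sg (ip v r))"
    unfolding sum_strings_mix[OF h k] using k
    by (intro sum.cong refl) (auto simp: G_def strings_def gl_bit_mix[OF h, unfolded strings_def])
  finally have adv: "?\<epsilon> * 2 ^ ?l \<le> (\<Sum>z\<in>strings k. \<Sum>v\<in>?V. \<Sum>r\<in>?V. sg (G z (h v) r) * sg (ip v r))" .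
  \<comment> \<open>The bit left over at odd length is fixed to a value for which the predictor has
    at least its average advantage.\<close>
  have "\<exists>z\<in>strings k. ?\<epsilon> * (2 ^ n)\<^sup>2 \<le> (\<Sum>v\<in>?V. \<Sum>r\<in>?V. sg (G z (h v) r) * sg (ip v r))"
  proof (rule ccontr)
    assume "\<not> ?thesis"
    moreover have "strings k \<noteq> {}" using card_strings[of k] by auto
    ultimately have "(\<Sum>z\<in>strings k. \<Sum>v\<in>?V. \<Sum>r\<in>?V. sg (G z (h v) r) * sg (ip v r))
        < (\<Sum>z\<in>strings k. ?\<epsilon> * (2 ^ n)\<^sup>2)"
      by (intro sum_strict_mono) (auto simp: not_le)
    also have "\<dots> = ?\<epsilon> * 2 ^ ?l" by (simp add: card_strings power_add power2_eq_square mult_2)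
    finally show False using adv by simp
  qed
  then obtain z where z: "length z = k"
    and advz: "?\<epsilon> * (2 ^ n)\<^sup>2 \<le> (\<Sum>v\<in>?V. \<Sum>r\<in>?V. sg (G z (h v) r) * sg (ip v r))"
    by (auto simp: strings_def)
  have "1 \<le> 32 * n * S\<^sup>2" using n S by (simp add: Suc_le_eq)
  from ex_power_of_two_between[OF this] obtain t where
    t: "32 * n * S\<^sup>2 \<le> 2 ^ t" "2 ^ t \<le> 64 * n * S\<^sup>2" by auto
  let ?M = "2 ^ t :: nat"
  have t': "real (32 * n * S\<^sup>2) \<le> real ?M" "real ?M \<le> real (64 * n * S\<^sup>2)"
    using t by (simp_all only: of_nat_le_iff)
  have "32 * real n \<le> 2 ^ t * ?\<epsilon>\<^sup>2" using t'(1) S by (simp add: field_simps)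
  from goldreich_levin[where G = "G z" and h = h, OF _ advz this] S obtain \<rho> \<beta> where \<rho>: "\<rho> \<in> tuples n t" and \<beta>: "length \<beta> = t"
    and many: "?\<epsilon> * 2 ^ n \<le> 4 * 2 ^ t *
      real (card {v \<in> ?V. \<forall>i<n. majority_bit n (G z (h v)) \<rho> \<beta> i = v ! i})" by auto
  from ex_inverter[OF _ \<rho> \<beta>, of z C] C(1) z obtain D where D: "is_circuit n n D"
    "csize D = inverter_cost n ?M (csize C)"
    "\<And>y. y \<in> ?V \<Longrightarrow> ceval D y = map (majority_bit n (G z y) \<rho> \<beta>) [0..<n]"
    by (auto simp: G_def[abs_def])
  have "S \<le> 32 * n * S\<^sup>2" using n S by (simp add: power2_eq_square)
  then have SM: "csize C \<le> ?M" using t(1) C(2) by linarith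
  have "csize D \<le> n * (18 * ?M\<^sup>2)"
    unfolding D(2) by (rule inverter_cost_le[OF _ SM]) simp
  also have "\<dots> \<le> n * (18 * (64 * n * S\<^sup>2)\<^sup>2)"
    using t(2) by (intro mult_left_mono power_mono) auto
  finally have "real (csize D) \<le> real (n * (18 * (64 * n * S\<^sup>2)\<^sup>2))" by (simp only: of_nat_le_iff)
  also have "\<dots> = 73728 * real n ^ 3 * real S ^ 4"
    by (simp add: power_mult_distrib eval_nat_numeral)
  finally have "real (csize D) \<le> \<tau>" using \<tau> by simp
  with ow D(1) have "unif_prob n (\<lambda>v. ceval D (h v) = v) \<le> \<delta>" by (auto simp: one_way_at_def)
  moreover have "{v \<in> ?V. \<forall>i<n. majority_bit n (G z (h v)) \<rho> \<beta> i = v ! i} = {v \<in> ?V. ceval D (h v) = v}"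
  proof (rule Collect_cong, rule conj_cong[OF refl])
    fix v assume v: "v \<in> ?V"
    then have "length v = n" "h v \<in> ?V" using bij_betwE[OF h] by (simp_all add: strings_def)
    then show "(\<forall>i<n. majority_bit n (G z (h v)) \<rho> \<beta> i = v ! i) = (ceval D (h v) = v)"
      by (simp add: D(3) list_eq_iff_nth_eq)
  qed
  ultimately have "real (card {v \<in> ?V. \<forall>i<n. majority_bit n (G z (h v)) \<rho> \<beta> i = v ! i}) \<le> \<delta> * 2 ^ n"
    by (simp add: unif_prob_eq field_simps)
  then have "4 * 2 ^ t * real (card {v \<in> ?V. \<forall>i<n. majority_bit n (G z (h v)) \<rho> \<beta> i = v ! i})
      \<le> 4 * 2 ^ t * (\<delta> * 2 ^ n)"
    by (intro mult_left_mono) auto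
  from order_trans[OF many this] have "?\<epsilon> * 2 ^ n \<le> (4 * 2 ^ t * \<delta>) * 2 ^ n" by (simp only: mult_ac)
  then have "?\<epsilon> \<le> 4 * 2 ^ t * \<delta>" by (simp only: mult_le_cancel_right_pos zero_less_power zero_less_numeral)
  then have one: "1 \<le> 4 * real S * 2 ^ t * \<delta>" using S by (simp add: field_simps)
  \<comment> \<open>The sign matters because 2^t is next replaced by its upper bound in a product
    with \<delta>.\<close>
  have "0 \<le> \<delta>"
  proof (rule ccontr)
    assume "\<not> 0 \<le> \<delta>"
    then have "4 * real S * 2 ^ t * \<delta> \<le> 0" by (intro mult_nonneg_nonpos) auto
    with one show False by simp
  qed
  then have "4 * real S * 2 ^ t * \<delta> \<le> 4 * real S * (64 * real n * (real S)\<^sup>2) * \<delta>"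
    using t'(2) by (intro mult_right_mono mult_left_mono) auto
  also have "\<dots> = \<delta> * (256 * real n * real S ^ 3)" by (simp add: eval_nat_numeral)
  finally have "4 * real S * 2 ^ t * \<delta> \<le> \<delta> * (256 * real n * real S ^ 3)" .
  with one \<delta> show False by linarith
qed

text \<open>Halving the exponent makes room for every polynomial loss: if S is about 2^(l^(\<gamma>
  / 2)), then a fixed power of S times a polynomial in l stays below 2^((l / 3)^\<gamma>).\<close>

lemma exp_hard_gl_bit:
  assumes "exp_hard_owp h"
  shows "exp_hard (gl_bit h)"
proof -
  obtain \<gamma> where \<gamma>: "\<gamma> > 0" and ev: "\<forall>\<^sub>F n in sequentially.
        one_way_at h (2 powr - (real n powr \<gamma>)) (2 powr (real n powr \<gamma>)) n"
    and h: "\<And>n. bij_betw h (strings n) (strings n)"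
    using assms by (auto simp: exp_hard_owp_def)
  from ev obtain N where N: "\<And>n. n \<ge> N \<Longrightarrow>
      one_way_at h (2 powr - (real n powr \<gamma>)) (2 powr (real n powr \<gamma>)) n"
    by (auto simp: eventually_sequentially)
  have ow: "\<forall>\<^sub>F l in sequentially. one_way_at h (2 powr - (real (l div 2) powr \<gamma>))
      (2 powr (real (l div 2) powr \<gamma>)) (l div 2)"
    by (rule eventually_sequentiallyI[of "2 * N"], rule N) linarith
  \<comment> \<open>Rounding at most doubles S, which accounts for 1179648 = 16 * 73728. The
    quotient l / 3 is a lower bound of \<open>l div 2\<close> for l at least 3.\<close>
  have big: "\<forall>\<^sub>F l::nat in sequentially.
      1179648 * real l ^ 3 * 2 powr (4 * real l powr (\<gamma> / 2)) < 2 powr ((real l / 3) powr \<gamma>)"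
    using \<gamma> by real_asymp
  have "\<forall>\<^sub>F l in sequentially. 2 powr (real l powr (\<gamma> / 2)) \<le> real (hardness (gl_bit h) l)"
    using ow big eventually_ge_at_top[of 3]
  proof eventually_elim
    case (elim l)
    define n k S where "n = l div 2" and "k = l mod 2" and "S = nat \<lceil>2 powr (real l powr (\<gamma> / 2))\<rceil>"
    have l: "l = 2 * n + k" "k \<le> 1" "n \<ge> 1" "n \<le> l" "l \<le> 3 * n"
      using elim(3) by (auto simp: n_def k_def)
    have S: "2 powr (real l powr (\<gamma> / 2)) \<le> real S" by (simp add: S_def)
    moreover have S1: "1 \<le> 2 powr (real l powr (\<gamma> / 2))" by (rule ge_one_powr_ge_zero) auto
    ultimately have "S \<ge> 1" by linarith
    have "real S \<le> 2 powr (real l powr (\<gamma> / 2)) + 1"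
      using S1 unfolding S_def by linarith
    then have S2: "real S \<le> 2 * 2 powr (real l powr (\<gamma> / 2))" using S1 by linarith
    have "73728 * real n ^ 3 * real S ^ 4 \<le> 73728 * real l ^ 3 * (2 * 2 powr (real l powr (\<gamma> / 2))) ^ 4"
      using S2 l(4) by (intro mult_mono power_mono) auto
    also have "\<dots> = 1179648 * real l ^ 3 * 2 powr (4 * real l powr (\<gamma> / 2))"
      by (simp add: power_mult_distrib powr_power)
    also have "\<dots> < 2 powr ((real l / 3) powr \<gamma>)" by (rule elim(2))
    also have "\<dots> \<le> 2 powr (real n powr \<gamma>)"
      using l(5) \<gamma> by (intro powr_mono powr_mono2) auto
    finally have size: "73728 * real n ^ 3 * real S ^ 4 < 2 powr (real n powr \<gamma>)" .
    \<comment> \<open>The term for the success probability is below the term for the size, so one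
      estimate meets both conditions.\<close>
    have "256 * real n * real S ^ 3 \<le> 73728 * real n ^ 3 * real S ^ 4"
      using l(3) \<open>S \<ge> 1\<close> by (intro mult_mono) (auto simp: self_le_power power_increasing)
    with size have "256 * real n * real S ^ 3 < 2 powr (real n powr \<gamma>)" by linarith
    then have "2 powr - (real n powr \<gamma>) * (256 * real n * real S ^ 3) < 1"
      by (simp add: powr_minus field_simps)
    then have "hard_at (gl_bit h) (1 / real S) S (2 * n + k)"
      using elim(1) l(2,3) \<open>S \<ge> 1\<close> size unfolding n_def[symmetric]
      by (intro one_way_imp_hard_at[OF h]) auto
    then have "S \<le> hardness (gl_bit h) l" using \<open>S \<ge> 1\<close> l(1) by (auto intro: hardness_ge)
    with S show ?case by linarith
  qed
  with \<gamma> show ?thesis unfolding exp_hard_def by (intro exI[of _ "\<gamma> / 2"]) auto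
qed

section \<open>Programming Turing machines\<close>

text \<open>Only the last configuration may be halted. When a machine becomes part of a larger one,
  its halting state can therefore be identified with the state in which the computation
  continues.\<close>

inductive reach :: "tm \<Rightarrow> config \<Rightarrow> nat \<Rightarrow> config \<Rightarrow> bool" for M where
  reach_refl: "reach M c 0 c"
| reach_step: "fst c < nstates M \<Longrightarrow> reach M (step M c) t c' \<Longrightarrow> reach M c (Suc t) c'"

lemma reach_trans: "reach M c t c' \<Longrightarrow> reach M c' t' c'' \<Longrightarrow> reach M c (t + t') c''"
  by (induction rule: reach.induct) (auto intro: reach.intros)

lemma reach_1: "fst c < nstates M \<Longrightarrow> step M c = c' \<Longrightarrow> reach M c 1 c'"
  by (metis One_nat_def reach_refl reach_step)

lemma reach_imp_steps: "reach M c t c' \<Longrightarrow> (step M ^^ t) c = c'"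
  by (induction rule: reach.induct) (auto simp: funpow_swap1)

lemma step_halted: "fst c \<ge> nstates M \<Longrightarrow> step M c = c"
  by (cases c) simp

declare step.simps [simp del]

lemma steps_halted: "fst c \<ge> nstates M \<Longrightarrow> (step M ^^ t) c = c"
  by (induction t) (simp_all add: step_halted)

text \<open>\<open>outputs_within\<close> also counts idle steps after halting; here they are cut
  off.\<close>

lemma steps_imp_reach:
  assumes "(step M ^^ t) c = c'" "fst c' \<ge> nstates M"
  shows "\<exists>t'\<le>t. reach M c t' c'"
  using assms
proof (induction t arbitrary: c)
  case 0
  then show ?case by (auto intro: reach_refl)
next
  case (Suc t)
  show ?case
  proof (cases "fst c < nstates M")
    case True
    from Suc.prems have "(step M ^^ t) (step M c) = c'" by (simp add: funpow_swap1)
    from Suc.IH[OF this Suc.prems(2)] obtain t' where "t' \<le> t" "reach M (step M c) t' c'" by blast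
    with True show ?thesis by (intro exI[of _ "Suc t'"]) (auto intro: reach_step)
  next
    case False
    then have "c' = c" using Suc.prems steps_halted[of M c "Suc t"] by simp
    then show ?thesis by (auto intro: reach_refl)
  qed
qed

text \<open>The renaming \<open>e\<close> is constrained only on states that are not halting. It may
  send the halting state anywhere, for instance to the start of the next machine, and all
  combinators rest on this.\<close>

lemma reach_embed:
  assumes "reach M c t c'"
    and "\<And>q ss. q < nstates M \<Longrightarrow> e q < nstates M'"
    and "\<And>q ss. q < nstates M \<Longrightarrow> trans M' (e q) ss = (e (fst (trans M q ss)), snd (trans M q ss))"
  shows "reach M' (e (fst c), snd c) t (e (fst c'), snd c')"
  using assms(1)
proof (induction rule: reach.induct)
  case (reach_step c t c')
  have "step M' (e (fst c), snd c) = (e (fst (step M c)), snd (step M c))"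
    using reach_step.hyps(1) assms(2,3) by (simp add: step_next_move next_move_def)
  with reach_step assms(2) show ?case by (auto intro!: reach.reach_step)
qed (auto intro: reach_refl)

definition wf_prog :: "nat \<Rightarrow> tm \<Rightarrow> bool" where
  "wf_prog r M \<longleftrightarrow> wf_tm M \<and> ntapes M = r"

text \<open>The time is an upper bound, so that it can be relaxed freely, in particular to a common
  bound for both branches of a conditional.\<close>

definition runs :: "nat \<Rightarrow> tm \<Rightarrow> nat \<Rightarrow> (nat \<Rightarrow> tape) \<Rightarrow> (nat \<Rightarrow> tape) \<Rightarrow> bool" where
  "runs r M t \<sigma> \<sigma>' \<longleftrightarrow>
     (\<exists>t'\<le>t. reach M (0, map \<sigma> [0..<r]) t' (nstates M, map \<sigma>' [0..<r]))"

lemma runs_mono: "runs r M t \<sigma> \<sigma>' \<Longrightarrow> t \<le> t' \<Longrightarrow> runs r M t' \<sigma> \<sigma>'"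
  unfolding runs_def by (meson order_trans)

lemma runs_cong:
  assumes "runs r M t \<sigma> \<sigma>'" "\<And>i. i < r \<Longrightarrow> \<sigma> i = \<tau> i" "\<And>i. i < r \<Longrightarrow> \<sigma>' i = \<tau>' i"
  shows "runs r M t \<tau> \<tau>'"
proof -
  have "map \<sigma> [0..<r] = map \<tau> [0..<r]" "map \<sigma>' [0..<r] = map \<tau>' [0..<r]" using assms by auto
  with assms(1) show ?thesis by (simp add: runs_def)
qed

definition seen :: "bool option list \<Rightarrow> nat \<Rightarrow> bool option" where
  "seen ss i = (if i < length ss then ss ! i else None)"

definition reads :: "nat \<Rightarrow> (nat \<Rightarrow> tape) \<Rightarrow> nat \<Rightarrow> bool option" where
  "reads r \<sigma> i = (if i < r then rd (\<sigma> i) else None)"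

lemma seen_reads: "seen (map (\<lambda>i. rd (\<sigma> i)) [0..<r]) = reads r \<sigma>"
  by (auto simp: seen_def reads_def)

lemma reads_less [simp]: "i < r \<Longrightarrow> reads r \<sigma> i = rd (\<sigma> i)"
  by (simp add: reads_def)

lemma step_tapes:
  "q < nstates M \<Longrightarrow> trans M q (map (\<lambda>i. rd (\<sigma> i)) [0..<r]) = (q', map g [0..<r]) \<Longrightarrow>
    step M (q, map \<sigma> [0..<r]) = (q', map (\<lambda>i. act (g i) (\<sigma> i)) [0..<r])"
  unfolding step_next_move by (simp add: next_move_def o_def map2_map_map)

lemma act_rd [simp]: "act (rd tp, Stay) tp = tp"
  by (cases tp) (simp add: rd_def)

subsection \<open>Combinators\<close>

definition prim :: "nat \<Rightarrow> ((nat \<Rightarrow> bool option) \<Rightarrow> nat \<Rightarrow> bool option \<times> dir) \<Rightarrow> tm" where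
  "prim r g = TM r 1 (\<lambda>q ss. (1, map (g (seen ss)) [0..<r]))"

lemma wf_prim [simp]: "r \<ge> 1 \<Longrightarrow> wf_prog r (prim r g)"
  by (simp add: wf_prog_def wf_tm_def prim_def)

lemma runs_prim:
  assumes "\<And>i. i < r \<Longrightarrow> \<sigma>' i = act (g (reads r \<sigma>) i) (\<sigma> i)"
  shows "runs r (prim r g) 1 \<sigma> \<sigma>'"
proof -
  have "step (prim r g) (0, map \<sigma> [0..<r]) = (1, map (\<lambda>i. act (g (reads r \<sigma>) i) (\<sigma> i)) [0..<r])"
    by (rule step_tapes) (simp_all add: prim_def seen_reads)
  also have "\<dots> = (nstates (prim r g), map \<sigma>' [0..<r])"
    using assms by (simp add: prim_def)
  finally have "reach (prim r g) (0, map \<sigma> [0..<r]) 1 (nstates (prim r g), map \<sigma>' [0..<r])"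
    by (intro reach_1) (simp_all add: prim_def)
  then show ?thesis unfolding runs_def by blast
qed

definition seqm :: "tm \<Rightarrow> tm \<Rightarrow> tm" where
  "seqm M1 M2 = TM (ntapes M1) (nstates M1 + nstates M2) (\<lambda>q ss. if q < nstates M1 then trans M1 q ss
     else (fst (trans M2 (q - nstates M1) ss) + nstates M1, snd (trans M2 (q - nstates M1) ss)))"

lemma wf_seqm [simp]: "wf_prog r M1 \<Longrightarrow> wf_prog r M2 \<Longrightarrow> wf_prog r (seqm M1 M2)"
  by (auto simp: wf_prog_def wf_tm_def seqm_def intro: trans_le_add1 split: if_splits)

lemma runs_seqm:
  assumes "runs r M1 t1 \<sigma> \<sigma>1" "runs r M2 t2 \<sigma>1 \<sigma>2"
  shows "runs r (seqm M1 M2) (t1 + t2) \<sigma> \<sigma>2"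
proof -
  obtain s1 where s1: "s1 \<le> t1" "reach M1 (0, map \<sigma> [0..<r]) s1 (nstates M1, map \<sigma>1 [0..<r])"
    using assms(1) by (auto simp: runs_def)
  obtain s2 where s2: "s2 \<le> t2" "reach M2 (0, map \<sigma>1 [0..<r]) s2 (nstates M2, map \<sigma>2 [0..<r])"
    using assms(2) by (auto simp: runs_def)
  have "reach (seqm M1 M2) (0, map \<sigma> [0..<r]) s1 (nstates M1, map \<sigma>1 [0..<r])"
    using reach_embed[OF s1(2), of "\<lambda>q. q" "seqm M1 M2"] by (simp add: seqm_def)
  moreover have "reach (seqm M1 M2) (nstates M1, map \<sigma>1 [0..<r]) s2
      (nstates (seqm M1 M2), map \<sigma>2 [0..<r])"
    using reach_embed[OF s2(2), of "\<lambda>q. q + nstates M1" "seqm M1 M2"] by (simp add: seqm_def add.commute)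
  ultimately have "reach (seqm M1 M2) (0, map \<sigma> [0..<r]) (s1 + s2) (nstates (seqm M1 M2), map \<sigma>2 [0..<r])"
    by (rule reach_trans)
  with s1(1) s2(1) show ?thesis
    unfolding runs_def by (intro exI[of _ "s1 + s2"]) auto
qed

definition stay :: "bool option list \<Rightarrow> (bool option \<times> dir) list" where
  "stay ss = map (\<lambda>s. (s, Stay)) ss"

lemma stay_reads: "stay (map (\<lambda>i. rd (\<sigma> i)) [0..<r]) = map (\<lambda>i. (rd (\<sigma> i), Stay)) [0..<r]"
  by (simp add: stay_def)

definition loop_state :: "nat \<Rightarrow> nat \<Rightarrow> nat" where
  "loop_state n q = (if q = n then 0 else Suc q)"

text \<open>State 0 performs the test without changing the tapes. The states of the body come after
  it, and the halting state of the body is identified with 0 again.\<close>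

definition whilem :: "((nat \<Rightarrow> bool option) \<Rightarrow> bool) \<Rightarrow> tm \<Rightarrow> tm" where
  "whilem P M = TM (ntapes M) (Suc (nstates M)) (\<lambda>q ss.
     if q = 0 then (if P (seen ss) then loop_state (nstates M) 0 else Suc (nstates M), stay ss)
     else (loop_state (nstates M) (fst (trans M (q - 1) ss)), snd (trans M (q - 1) ss)))"

lemma whilem_simps [simp]:
  "nstates (whilem P M) = Suc (nstates M)" "ntapes (whilem P M) = ntapes M"
  "trans (whilem P M) 0 ss = (if P (seen ss) then loop_state (nstates M) 0 else Suc (nstates M), stay ss)"
  "trans (whilem P M) (Suc q) ss = (loop_state (nstates M) (fst (trans M q ss)), snd (trans M q ss))"
  by (simp_all add: whilem_def)

lemma loop_state_le: "q \<le> n \<Longrightarrow> loop_state n q < Suc n"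
  by (simp add: loop_state_def)

lemma loop_state_simps [simp]: "loop_state n n = 0" "q < n \<Longrightarrow> loop_state n q = Suc q"
  by (simp_all add: loop_state_def)

lemma wf_whilem [simp]:
  assumes "wf_prog r M"
  shows "wf_prog r (whilem P M)"
proof -
  have M: "fst (trans M q ss) \<le> nstates M" "length (snd (trans M q ss)) = r"
    if "q < nstates M" "length ss = r" for q ss
    using that assms by (auto simp: wf_prog_def wf_tm_def)
  have "fst (trans (whilem P M) q ss) \<le> nstates (whilem P M) \<and>
      length (snd (trans (whilem P M) q ss)) = r" if "q < nstates (whilem P M)" "length ss = r" for q ss
  proof (cases q)
    case 0
    then show ?thesis using that loop_state_le[of 0 "nstates M"] by (simp add: stay_def)
  next
    case (Suc q')
    then show ?thesis using that M[of q' ss] loop_state_le[of "fst (trans M q' ss)" "nstates M"] by simp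
  qed
  then show ?thesis using assms by (simp add: wf_prog_def wf_tm_def)
qed

lemma runs_while_false:
  assumes "\<not> P (reads r \<sigma>)"
  shows "runs r (whilem P M) 1 \<sigma> \<sigma>"
proof -
  have "step (whilem P M) (0, map \<sigma> [0..<r]) =
      (Suc (nstates M), map (\<lambda>i. act (rd (\<sigma> i), Stay) (\<sigma> i)) [0..<r])"
    using assms by (intro step_tapes) (simp_all add: seen_reads stay_reads)
  then have "reach (whilem P M) (0, map \<sigma> [0..<r]) 1 (Suc (nstates M), map \<sigma> [0..<r])"
    by (intro reach_1) simp_all
  then show ?thesis unfolding runs_def by (intro exI[of _ 1]) simp
qed

lemma runs_while_true:
  assumes "P (reads r \<sigma>)" "runs r M t1 \<sigma> \<sigma>1" "runs r (whilem P M) t2 \<sigma>1 \<sigma>2"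
  shows "runs r (whilem P M) (1 + t1 + t2) \<sigma> \<sigma>2"
proof -
  let ?e = "loop_state (nstates M)" and ?W = "whilem P M"
  obtain s1 where s1: "s1 \<le> t1" "reach M (0, map \<sigma> [0..<r]) s1 (nstates M, map \<sigma>1 [0..<r])"
    using assms(2) by (auto simp: runs_def)
  obtain s2 where s2: "s2 \<le> t2" "reach ?W (0, map \<sigma>1 [0..<r]) s2 (nstates ?W, map \<sigma>2 [0..<r])"
    using assms(3) by (auto simp: runs_def)
  have "step ?W (0, map \<sigma> [0..<r]) = (?e 0, map (\<lambda>i. act (rd (\<sigma> i), Stay) (\<sigma> i)) [0..<r])"
    using assms(1) by (intro step_tapes) (simp_all add: seen_reads stay_reads)
  then have "reach ?W (0, map \<sigma> [0..<r]) 1 (?e 0, map \<sigma> [0..<r])"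
    by (intro reach_1) simp_all
  moreover have "reach ?W (?e 0, map \<sigma> [0..<r]) s1 (0, map \<sigma>1 [0..<r])"
    using reach_embed[OF s1(2), of ?e ?W] by simp
  ultimately have "reach ?W (0, map \<sigma> [0..<r]) (1 + s1 + s2) (nstates ?W, map \<sigma>2 [0..<r])"
    using s2(2) by (blast intro: reach_trans)
  with s1(1) s2(1) show ?thesis
    unfolding runs_def by (intro exI[of _ "1 + s1 + s2"]) auto
qed

lemma runs_while:
  assumes "\<And>p. p < N \<Longrightarrow> P (reads r (\<sigma> p)) \<and> runs r M c (\<sigma> p) (\<sigma> (Suc p))" "\<not> P (reads r (\<sigma> N))"
  shows "runs r (whilem P M) (N * (c + 1) + 1) (\<sigma> 0) (\<sigma> N)"
proof -
  have "k \<le> N \<Longrightarrow> runs r (whilem P M) (k * (c + 1) + 1) (\<sigma> (N - k)) (\<sigma> N)" for k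
  proof (induction k)
    case 0
    then show ?case using runs_while_false[of P r "\<sigma> N" M, OF assms(2)] by simp
  next
    case (Suc k)
    then have "runs r M c (\<sigma> (N - Suc k)) (\<sigma> (N - k))" "P (reads r (\<sigma> (N - Suc k)))"
      using assms(1)[of "N - Suc k"] by (simp_all add: Suc_diff_Suc)
    from runs_while_true[OF this(2,1) Suc.IH] Suc.prems show ?case
      by (auto elim: runs_mono)
  qed
  from this[of N] show ?thesis by simp
qed

definition branch_state :: "nat \<Rightarrow> nat \<Rightarrow> nat \<Rightarrow> nat \<Rightarrow> nat" where
  "branch_state n H k q = (if q = n then H else Suc (k + q))"

definition ifm :: "((nat \<Rightarrow> bool option) \<Rightarrow> bool) \<Rightarrow> tm \<Rightarrow> tm \<Rightarrow> tm" where
  "ifm P M1 M2 = (let n1 = nstates M1; n2 = nstates M2; H = Suc (n1 + n2) in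
     TM (ntapes M1) H (\<lambda>q ss.
       if q = 0 then (if P (seen ss) then branch_state n1 H 0 0 else branch_state n2 H n1 0, stay ss)
       else if q \<le> n1 then (branch_state n1 H 0 (fst (trans M1 (q - 1) ss)), snd (trans M1 (q - 1) ss))
       else (branch_state n2 H n1 (fst (trans M2 (q - 1 - n1) ss)), snd (trans M2 (q - 1 - n1) ss))))"

lemma ifm_simps [simp]:
  "nstates (ifm P M1 M2) = Suc (nstates M1 + nstates M2)" "ntapes (ifm P M1 M2) = ntapes M1"
  "trans (ifm P M1 M2) 0 ss = (if P (seen ss)
     then branch_state (nstates M1) (Suc (nstates M1 + nstates M2)) 0 0
     else branch_state (nstates M2) (Suc (nstates M1 + nstates M2)) (nstates M1) 0, stay ss)"
  "q < nstates M1 \<Longrightarrow> trans (ifm P M1 M2) (Suc q) ss =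
     (branch_state (nstates M1) (Suc (nstates M1 + nstates M2)) 0 (fst (trans M1 q ss)), snd (trans M1 q ss))"
  "trans (ifm P M1 M2) (Suc (nstates M1 + q)) ss =
     (branch_state (nstates M2) (Suc (nstates M1 + nstates M2)) (nstates M1) (fst (trans M2 q ss)),
      snd (trans M2 q ss))"
  by (simp_all add: ifm_def Let_def)

lemma branch_state_le: "q \<le> n \<Longrightarrow> k + n < H \<Longrightarrow> branch_state n H k q \<le> H"
  by (simp add: branch_state_def)

lemma branch_state_simps [simp]:
  "branch_state n H k n = H" "q < n \<Longrightarrow> branch_state n H k q = Suc (k + q)"
  by (simp_all add: branch_state_def)

lemma wf_ifm [simp]:
  assumes "wf_prog r M1" "wf_prog r M2"
  shows "wf_prog r (ifm P M1 M2)"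
proof -
  have M1: "fst (trans M1 q ss) \<le> nstates M1" "length (snd (trans M1 q ss)) = r"
    if "q < nstates M1" "length ss = r" for q ss
    using that assms(1) by (auto simp: wf_prog_def wf_tm_def)
  have M2: "fst (trans M2 q ss) \<le> nstates M2" "length (snd (trans M2 q ss)) = r"
    if "q < nstates M2" "length ss = r" for q ss
    using that assms(2) by (auto simp: wf_prog_def wf_tm_def)
  let ?I = "ifm P M1 M2"
  have "fst (trans ?I q ss) \<le> nstates ?I \<and> length (snd (trans ?I q ss)) = r"
    if q: "q < nstates ?I" and ss: "length ss = r" for q ss
  proof (cases q)
    case 0
    then show ?thesis using ss by (simp add: stay_def branch_state_le)
  next
    case (Suc q')
    show ?thesis
    proof (cases "q' < nstates M1")
      case True
      then show ?thesis using M1[OF True ss] by (simp add: Suc branch_state_le)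
    next
      case False
      define p where "p = q' - nstates M1"
      have p: "q = Suc (nstates M1 + p)" "p < nstates M2"
        using False q Suc by (auto simp: p_def)
      then show ?thesis using M2[OF p(2) ss] by (simp add: branch_state_le)
    qed
  qed
  then show ?thesis using assms by (simp add: wf_prog_def wf_tm_def)
qed

lemma runs_if:
  assumes "if P (reads r \<sigma>) then runs r M1 t \<sigma> \<sigma>' else runs r M2 t \<sigma> \<sigma>'"
  shows "runs r (ifm P M1 M2) (1 + t) \<sigma> \<sigma>'"
proof -
  let ?n1 = "nstates M1" and ?n2 = "nstates M2" and ?I = "ifm P M1 M2"
  let ?H = "Suc (?n1 + ?n2)"
  let ?e1 = "branch_state ?n1 ?H 0" and ?e2 = "branch_state ?n2 ?H ?n1"
  let ?s = "if P (reads r \<sigma>) then ?e1 0 else ?e2 0"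
  have "step ?I (0, map \<sigma> [0..<r]) = (?s, map (\<lambda>i. act (rd (\<sigma> i), Stay) (\<sigma> i)) [0..<r])"
    by (rule step_tapes) (simp_all add: seen_reads stay_reads)
  then have first: "reach ?I (0, map \<sigma> [0..<r]) 1 (?s, map \<sigma> [0..<r])"
    by (intro reach_1) simp_all
  have "\<exists>s\<le>t. reach ?I (?s, map \<sigma> [0..<r]) s (?H, map \<sigma>' [0..<r])"
  proof (cases "P (reads r \<sigma>)")
    case True
    with assms obtain s where s: "s \<le> t" "reach M1 (0, map \<sigma> [0..<r]) s (?n1, map \<sigma>' [0..<r])"
      by (auto simp: runs_def)
    from reach_embed[OF s(2), of ?e1 ?I] True s(1) show ?thesis
      by (intro exI[of _ s]) simp
  next
    case False
    with assms obtain s where s: "s \<le> t" "reach M2 (0, map \<sigma> [0..<r]) s (?n2, map \<sigma>' [0..<r])"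
      by (auto simp: runs_def)
    from reach_embed[OF s(2), of ?e2 ?I] False s(1) show ?thesis
      by (intro exI[of _ s]) simp
  qed
  then obtain s where "s \<le> t" "reach ?I (?s, map \<sigma> [0..<r]) s (?H, map \<sigma>' [0..<r])" by blast
  with reach_trans[OF first this(2)] show ?thesis
    unfolding runs_def by (intro exI[of _ "1 + s"]) simp
qed

text \<open>\<open>polytime\<close> admits only bounds of the form N^a + a. For N \<ge> 2 the
  estimate N + 2 \<le> N^2 yields the exponent 2 e, and the summand 3^e takes care of N \<le>
  1.\<close>

lemma poly_bounded_imp_power:
  assumes "poly_bounded T"
  shows "\<exists>a. \<forall>N. T N \<le> N ^ a + a"
proof -
  obtain e where e: "\<And>N. T N \<le> (N + 2) ^ e" using assms by (auto simp: poly_bounded_def)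
  define a where "a = 2 * e + 3 ^ e"
  have "(N + 2) ^ e \<le> N ^ a + a" for N
  proof (cases "N \<le> 1")
    case True
    then have "(N + 2) ^ e \<le> 3 ^ e" by (intro power_mono) auto
    then show ?thesis by (simp add: a_def)
  next
    case False
    then have "N + 2 \<le> 2 * N" and "2 * N \<le> N * N" by simp_all
    then have "N + 2 \<le> N ^ 2" unfolding power2_eq_square by (rule order_trans)
    then have "(N + 2) ^ e \<le> (N ^ 2) ^ e" by (rule power_mono) simp
    also have "\<dots> \<le> N ^ a" unfolding power_mult[symmetric] a_def using False by (intro power_increasing) auto
    finally show ?thesis by simp
  qed
  with e show ?thesis by (meson order_trans)
qed

lemma polytime_if_runs:
  assumes wf: "wf_prog r M" and k: "k \<le> r" and T: "poly_bounded T"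
    and run: "\<And>xs w. (xs, w) \<in> G \<Longrightarrow> length xs = k \<and> (\<exists>\<sigma>'.
      runs r M (T (sum_list (map length xs))) (\<lambda>j. tape_of (if j < k then xs ! j else [])) \<sigma>' \<and>
      (\<forall>j<length w. snd (\<sigma>' 0) (int j) = Some (w ! j)) \<and> snd (\<sigma>' 0) (int (length w)) = None)"
  shows "polytime G"
proof -
  obtain a where a: "\<And>N. T N \<le> N ^ a + a" using poly_bounded_imp_power[OF T] by blast
  have M: "wf_tm M" "ntapes M = r" "0 < r" using wf by (auto simp: wf_prog_def wf_tm_def)
  have "length xs \<le> ntapes M \<and> outputs_within M xs w (sum_list (map length xs) ^ a + a)"
    if "(xs, w) \<in> G" for xs w
  proof -
    let ?N = "sum_list (map length xs)"
    from run[OF that] obtain \<sigma>' where len: "length xs = k"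
      and \<sigma>': "runs r M (T ?N) (\<lambda>j. tape_of (if j < k then xs ! j else [])) \<sigma>'"
      and out: "\<forall>j<length w. snd (\<sigma>' 0) (int j) = Some (w ! j)" "snd (\<sigma>' 0) (int (length w)) = None"
      by blast
    have init: "init M xs = (0, map (\<lambda>j. tape_of (if j < k then xs ! j else [])) [0..<r])"
      by (simp add: init_def M len)
    obtain t where t: "t \<le> T ?N" "reach M (init M xs) t (nstates M, map \<sigma>' [0..<r])"
      using \<sigma>' unfolding runs_def init by blast
    then have "t \<le> ?N ^ a + a" using a[of ?N] by linarith
    then have "(step M ^^ (?N ^ a + a)) (init M xs)
        = (step M ^^ (?N ^ a + a - t)) ((step M ^^ t) (init M xs))"
      by (simp flip: funpow_add[THEN fun_cong, simplified])
    also have "\<dots> = (nstates M, map \<sigma>' [0..<r])"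
      using reach_imp_steps[OF t(2)] by (simp add: steps_halted)
    finally show ?thesis
      using out k M len by (simp add: outputs_within_def hd_map)
  qed
  then show ?thesis unfolding polytime_def using M by blast
qed

subsection \<open>Copying\<close>

lemma snd_tape_of: "snd (tape_of w) p = (if 0 \<le> p \<and> p < int (length w) then Some (w ! nat p) else None)"
  by (simp add: tape_of_def)

lemma fst_tape_of [simp]: "fst (tape_of w) = 0"
  by (simp add: tape_of_def)

definition shift_heads :: "nat \<Rightarrow> nat set \<Rightarrow> dir \<Rightarrow> tm" where
  "shift_heads r I d = prim r (\<lambda>\<rho> l. (\<rho> l, if l \<in> I then d else Stay))"

lemma act_rd_move: "act (rd tp, d) tp = (move d (fst tp), snd tp)"
  by (cases tp) (simp add: rd_def)

lemma runs_shift_heads: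
  "runs r (shift_heads r I d) 1 \<sigma> (\<lambda>i. if i \<in> I then (move d (fst (\<sigma> i)), snd (\<sigma> i)) else \<sigma> i)"
  unfolding shift_heads_def by (rule runs_prim) (simp add: act_rd_move)

definition copy_tape :: "nat \<Rightarrow> nat \<Rightarrow> nat \<Rightarrow> tm" where
  "copy_tape r i j =
     seqm (whilem (\<lambda>\<rho>. \<rho> i \<noteq> None)
       (prim r (\<lambda>\<rho> l. if l \<in> {i, j} then (\<rho> i, MoveRight) else (\<rho> l, Stay))))
     (seqm (shift_heads r {i, j} MoveLeft)
     (seqm (whilem (\<lambda>\<rho>. \<rho> i \<noteq> None) (shift_heads r {i, j} MoveLeft))
       (shift_heads r {i, j} MoveRight)))"

lemma wf_copy_tape [simp]: "r \<ge> 1 \<Longrightarrow> wf_prog r (copy_tape r i j)"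
  by (simp add: copy_tape_def shift_heads_def)

lemma runs_copy_tape:
  assumes ij: "i < r" "j < r" "i \<noteq> j" and w: "\<sigma> i = tape_of w" "\<sigma> j = tape_of []"
  shows "runs r (copy_tape r i j) (4 * length w + 4) \<sigma> (\<sigma>(j := tape_of w))"
proof -
  let ?N = "length w"
  \<comment> \<open>\<alpha> follows the copying to the right and \<beta> the way back. The way back
    ends on the blank to the left of cell 0, hence the final move to the right.\<close>
  define \<alpha> where "\<alpha> p = \<sigma>(i := (int p, snd (tape_of w)), j := (int p, snd (tape_of (take p w))))" for p
  define \<beta> where "\<beta> q = \<sigma>(i := (int ?N - 1 - int q, snd (tape_of w)), j := (int ?N - 1 - int q, snd (tape_of w)))" for q
  let ?M = "prim r (\<lambda>\<rho> l. if l \<in> {i, j} then (\<rho> i, MoveRight) else (\<rho> l, Stay))"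
  have "runs r (whilem (\<lambda>\<rho>. \<rho> i \<noteq> None) ?M) (?N * (1 + 1) + 1) (\<alpha> 0) (\<alpha> ?N)"
  proof (rule runs_while)
    fix p assume p: "p < ?N"
    have rd: "rd (\<alpha> p i) = Some (w ! p)" using p ij by (simp add: \<alpha>_def rd_def snd_tape_of)
    have "runs r ?M 1 (\<alpha> p) (\<alpha> (Suc p))"
    proof (rule runs_prim)
      fix l assume l: "l < r"
      have "(snd (tape_of w))(int p := Some (w ! p)) = snd (tape_of w)"
        using p by (auto simp: snd_tape_of)
      moreover have "(snd (tape_of (take p w)))(int p := Some (w ! p)) = snd (tape_of (take (Suc p) w))"
        using p by (auto simp: snd_tape_of fun_eq_iff)
      ultimately show "\<alpha> (Suc p) l = act (if l \<in> {i, j} then (reads r (\<alpha> p) i, MoveRight)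
          else (reads r (\<alpha> p) l, Stay)) (\<alpha> p l)"
        using l ij rd by (auto simp: act_eq \<alpha>_def rd_def)
    qed
    then show "reads r (\<alpha> p) i \<noteq> None \<and> runs r ?M 1 (\<alpha> p) (\<alpha> (Suc p))"
      using rd ij by simp
  next
    show "\<not> reads r (\<alpha> ?N) i \<noteq> None" using ij by (simp add: \<alpha>_def rd_def snd_tape_of)
  qed
  moreover have "\<alpha> 0 = \<sigma>"
    using w ij by (auto simp: \<alpha>_def fun_eq_iff tape_of_def)
  ultimately have 1: "runs r (whilem (\<lambda>\<rho>. \<rho> i \<noteq> None) ?M) (?N * (1 + 1) + 1) \<sigma> (\<alpha> ?N)"
    by (simp only:)
  have 2: "runs r (shift_heads r {i, j} MoveLeft) 1 (\<alpha> ?N) (\<beta> 0)"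
    by (rule runs_cong[OF runs_shift_heads]) (use ij in \<open>auto simp: \<alpha>_def \<beta>_def\<close>)
  have 3: "runs r (whilem (\<lambda>\<rho>. \<rho> i \<noteq> None) (shift_heads r {i, j} MoveLeft)) (?N * (1 + 1) + 1) (\<beta> 0) (\<beta> ?N)"
  proof (rule runs_while)
    fix q assume q: "q < ?N"
    have "runs r (shift_heads r {i, j} MoveLeft) 1 (\<beta> q) (\<beta> (Suc q))"
      by (rule runs_cong[OF runs_shift_heads]) (use ij in \<open>auto simp: \<beta>_def\<close>)
    moreover have "reads r (\<beta> q) i \<noteq> None" using q ij by (simp add: \<beta>_def rd_def snd_tape_of)
    ultimately show "reads r (\<beta> q) i \<noteq> None \<and> runs r (shift_heads r {i, j} MoveLeft) 1 (\<beta> q) (\<beta> (Suc q))"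
      by blast
  next
    show "\<not> reads r (\<beta> ?N) i \<noteq> None" using ij by (simp add: \<beta>_def rd_def snd_tape_of)
  qed
  have 4: "runs r (shift_heads r {i, j} MoveRight) 1 (\<beta> ?N) (\<sigma>(j := tape_of w))"
    by (rule runs_cong[OF runs_shift_heads]) (use ij w in \<open>auto simp: \<beta>_def tape_of_def\<close>)
  show ?thesis
    unfolding copy_tape_def by (rule runs_mono[OF runs_seqm[OF 1 runs_seqm[OF 2 runs_seqm[OF 3 4]]]]) simp
qed

subsection \<open>Stacks\<close>

text \<open>A stack is a tape whose head is on the topmost symbol and whose contents end before cell
  \<open>E\<close>. In particular an input tape is a stack.\<close>

definition stk :: "int \<Rightarrow> bool list \<Rightarrow> tape" where
  "stk E xs = (E - int (length xs),
     \<lambda>p. if E - int (length xs) \<le> p \<and> p < E then Some (xs ! nat (p - (E - int (length xs)))) else None)"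

definition topsym :: "bool list \<Rightarrow> bool option" where
  "topsym xs = (case xs of [] \<Rightarrow> None | x # _ \<Rightarrow> Some x)"

lemma topsym_simps [simp]: "topsym [] = None" "topsym (x # xs) = Some x"
  by (simp_all add: topsym_def)

lemma topsym_eq_None [simp]: "topsym xs = None \<longleftrightarrow> xs = []"
  by (cases xs) auto

lemma tape_of_stk: "tape_of w = stk (int (length w)) w"
  by (auto simp: tape_of_def stk_def fun_eq_iff)

lemma rd_stk [simp]: "rd (stk E xs) = topsym xs"
  by (cases xs) (auto simp: stk_def rd_def)

lemma act_topsym_stk [simp]: "act (topsym xs, Stay) (stk E xs) = stk E xs"
  by (metis act_rd rd_stk)

lemma act_pop: "act (None, MoveRight) (stk E (x # xs)) = stk E xs"
  by (auto simp: act_eq stk_def fun_eq_iff nth_Cons split: nat.splits intro!: arg_cong[where f = "nth xs"])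

lemma act_push: "act (Some b, Stay) (fst (stk E xs) - 1, snd (stk E xs)) = stk E (b # xs)"
  by (auto simp: act_eq stk_def fun_eq_iff nth_Cons split: nat.splits intro!: arg_cong[where f = "nth xs"])

text \<open>Tape 0 is kept apart from the stacks, since the result has to be written there in the
  end. The ends \<open>E j\<close> never move.\<close>

definition conf :: "tape \<Rightarrow> (nat \<Rightarrow> int) \<Rightarrow> bool list list \<Rightarrow> nat \<Rightarrow> tape" where
  "conf \<tau> E S i = (case i of 0 \<Rightarrow> \<tau> | Suc j \<Rightarrow> stk (E j) (S ! j))"

lemma conf_simps [simp]: "conf \<tau> E S 0 = \<tau>" "conf \<tau> E S (Suc j) = stk (E j) (S ! j)"
  by (simp_all add: conf_def)

text \<open>Quantifying over the positions of the stacks and over tape 0 makes specifications speak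
  of the contents of stacks only.\<close>

definition srun :: "nat \<Rightarrow> tm \<Rightarrow> nat \<Rightarrow> bool list list \<Rightarrow> bool list list \<Rightarrow> bool" where
  "srun n M t S S' \<longleftrightarrow> length S = n \<and> length S' = n \<and> wf_prog (Suc n) M \<and>
     (\<forall>\<tau> E. runs (Suc n) M t (conf \<tau> E S) (conf \<tau> E S'))"

lemma srunI:
  "length S = n \<Longrightarrow> length S' = n \<Longrightarrow> wf_prog (Suc n) M \<Longrightarrow>
    (\<And>\<tau> E. runs (Suc n) M t (conf \<tau> E S) (conf \<tau> E S')) \<Longrightarrow> srun n M t S S'"
  by (simp add: srun_def)

lemma srunD:
  assumes "srun n M t S S'"
  shows "length S = n" "length S' = n" "wf_prog (Suc n) M" "runs (Suc n) M t (conf \<tau> E S) (conf \<tau> E S')"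
  using assms unfolding srun_def by blast+

lemma srun_mono: "srun n M t S S' \<Longrightarrow> t \<le> t' \<Longrightarrow> srun n M t' S S'"
  unfolding srun_def by (blast intro: runs_mono)

lemma srun_seqm: "srun n M1 t1 S S1 \<Longrightarrow> srun n M2 t2 S1 S2 \<Longrightarrow> srun n (seqm M1 M2) (t1 + t2) S S2"
  unfolding srun_def by (blast intro: runs_seqm wf_seqm)

definition tops :: "bool list list \<Rightarrow> bool option list" where
  "tops S = map topsym S"

definition stest :: "nat \<Rightarrow> (bool option list \<Rightarrow> bool) \<Rightarrow> (nat \<Rightarrow> bool option) \<Rightarrow> bool" where
  "stest n P \<rho> = P (map (\<lambda>j. \<rho> (Suc j)) [0..<n])"

lemma stest_conf: "length S = n \<Longrightarrow> stest n P (reads (Suc n) (conf \<tau> E S)) = P (tops S)"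
proof -
  assume "length S = n"
  then have "map (\<lambda>j. reads (Suc n) (conf \<tau> E S) (Suc j)) [0..<n] = tops S"
    unfolding tops_def by (intro nth_equalityI) auto
  then show ?thesis by (simp add: stest_def)
qed

definition swhile :: "nat \<Rightarrow> (bool option list \<Rightarrow> bool) \<Rightarrow> tm \<Rightarrow> tm" where
  "swhile n P M = whilem (stest n P) M"

lemma wf_swhile [simp]: "wf_prog (Suc n) M \<Longrightarrow> wf_prog (Suc n) (swhile n P M)"
  by (simp add: swhile_def)

lemma srun_while_false:
  "wf_prog (Suc n) M \<Longrightarrow> length S = n \<Longrightarrow> \<not> P (tops S) \<Longrightarrow> srun n (swhile n P M) 1 S S"
  unfolding swhile_def by (intro srunI runs_while_false) (simp_all add: stest_conf)

lemma srun_while_true: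
  assumes "P (tops S)" "srun n M t1 S S1" "srun n (swhile n P M) t2 S1 S2"
  shows "srun n (swhile n P M) (1 + t1 + t2) S S2"
proof (rule srunI)
  fix \<tau> E
  show "runs (Suc n) (swhile n P M) (1 + t1 + t2) (conf \<tau> E S) (conf \<tau> E S2)"
    using assms(1) srunD(4)[OF assms(2), of \<tau> E] srunD(4)[OF assms(3), of \<tau> E]
      stest_conf[OF srunD(1)[OF assms(2)], of P \<tau> E]
    unfolding swhile_def by (intro runs_while_true) auto
qed (use srunD(1-3)[OF assms(2)] srunD(1-3)[OF assms(3)] in auto)

definition sif :: "nat \<Rightarrow> (bool option list \<Rightarrow> bool) \<Rightarrow> tm \<Rightarrow> tm \<Rightarrow> tm" where
  "sif n P M1 M2 = ifm (stest n P) M1 M2"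

lemma wf_sif [simp]:
  "wf_prog (Suc n) M1 \<Longrightarrow> wf_prog (Suc n) M2 \<Longrightarrow> wf_prog (Suc n) (sif n P M1 M2)"
  by (simp add: sif_def)

lemma srun_sif:
  "wf_prog (Suc n) M1 \<Longrightarrow> wf_prog (Suc n) M2 \<Longrightarrow>
   if P (tops S) then srun n M1 t S S' else srun n M2 t S S' \<Longrightarrow> srun n (sif n P M1 M2) (1 + t) S S'"
  unfolding sif_def by (intro srunI runs_if) (auto simp: stest_conf srun_def split: if_splits)

definition skip :: "nat \<Rightarrow> tm" where
  "skip n = shift_heads (Suc n) {} Stay"

lemma srun_skip: "length S = n \<Longrightarrow> srun n (skip n) 1 S S"
  unfolding skip_def by (intro srunI runs_cong[OF runs_shift_heads]) (simp_all add: shift_heads_def)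

text \<open>Popping an empty stack does nothing, in accordance with \<open>tl\<close>.\<close>

definition pop :: "nat \<Rightarrow> nat \<Rightarrow> tm" where
  "pop n j = prim (Suc n) (\<lambda>\<rho> l. if l = Suc j \<and> \<rho> l \<noteq> None then (None, MoveRight) else (\<rho> l, Stay))"

lemma srun_pop:
  assumes "length S = n" "j < n"
  shows "srun n (pop n j) 1 S (S[j := tl (S ! j)])"
proof -
  have "runs (Suc n) (pop n j) 1 (conf \<tau> E S) (conf \<tau> E (S[j := tl (S ! j)]))" for \<tau> E
    unfolding pop_def
  proof (rule runs_prim)
    fix i assume i: "i < Suc n"
    show "conf \<tau> E (S[j := tl (S ! j)]) i = act (if i = Suc j \<and> reads (Suc n) (conf \<tau> E S) i \<noteq> None
        then (None, MoveRight) else (reads (Suc n) (conf \<tau> E S) i, Stay)) (conf \<tau> E S i)"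
    proof (cases "i = Suc j")
      case True
      then show ?thesis
        using assms by (cases "S ! j") (simp_all add: act_pop, metis act_topsym_stk topsym_simps(1))
    next
      case False
      then show ?thesis using i assms by (cases i) (auto simp del: act.simps)
    qed
  qed
  then show ?thesis using assms by (intro srunI) (simp_all add: pop_def)
qed

definition push :: "nat \<Rightarrow> nat \<Rightarrow> bool \<Rightarrow> tm" where
  "push n j b = seqm (shift_heads (Suc n) {Suc j} MoveLeft)
     (prim (Suc n) (\<lambda>\<rho> l. (if l = Suc j then Some b else \<rho> l, Stay)))"

lemma srun_push:
  assumes "length S = n" "j < n"
  shows "srun n (push n j b) 2 S (S[j := b # S ! j])"
proof -
  have "runs (Suc n) (push n j b) (1 + 1) (conf \<tau> E S) (conf \<tau> E (S[j := b # S ! j]))" for \<tau> E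
    unfolding push_def
  proof (rule runs_seqm[OF runs_shift_heads runs_prim])
    fix i assume i: "i < Suc n"
    let ?\<sigma> = "\<lambda>i. if i \<in> {Suc j} then (move MoveLeft (fst (conf \<tau> E S i)), snd (conf \<tau> E S i)) else conf \<tau> E S i"
    show "conf \<tau> E (S[j := b # S ! j]) i =
       act (if i = Suc j then Some b else reads (Suc n) ?\<sigma> i, Stay) (?\<sigma> i)"
    proof (cases "i = Suc j")
      case True
      then show ?thesis using assms by (simp add: act_push del: act.simps)
    next
      case False
      then show ?thesis using i assms by (cases i) (auto simp del: act.simps)
    qed
  qed
  then show ?thesis using assms by (intro srunI) (simp_all add: push_def shift_heads_def numeral_2_eq_2)
qed

fun pushes :: "nat \<Rightarrow> nat \<Rightarrow> bool list \<Rightarrow> tm" where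
  "pushes n j [] = skip n"
| "pushes n j (b # bs) = seqm (pushes n j bs) (push n j b)"

lemma srun_pushes:
  assumes "length S = n" "j < n"
  shows "srun n (pushes n j bs) (2 * length bs + 1) S (S[j := bs @ S ! j])"
proof (induction bs)
  case Nil
  then show ?case using srun_skip[OF assms(1)] by simp
next
  case (Cons b bs)
  from srun_seqm[OF Cons srun_push[of _ n j b]] assms show ?case by (auto elim: srun_mono)
qed

fun write_all :: "nat \<Rightarrow> bool list list \<Rightarrow> nat \<Rightarrow> tm" where
  "write_all n f 0 = skip n"
| "write_all n f (Suc k) = seqm (write_all n f k) (pushes n k (f ! k))"

lemma srun_write_all:
  assumes "length f = n"
  shows "k \<le> n \<Longrightarrow> \<exists>c. \<forall>S. length S = n \<longrightarrow>
    srun n (write_all n f k) c S (map2 (@) (take k f) (take k S) @ drop k S)"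
proof (induction k)
  case 0
  then show ?case by (auto intro: srun_skip)
next
  case (Suc k)
  then obtain c where c: "\<And>S. length S = n \<Longrightarrow>
      srun n (write_all n f k) c S (map2 (@) (take k f) (take k S) @ drop k S)" by auto
  have "srun n (write_all n f (Suc k)) (c + (2 * length (f ! k) + 1)) S
      (map2 (@) (take (Suc k) f) (take (Suc k) S) @ drop (Suc k) S)" if S: "length S = n" for S
  proof -
    let ?S = "map2 (@) (take k f) (take k S) @ drop k S"
    have "srun n (write_all n f (Suc k)) (c + (2 * length (f ! k) + 1)) S (?S[k := f ! k @ ?S ! k])"
      unfolding write_all.simps by (rule srun_seqm[OF c[OF S] srun_pushes]) (use Suc.prems S assms in auto)
    moreover have "?S[k := f ! k @ ?S ! k] = map2 (@) (take (Suc k) f) (take (Suc k) S) @ drop (Suc k) S"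
      using Suc.prems S assms by (intro nth_equalityI) (auto simp: nth_append nth_list_update less_Suc_eq min_def)
    ultimately show ?thesis by simp
  qed
  then show ?case by blast
qed

text \<open>Specifies the reading phase of a program block; \<open>acc\<close> models what the
  finite control has to remember.\<close>

fun take_tops :: "nat list \<Rightarrow> bool list list \<Rightarrow> bool list list \<Rightarrow> bool list list \<times> bool list list" where
  "take_tops [] acc S = (acc, S)"
| "take_tops (j # js) acc S = (case S ! j of [] \<Rightarrow> take_tops js acc S
     | b # xs \<Rightarrow> take_tops js (acc[j := acc ! j @ [b]]) (S[j := xs]))"

lemma take_tops_replicate:
  "j < length acc \<Longrightarrow> j < length S \<Longrightarrow> take_tops (replicate d j @ js) acc S =
     take_tops js (acc[j := acc ! j @ take d (S ! j)]) (S[j := drop d (S ! j)])"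
proof (induction d arbitrary: acc S)
  case (Suc d)
  show ?case
  proof (cases "S ! j")
    case Nil
    then show ?thesis using Suc by simp
  next
    case (Cons b xs)
    then show ?thesis using Suc.IH[of "acc[j := acc ! j @ [b]]" "S[j := xs]"] Suc.prems by simp
  qed
qed simp

lemma take_tops_all:
  assumes "length S = n"
  shows "take_tops (concat (map (replicate d) [0..<n])) (replicate n []) S = (map (take d) S, map (drop d) S)"
proof -
  have "k \<le> n \<Longrightarrow> take_tops (concat (map (replicate d) [n - k..<n]))
      (map (take d) (take (n - k) S) @ replicate k []) (map (drop d) (take (n - k) S) @ drop (n - k) S)
      = (map (take d) S, map (drop d) S)" for k
  proof (induction k)
    case (Suc k)
    let ?i = "n - Suc k"
    have i: "[?i..<n] = ?i # [n - k..<n]" "n - k = Suc ?i" "?i < n"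
      using Suc.prems by (simp_all add: upt_conv_Cons Suc_diff_Suc)
    have S: "drop ?i S = S ! ?i # drop (Suc ?i) S" "take (Suc ?i) S = take ?i S @ [S ! ?i]"
      using i assms by (simp_all add: Cons_nth_drop_Suc take_Suc_conv_app_nth)
    have len: "length (take ?i S) = ?i" using assms i by simp
    show ?case
      using Suc i(3) assms unfolding i(1)
      by (subst list.map, subst concat.simps, subst take_tops_replicate)
        (simp_all add: nth_append list_update_append S i(2) len)
  qed (use assms in simp)
  from this[of n] show ?thesis by simp
qed

text \<open>The symbols read are remembered by the position in a decision tree: the machine branches
  on the next symbol and continues with the machine for the extended \<open>acc\<close>. The
  induction is therefore for all \<open>acc\<close> at once. At a leaf the output
  \<open>g acc\<close> is a constant, and the fixed number of pops makes the time constant.\<close>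

lemma ex_block_aux:
  assumes g: "\<And>ts. length (g ts) = n"
  shows "set js \<subseteq> {..<n} \<Longrightarrow> \<exists>M c. \<forall>S. length S = n \<longrightarrow>
    srun n M c S (map2 (@) (g (fst (take_tops js acc S))) (snd (take_tops js acc S)))"
proof (induction js arbitrary: acc)
  case Nil
  obtain c where "\<And>S. length S = n \<Longrightarrow> srun n (write_all n (g acc) n) c S
      (map2 (@) (take n (g acc)) (take n S) @ drop n S)"
    using srun_write_all[OF g order_refl] by blast
  then have "\<forall>S. length S = n \<longrightarrow> srun n (write_all n (g acc) n) c S (map2 (@) (g acc) S)"
    by (simp add: g)
  then show ?case by auto
next
  case (Cons j js)
  then have j: "j < n" and js: "set js \<subseteq> {..<n}" by auto
  let ?R = "\<lambda>acc S. map2 (@) (g (fst (take_tops js acc S))) (snd (take_tops js acc S))"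
  from Cons.IH[OF js] obtain M c where
    M: "\<And>acc S. length S = n \<Longrightarrow> srun n (M acc) (c acc) S (?R acc S)" by metis
  let ?acc = "\<lambda>b. acc[j := acc ! j @ [b]]"
  let ?c = "c acc + c (?acc True) + c (?acc False) + 1"
  let ?N = "sif n (\<lambda>ts. ts ! j = None) (M acc) (sif n (\<lambda>ts. ts ! j = Some True)
     (seqm (pop n j) (M (?acc True))) (seqm (pop n j) (M (?acc False))))"
  have wf: "wf_prog (Suc n) (M acc)" for acc
    using M[of "replicate n []" acc] by (simp add: srun_def)
  have wfp: "wf_prog (Suc n) (pop n j)" by (simp add: pop_def)
  have "srun n ?N (1 + (1 + ?c)) S (map2 (@) (g (fst (take_tops (j # js) acc S))) (snd (take_tops (j # js) acc S)))"
    if S: "length S = n" for S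
  proof (cases "S ! j")
    case Nil
    then show ?thesis
      using M[OF S, of acc] S j by (intro srun_sif wf wfp wf_sif wf_seqm) (auto simp: tops_def elim: srun_mono)
  next
    case (Cons b xs)
    have "srun n (seqm (pop n j) (M (?acc b))) (1 + c (?acc b)) S (?R (?acc b) (S[j := xs]))"
      using srun_seqm[OF srun_pop[OF S j] M] S Cons by simp
    then have run: "srun n (seqm (pop n j) (M (?acc b))) ?c S (?R (?acc b) (S[j := xs]))"
      by (rule srun_mono) (cases b; simp)
    have "srun n (sif n (\<lambda>ts. ts ! j = Some True) (seqm (pop n j) (M (?acc True)))
        (seqm (pop n j) (M (?acc False)))) (1 + ?c) S (?R (?acc b) (S[j := xs]))"
      using run S j Cons by (intro srun_sif wf wfp wf_seqm) (cases b; simp add: tops_def)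
    then show ?thesis
      using S j Cons by (intro srun_sif wf wfp wf_sif wf_seqm) (simp add: tops_def)
  qed
  then show ?case by blast
qed

text \<open>Any function of the topmost d symbols of all stacks is a finite table and hence a single
  instruction of constant time. The later programs are built from such instructions.\<close>

lemma ex_block:
  assumes "\<And>ts. length (g ts) = n"
  shows "\<exists>M c. \<forall>S. length S = n \<longrightarrow> srun n M c S (map2 (@) (g (map (take d) S)) (map (drop d) S))"
proof -
  let ?js = "concat (map (replicate d) [0..<n])"
  have "set ?js \<subseteq> {..<n}" by auto
  from ex_block_aux[where g = g and js = ?js and acc = "replicate n []", OF assms this]
  show ?thesis by (auto simp: take_tops_all)
qed

section \<open>Checking a preimage under the permutation\<close>

text \<open>Runs \<open>M\<close> on the tapes from \<open>7\<close> on. Tape \<open>3\<close> moves along with the output tape of \<open>M\<close> and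
  has a mark in cell \<open>0\<close>; tape \<open>4\<close> records on which side of the mark the head is, so that the head
  can be brought back to the beginning of the output.\<close>

definition tracked :: "tm \<Rightarrow> tm" where
  "tracked M = TM (7 + ntapes M) (nstates M) (\<lambda>q ss. let as = snd (trans M q (drop 7 ss)) in
     (fst (trans M q (drop 7 ss)),
      [(ss ! 0, Stay), (ss ! 1, Stay), (ss ! 2, Stay), (ss ! 3, snd (as ! 0)),
       (if ss ! 3 = Some True then Some (snd (as ! 0) = MoveLeft) else ss ! 4, Stay),
       (ss ! 5, Stay), (ss ! 6, Stay)] @ as))"

lemma wf_tracked: "wf_tm M \<Longrightarrow> wf_prog (7 + ntapes M) (tracked M)"
  by (simp add: wf_prog_def wf_tm_def tracked_def Let_def)

definition mark :: "int \<Rightarrow> bool option" where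
  "mark p = (if p = 0 then Some True else None)"

text \<open>The side is recorded anew in every step that starts on the mark, and the head cannot
  change sides without passing the mark. Hence the record is right whenever the head is off the
  mark.\<close>

lemma reach_tracked:
  assumes wf: "wf_tm M"
  shows "reach M c t c' \<Longrightarrow> length (snd c) = ntapes M \<Longrightarrow>
    fst (snd c ! 0) \<noteq> 0 \<longrightarrow> rd sd = Some (fst (snd c ! 0) < 0) \<Longrightarrow>
    length (snd c') = ntapes M \<and> (\<exists>sd'. reach (tracked M)
      (fst c, [t0, t1, t2, (fst (snd c ! 0), mark), sd, t5, t6] @ snd c) t
      (fst c', [t0, t1, t2, (fst (snd c' ! 0), mark), sd', t5, t6] @ snd c') \<and>
      (fst (snd c' ! 0) \<noteq> 0 \<longrightarrow> rd sd' = Some (fst (snd c' ! 0) < 0)))"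
proof (induction arbitrary: sd rule: reach.induct)
  case (reach_refl c)
  then show ?case using reach.reach_refl by blast
next
  case (reach_step c t c')
  let ?as = "snd (trans M (fst c) (map rd (snd c)))"
  let ?p = "fst (snd c ! 0)"
  let ?c1 = "step M c"
  have M: "0 < ntapes M" "length ?as = ntapes M"
    using wf reach_step.hyps(1) reach_step.prems(1) by (simp_all add: wf_tm_def)
  have c1: "?c1 = (fst (trans M (fst c) (map rd (snd c))), map2 act ?as (snd c))"
    using reach_step.hyps(1) by (simp add: step_next_move next_move_def)
  have p1: "fst (snd ?c1 ! 0) = move (snd (?as ! 0)) ?p"
    using M reach_step.prems(1) by (simp add: c1 act_eq)
  define sd1 where "sd1 = act (if ?p = 0 then Some (snd (?as ! 0) = MoveLeft) else rd sd, Stay) sd"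
  have rd_sd1: "rd sd1 = (if ?p = 0 then Some (snd (?as ! 0) = MoveLeft) else rd sd)"
    by (simp add: sd1_def rd_def act_eq)
  have rd3: "rd (?p, mark) = (if ?p = 0 then Some True else None)"
    by (simp add: rd_def mark_def)
  have act3: "act (rd (?p, mark), d) (?p, mark) = (move d ?p, mark)" for d
    by (simp add: act_rd_move del: act.simps)
  have step: "step (tracked M) (fst c, [t0, t1, t2, (?p, mark), sd, t5, t6] @ snd c)
      = (fst ?c1, [t0, t1, t2, (fst (snd ?c1 ! 0), mark), sd1, t5, t6] @ snd ?c1)"
    using reach_step.hyps(1) unfolding p1
    by (simp add: step_next_move next_move_def tracked_def Let_def c1 act3 sd1_def del: act.simps)
      (auto simp: rd_def mark_def)
  have "move d ?p \<noteq> 0 \<longrightarrow> rd sd1 = Some (move d ?p < 0)" if "d = snd (?as ! 0)" for d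
    using reach_step.prems(2) that unfolding rd_sd1 by (cases d) auto
  then have inv: "fst (snd ?c1 ! 0) \<noteq> 0 \<longrightarrow> rd sd1 = Some (fst (snd ?c1 ! 0) < 0)"
    unfolding p1 by blast
  have len: "length (snd ?c1) = ntapes M" using M reach_step.prems(1) by (simp add: c1)
  from reach_step.IH[OF len inv] obtain sd' where *: "length (snd c') = ntapes M"
    "reach (tracked M) (fst ?c1, [t0, t1, t2, (fst (snd ?c1 ! 0), mark), sd1, t5, t6] @ snd ?c1) t
      (fst c', [t0, t1, t2, (fst (snd c' ! 0), mark), sd', t5, t6] @ snd c')"
    "fst (snd c' ! 0) \<noteq> 0 \<longrightarrow> rd sd' = Some (fst (snd c' ! 0) < 0)" by blast
  have "reach (tracked M) (fst c, [t0, t1, t2, (?p, mark), sd, t5, t6] @ snd c) (Suc t)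
      (fst c', [t0, t1, t2, (fst (snd c' ! 0), mark), sd', t5, t6] @ snd c')"
    using *(2) reach_step.hyps(1) by (intro reach.reach_step) (simp_all only: step, simp add: tracked_def)
  with * show ?case by blast
qed

lemma nth_evens_odds:
  "j < length u div 2 \<Longrightarrow> evens u ! j = u ! (2 * j)"
  "j < length u div 2 \<Longrightarrow> odds u ! j = u ! (2 * j + 1)"
proof (induction u arbitrary: j rule: evens.induct)
  case (1 a b u)
  { case 1 then show ?case using "1.IH"(1) by (cases j) auto }
  { case 2 then show ?case using "1.IH"(2) by (cases j) auto }
qed auto

lemma ip_snoc: "length v = length r \<Longrightarrow> ip (v @ [a]) (r @ [b]) = (ip v r \<noteq> (a \<and> b))"
  by (induction v r rule: list_induct2) auto

lemma ip_append1: "length v = length r \<Longrightarrow> ip (v @ w) r = ip v r"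
  by (induction v r rule: list_induct2) auto

definition preimage_check :: "(bool list \<Rightarrow> bool list) \<Rightarrow> bool \<Rightarrow> bool list \<Rightarrow> bool list \<Rightarrow> bool" where
  "preimage_check h a u y \<longleftrightarrow> length y = length u div 2 \<and> h y = evens u \<and> ip y (odds u) = a"

text \<open>Tapes: \<open>0\<close> input \<open>u\<close> and output, \<open>1\<close> input \<open>y\<close>, \<open>2\<close> copy of \<open>u\<close>, \<open>5\<close> whether all tests
  succeeded so far, \<open>6\<close> partial inner product.\<close>

definition check_tm :: "tm \<Rightarrow> bool \<Rightarrow> tm" where
  "check_tm M a = (let r = 7 + ntapes M in
     seqm (copy_tape r 0 2)
     (seqm (copy_tape r 1 7)
     (seqm (prim r (\<lambda>\<rho> l. (if l \<in> {3, 5} then Some True else if l = 6 then Some False else \<rho> l, Stay)))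
     (seqm (tracked M)
     (seqm (whilem (\<lambda>\<rho>. \<rho> 3 \<noteq> Some True)
        (prim r (\<lambda>\<rho> l. (\<rho> l, if l \<in> {3, 7} then (if \<rho> 4 = Some True then MoveRight else MoveLeft) else Stay))))
     (seqm (whilem (\<lambda>\<rho>. \<rho> 7 \<noteq> None)
        (seqm (prim r (\<lambda>\<rho> l. (if l = 5 then (if \<rho> 2 = \<rho> 7 then \<rho> 5 else Some False) else \<rho> l,
            if l \<in> {2, 7} then MoveRight else Stay)))
          (prim r (\<lambda>\<rho> l. (if l = 5 then (if \<rho> 2 = None then Some False else \<rho> 5)
            else if l = 6 then (if \<rho> 2 = Some True \<and> \<rho> 1 = Some True then map_option Not (\<rho> 6) else \<rho> 6)
            else \<rho> l, if l \<in> {1, 2} then MoveRight else Stay)))))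
     (seqm (prim r (\<lambda>\<rho> l. (\<rho> l, if l = 2 \<and> \<rho> 2 \<noteq> None then MoveRight else Stay)))
     (seqm (prim r (\<lambda>\<rho> l. if l = 0 then (Some (\<rho> 5 = Some True \<and> \<rho> 2 = None \<and> \<rho> 6 = Some a), MoveRight)
          else (\<rho> l, Stay)))
       (prim r (\<lambda>\<rho> l. (if l = 0 then None else \<rho> l, Stay)))))))))))"

lemma runs_tracked:
  assumes wf: "wf_tm M" and out: "outputs_within M [y] z T"
    and \<sigma>: "\<And>j. j < ntapes M \<Longrightarrow> \<sigma> (7 + j) = tape_of (if j = 0 then y else [])" "\<sigma> 3 = (0, mark)"
  shows "\<exists>\<sigma>' p. runs (7 + ntapes M) (tracked M) T \<sigma> \<sigma>' \<and> (\<forall>j\<in>{0, 1, 2, 5, 6}. \<sigma>' j = \<sigma> j) \<and>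
    \<sigma>' 3 = (p, mark) \<and> \<bar>p\<bar> \<le> int T \<and> fst (\<sigma>' 7) = p \<and> (p \<noteq> 0 \<longrightarrow> rd (\<sigma>' 4) = Some (p < 0)) \<and>
    (\<forall>j<length z. snd (\<sigma>' 7) (int j) = Some (z ! j)) \<and> snd (\<sigma>' 7) (int (length z)) = None"
proof -
  let ?k = "ntapes M"
  have k: "0 < ?k" using wf by (simp add: wf_tm_def)
  obtain q ts where cfg: "cfg M [y] T = (q, ts)" by (cases "cfg M [y] T")
  with cfg_wf[OF wf, of "[y]" T] have len: "length ts = ?k" by simp
  have q: "q = nstates M" and z: "\<forall>j<length z. snd (ts ! 0) (int j) = Some (z ! j)"
    "snd (ts ! 0) (int (length z)) = None"
  proof -
    have "hd ts = ts ! 0" using len k by (intro hd_conv_nth) auto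
    then show "q = nstates M" "\<forall>j<length z. snd (ts ! 0) (int j) = Some (z ! j)"
      "snd (ts ! 0) (int (length z)) = None"
      using out cfg by (auto simp: outputs_within_def cfg_def Let_def)
  qed
  have head: "\<bar>fst (ts ! 0)\<bar> \<le> int T" using head_bound[OF wf k, of "[y]" T] cfg by simp
  have init: "init M [y] = (0, map (\<lambda>j. \<sigma> (7 + j)) [0..<?k])"
    using \<sigma>(1) by (auto simp: init_def)
  from steps_imp_reach[of T M "init M [y]" "(q, ts)"] cfg q obtain t where
    t: "t \<le> T" "reach M (init M [y]) t (q, ts)" by (auto simp: cfg_def)
  have "fst (snd (init M [y]) ! 0) = 0" using k by (simp add: init_def)
  with reach_tracked[OF wf t(2), of "\<sigma> 4" "\<sigma> 0" "\<sigma> 1" "\<sigma> 2" "\<sigma> 5" "\<sigma> 6"] obtain sd where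
    sd: "reach (tracked M) (0, [\<sigma> 0, \<sigma> 1, \<sigma> 2, (0, mark), \<sigma> 4, \<sigma> 5, \<sigma> 6] @ snd (init M [y])) t
      (q, [\<sigma> 0, \<sigma> 1, \<sigma> 2, (fst (ts ! 0), mark), sd, \<sigma> 5, \<sigma> 6] @ ts)"
    "fst (ts ! 0) \<noteq> 0 \<longrightarrow> rd sd = Some (fst (ts ! 0) < 0)"
    by (auto simp: init_def)
  define \<sigma>' where "\<sigma>' i = (if i < 7 then [\<sigma> 0, \<sigma> 1, \<sigma> 2, (fst (ts ! 0), mark), sd, \<sigma> 5, \<sigma> 6] ! i
    else ts ! (i - 7))" for i
  have split: "[0..<7 + ?k] = [0, 1, 2, 3, 4, 5, 6] @ map (\<lambda>j. 7 + j) [0..<?k]"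
    by (intro nth_equalityI) (auto simp: nth_append nth_Cons split: nat.splits)
  have "map \<sigma> [0..<7 + ?k] = [\<sigma> 0, \<sigma> 1, \<sigma> 2, (0, mark), \<sigma> 4, \<sigma> 5, \<sigma> 6] @ snd (init M [y])"
    unfolding split init by (simp add: \<sigma>(2))
  moreover have "map \<sigma>' [0..<7 + ?k] = [\<sigma> 0, \<sigma> 1, \<sigma> 2, (fst (ts ! 0), mark), sd, \<sigma> 5, \<sigma> 6] @ ts"
    unfolding split by (simp add: \<sigma>'_def o_def) (intro nth_equalityI; simp add: len)
  moreover have "nstates (tracked M) = q" by (simp add: tracked_def q)
  ultimately have "runs (7 + ?k) (tracked M) T \<sigma> \<sigma>'"
    using sd(1) t(1) unfolding runs_def by (intro exI[of _ t]) simp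
  then show ?thesis
    using sd(2) head z by (intro exI[of _ \<sigma>'] exI[of _ "fst (ts ! 0)"]) (auto simp: \<sigma>'_def)
qed

definition flag :: "bool \<Rightarrow> tape" where
  "flag b = (0, (\<lambda>_. None)(0 := Some b))"

lemma flag_simps [simp]:
  "rd (flag b) = Some b" "act (Some c, Stay) (flag b) = flag c" "act (Some b, Stay) (0, \<lambda>_. None) = flag b"
  by (simp_all add: flag_def rd_def act_eq)

lemma fst_snd_act [simp]: "act (rd tp, d) tp = (move d (fst tp), snd tp)"
  by (rule act_rd_move)

text \<open>\<open>y\<close> may be longer than \<open>r\<close>. The excess bits contribute
  nothing, just as blanks behind the end of u leave the parity of the machine unchanged.\<close>

lemma ip_take_Suc:
  "i < length y \<Longrightarrow> ip (take (Suc i) y) (take (Suc i) r)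
     = (ip (take i y) (take i r) \<noteq> (i < length r \<and> r ! i \<and> y ! i))"
proof (cases "i < length r")
  case True
  then show "i < length y \<Longrightarrow> ?thesis" by (auto simp: take_Suc_conv_app_nth ip_snoc)
next
  case False
  define w where "w = drop (length r) (take (Suc i) y)"
  assume i: "i < length y"
  have "take (Suc i) y = take (length r) y @ drop (length r) (take (Suc i) y)"
    using False by (metis append_take_drop_id min.absorb1 not_less take_take le_SucI)
  moreover have "take i y = take (length r) y @ drop (length r) (take i y)"
    using False by (metis append_take_drop_id min.absorb1 not_less take_take)
  moreover have "ip (take (length r) y @ w) r = ip (take (length r) y) r" for w
    using False i by (intro ip_append1) auto
  ultimately show ?thesis using False by (metis le_SucI not_less take_all)
qed

lemma runs_check_tm:
  assumes wf: "wf_tm M" and out: "outputs_within M [y] (h y) T" and len: "length (h y) = length y"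
  shows "\<exists>\<sigma>'. runs (7 + ntapes M) (check_tm M a) (4 * length u + 8 * length y + 3 * T + 20)
      (\<lambda>j. tape_of (if j < 2 then [u, y] ! j else [])) \<sigma>' \<and>
    snd (\<sigma>' 0) 0 = Some (preimage_check h a u y) \<and> snd (\<sigma>' 0) 1 = None"
proof -
  let ?r = "7 + ntapes M" and ?z = "h y" and ?N = "length y"
  let ?U = "snd (tape_of u)" and ?Y = "snd (tape_of y)"
  have r: "7 < ?r" using wf by (simp add: wf_tm_def)
  define \<sigma>0 where "\<sigma>0 = (\<lambda>j. tape_of (if j < 2 then [u, y] ! j else []))"
  define \<sigma>1 where "\<sigma>1 = \<sigma>0(2 := tape_of u)"
  define \<sigma>2 where "\<sigma>2 = \<sigma>1(7 := tape_of y)"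
  define \<sigma>3 where "\<sigma>3 = \<sigma>2(3 := (0, mark), 5 := flag True, 6 := flag False)"
  have nil: "tape_of [] = (0, \<lambda>_. None)" by (auto simp: tape_of_def fun_eq_iff)
  have r1: "runs ?r (copy_tape ?r 0 2) (4 * length u + 4) \<sigma>0 \<sigma>1"
    unfolding \<sigma>1_def using r by (intro runs_copy_tape) (auto simp: \<sigma>0_def)
  have r2: "runs ?r (copy_tape ?r 1 7) (4 * ?N + 4) \<sigma>1 \<sigma>2"
    unfolding \<sigma>2_def using r by (intro runs_copy_tape) (auto simp: \<sigma>1_def \<sigma>0_def)
  have r3: "runs ?r (prim ?r (\<lambda>\<rho> l. (if l \<in> {3, 5} then Some True else if l = 6 then Some False else \<rho> l, Stay)))
      1 \<sigma>2 \<sigma>3"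
  proof (rule runs_prim)
    fix i assume i: "i < ?r"
    have "\<sigma>2 3 = (0, \<lambda>_. None)" "\<sigma>2 5 = (0, \<lambda>_. None)" "\<sigma>2 6 = (0, \<lambda>_. None)"
      by (simp_all add: \<sigma>2_def \<sigma>1_def \<sigma>0_def nil)
    moreover have "act (Some True, Stay) (0, \<lambda>_. None) = (0, mark)"
      by (auto simp: act_eq mark_def fun_eq_iff)
    ultimately show "\<sigma>3 i = act (if i \<in> {3, 5} then Some True else if i = 6 then Some False
        else reads ?r \<sigma>2 i, Stay) (\<sigma>2 i)"
      using i by (auto simp: \<sigma>3_def simp del: act.simps)
  qed
  have "\<sigma>3 (7 + j) = tape_of (if j = 0 then y else [])" for j
    by (cases j) (simp_all add: \<sigma>3_def \<sigma>2_def \<sigma>1_def \<sigma>0_def)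
  moreover have "\<sigma>3 3 = (0, mark)" by (simp add: \<sigma>3_def)
  ultimately obtain \<sigma>4 p where
    r4: "runs ?r (tracked M) T \<sigma>3 \<sigma>4" and keep: "\<forall>j\<in>{0, 1, 2, 5, 6}. \<sigma>4 j = \<sigma>3 j"
    and p: "\<sigma>4 3 = (p, mark)" "\<bar>p\<bar> \<le> int T" "fst (\<sigma>4 7) = p" "p \<noteq> 0 \<longrightarrow> rd (\<sigma>4 4) = Some (p < 0)"
    and z: "\<forall>j<length ?z. snd (\<sigma>4 7) (int j) = Some (?z ! j)" "snd (\<sigma>4 7) (int (length ?z)) = None"
    using runs_tracked[OF wf out, of \<sigma>3] by blast
  define Z where "Z = snd (\<sigma>4 7)"
  have Z: "j < ?N \<Longrightarrow> Z (int j) = Some (?z ! j)" "Z (int ?N) = None" for j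
    using z by (simp_all add: Z_def len)
  \<comment> \<open>From either side the head is back on cell 0 after \<bar>p\<bar> steps.\<close>
  define pos where "pos i = (if p < 0 then p + int i else p - int i)" for i
  define \<tau> where "\<tau> i = \<sigma>4(3 := (pos i, mark), 7 := (pos i, Z))" for i
  define \<sigma>5 where "\<sigma>5 = \<tau> (nat \<bar>p\<bar>)"
  have \<sigma>5: "\<sigma>5 0 = tape_of u" "\<sigma>5 1 = tape_of y" "\<sigma>5 2 = tape_of u" "\<sigma>5 5 = flag True" "\<sigma>5 6 = flag False"
    "\<sigma>5 7 = (0, Z)"
    using keep by (simp_all add: \<sigma>5_def \<tau>_def \<sigma>3_def \<sigma>2_def \<sigma>1_def \<sigma>0_def pos_def)
  let ?W5 = "whilem (\<lambda>\<rho>. \<rho> 3 \<noteq> Some True)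
      (prim ?r (\<lambda>\<rho> l. (\<rho> l, if l \<in> {3, 7} then (if \<rho> 4 = Some True then MoveRight else MoveLeft) else Stay)))"
  have r5: "runs ?r ?W5 (nat \<bar>p\<bar> * (1 + 1) + 1) (\<tau> 0) \<sigma>5"
    unfolding \<sigma>5_def
  proof (rule runs_while)
    fix i assume i: "i < nat \<bar>p\<bar>"
    have rd4: "reads ?r (\<tau> i) 4 = Some (p < 0)" using i p(4) r by (auto simp: \<tau>_def)
    have "runs ?r (prim ?r (\<lambda>\<rho> l. (\<rho> l, if l \<in> {3, 7} then (if \<rho> 4 = Some True then MoveRight else MoveLeft) else Stay)))
        1 (\<tau> i) (\<tau> (Suc i))"
    proof (rule runs_prim, unfold rd4)
      fix l assume "l < ?r"
      then show "\<tau> (Suc i) l = act (reads ?r (\<tau> i) l, if l \<in> {3, 7}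
          then (if Some (p < 0) = Some True then MoveRight else MoveLeft) else Stay) (\<tau> i l)"
        by (auto simp: \<tau>_def pos_def)
    qed
    moreover have "pos i \<noteq> 0" using i by (auto simp: pos_def)
    ultimately show "reads ?r (\<tau> i) 3 \<noteq> Some True \<and> runs ?r (prim ?r (\<lambda>\<rho> l. (\<rho> l, if l \<in> {3, 7} then
        (if \<rho> 4 = Some True then MoveRight else MoveLeft) else Stay))) 1 (\<tau> i) (\<tau> (Suc i))"
      by (simp add: \<tau>_def rd_def mark_def)
  next
    show "\<not> reads ?r (\<tau> (nat \<bar>p\<bar>)) 3 \<noteq> Some True"
      by (simp add: \<tau>_def rd_def mark_def pos_def)
  qed
  have \<tau>0: "\<tau> 0 = \<sigma>4" using p by (auto simp: \<tau>_def pos_def Z_def fun_eq_iff prod_eq_iff)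
  \<comment> \<open>The length condition is part of the test: a pair of symbols that runs over the
    end of u counts as a failure.\<close>
  define ok where "ok i \<longleftrightarrow> (\<forall>j<i. 2 * j + 1 < length u \<and> u ! (2 * j) = ?z ! j)" for i
  define par where "par i = ip (take i y) (take i (odds u))" for i
  define \<kappa> where "\<kappa> i = \<sigma>5(1 := (int i, ?Y), 2 := (int (2 * i), ?U), 7 := (int i, Z),
      5 := flag (ok i), 6 := flag (par i))" for i
  let ?A = "prim ?r (\<lambda>\<rho> l. (if l = 5 then (if \<rho> 2 = \<rho> 7 then \<rho> 5 else Some False) else \<rho> l,
            if l \<in> {2, 7} then MoveRight else Stay))"
  let ?B = "prim ?r (\<lambda>\<rho> l. (if l = 5 then (if \<rho> 2 = None then Some False else \<rho> 5)
            else if l = 6 then (if \<rho> 2 = Some True \<and> \<rho> 1 = Some True then map_option Not (\<rho> 6) else \<rho> 6)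
            else \<rho> l, if l \<in> {1, 2} then MoveRight else Stay))"
  have r6: "runs ?r (whilem (\<lambda>\<rho>. \<rho> 7 \<noteq> None) (seqm ?A ?B)) (?N * (2 + 1) + 1) (\<kappa> 0) (\<kappa> ?N)"
  proof (rule runs_while)
    fix i assume i: "i < ?N"
    define okm where "okm \<longleftrightarrow> ok i \<and> ?U (int (2 * i)) = Some (?z ! i)"
    define \<mu> where "\<mu> = (\<kappa> i)(2 := (int (2 * i) + 1, ?U), 7 := (int (Suc i), Z), 5 := flag okm)"
    have rA: "reads ?r (\<kappa> i) 2 = ?U (int (2 * i))" "reads ?r (\<kappa> i) 7 = Some (?z ! i)"
      "reads ?r (\<kappa> i) 5 = Some (ok i)"
      using r i by (simp_all add: \<kappa>_def rd_def Z) (simp_all add: flag_def)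
    have A: "runs ?r ?A 1 (\<kappa> i) \<mu>"
    proof (rule runs_prim, unfold rA)
      fix l assume "l < ?r"
      then show "\<mu> l = act (if l = 5 then (if ?U (int (2 * i)) = Some (?z ! i) then Some (ok i) else Some False)
          else reads ?r (\<kappa> i) l, if l \<in> {2, 7} then MoveRight else Stay) (\<kappa> i l)"
        by (auto simp: \<mu>_def \<kappa>_def okm_def simp del: act.simps)
    qed
    have rB: "reads ?r \<mu> 2 = ?U (int (2 * i) + 1)" "reads ?r \<mu> 1 = Some (y ! i)"
      "reads ?r \<mu> 5 = Some okm" "reads ?r \<mu> 6 = Some (par i)"
      using r i by (simp_all add: \<mu>_def \<kappa>_def rd_def snd_tape_of) (simp_all add: flag_def)
    have U: "?U (int (2 * i)) = (if 2 * i < length u then Some (u ! (2 * i)) else None)"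
      "?U (int (2 * i) + 1) = (if 2 * i + 1 < length u then Some (u ! (2 * i + 1)) else None)"
      by (auto simp: snd_tape_of nat_add_distrib nat_mult_distrib)
    have ok_Suc: "ok (Suc i) \<longleftrightarrow> okm \<and> ?U (int (2 * i) + 1) \<noteq> None"
      unfolding okm_def U by (auto simp: ok_def less_Suc_eq)
    have "i < length (odds u) \<longleftrightarrow> 2 * i + 1 < length u" by auto
    then have par_Suc: "par (Suc i) \<longleftrightarrow> (par i \<noteq> (?U (int (2 * i) + 1) = Some True \<and> y ! i))"
      unfolding par_def ip_take_Suc[OF i] U using nth_evens_odds(2)[of i u] by auto
    have B: "runs ?r ?B 1 \<mu> (\<kappa> (Suc i))"
    proof (rule runs_prim, unfold rB)
      fix l assume "l < ?r"
      then show "\<kappa> (Suc i) l = act (if l = 5 then (if ?U (int (2 * i) + 1) = None then Some False else Some okm)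
          else if l = 6 then (if ?U (int (2 * i) + 1) = Some True \<and> Some (y ! i) = Some True
            then map_option Not (Some (par i)) else Some (par i))
          else reads ?r \<mu> l, if l \<in> {1, 2} then MoveRight else Stay) (\<mu> l)"
        using ok_Suc par_Suc by (auto simp: \<mu>_def \<kappa>_def simp del: act.simps)
    qed
    from runs_seqm[OF A B] rA(2)
    show "reads ?r (\<kappa> i) 7 \<noteq> None \<and> runs ?r (seqm ?A ?B) 2 (\<kappa> i) (\<kappa> (Suc i))" by (simp add: numeral_2_eq_2)
  next
    show "\<not> reads ?r (\<kappa> ?N) 7 \<noteq> None" using r by (simp add: \<kappa>_def rd_def Z)
  qed
  have \<kappa>0: "\<kappa> 0 = \<sigma>5"
    using \<sigma>5 by (auto simp: \<kappa>_def fun_eq_iff prod_eq_iff ok_def par_def)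
  \<comment> \<open>One leftover symbol is skipped. A blank behind it then shows that u has at most
    2 N + 1 symbols, while \<open>ok\<close> gives at least 2 N.\<close>
  define q where "q = (if ?U (int (2 * ?N)) \<noteq> None then int (2 * ?N) + 1 else int (2 * ?N))"
  define \<sigma>7 where "\<sigma>7 = (\<kappa> ?N)(2 := (q, ?U))"
  have r7: "runs ?r (prim ?r (\<lambda>\<rho> l. (\<rho> l, if l = 2 \<and> \<rho> 2 \<noteq> None then MoveRight else Stay))) 1 (\<kappa> ?N) \<sigma>7"
  proof (rule runs_prim)
    fix l assume "l < ?r"
    then show "\<sigma>7 l = act (reads ?r (\<kappa> ?N) l, if l = 2 \<and> reads ?r (\<kappa> ?N) 2 \<noteq> None then MoveRight else Stay) (\<kappa> ?N l)"
      using r by (auto simp: \<sigma>7_def \<kappa>_def q_def rd_def[of "(int (2 * ?N), ?U)"] simp del: act.simps)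
        (simp_all add: rd_def)
  qed
  define res where "res \<longleftrightarrow> ok ?N \<and> ?U q = None \<and> par ?N = a"
  define \<sigma>8 where "\<sigma>8 = \<sigma>7(0 := (1, ?U(0 := Some res)))"
  have "\<sigma>7 0 = (0, ?U)" using \<sigma>5(1) by (simp add: \<sigma>7_def \<kappa>_def prod_eq_iff)
  moreover have rd7: "reads ?r \<sigma>7 5 = Some (ok ?N)" "reads ?r \<sigma>7 6 = Some (par ?N)" "reads ?r \<sigma>7 2 = ?U q"
    using r by (simp_all add: \<sigma>7_def \<kappa>_def) (simp add: rd_def)
  ultimately have r8: "runs ?r (prim ?r (\<lambda>\<rho> l. if l = 0 then (Some (\<rho> 5 = Some True \<and> \<rho> 2 = None \<and> \<rho> 6 = Some a), MoveRight)
          else (\<rho> l, Stay))) 1 \<sigma>7 \<sigma>8"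
    by (intro runs_prim) (auto simp: \<sigma>8_def res_def rd7 simp del: fst_snd_act)
  define \<sigma>9 where "\<sigma>9 = \<sigma>8(0 := (1, ?U(0 := Some res, 1 := None)))"
  have r9: "runs ?r (prim ?r (\<lambda>\<rho> l. (if l = 0 then None else \<rho> l, Stay))) 1 \<sigma>8 \<sigma>9"
    by (intro runs_prim) (auto simp: \<sigma>9_def \<sigma>8_def)
  have "res = preimage_check h a u y"
  proof (cases "length u div 2 = ?N")
    case True
    have 1: "?U q = None" using True by (auto simp: q_def snd_tape_of)
    have 2: "ok ?N \<longleftrightarrow> h y = evens u"
      using True len nth_evens_odds(1)[of _ u] by (auto simp: ok_def list_eq_iff_nth_eq)
    have "take ?N (odds u) = odds u" using True by simp
    with 1 2 True show ?thesis by (simp add: res_def preimage_check_def par_def)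
  next
    case False
    have "\<not> (ok ?N \<and> ?U q = None)"
    proof
      assume *: "ok ?N \<and> ?U q = None"
      then have "2 * ?N \<le> length u" by (cases ?N) (auto simp: ok_def)
      then show False using * False by (auto simp: q_def snd_tape_of split: if_splits)
    qed
    with False show ?thesis by (auto simp: res_def preimage_check_def)
  qed
  moreover have "runs ?r (check_tm M a) (4 * length u + 8 * length y + 3 * T + 20) \<sigma>0 \<sigma>9"
    unfolding check_tm_def Let_def
    by (rule runs_mono[OF runs_seqm[OF r1 runs_seqm[OF r2 runs_seqm[OF r3 runs_seqm[OF r4
      runs_seqm[OF r5[unfolded \<tau>0] runs_seqm[OF r6[unfolded \<kappa>0] runs_seqm[OF r7 runs_seqm[OF r8 r9]]]]]]]]])
      (use p(2) in auto)
  ultimately show ?thesis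
    unfolding \<sigma>0_def[symmetric] by (intro exI[of _ \<sigma>9]) (simp add: \<sigma>9_def)
qed

lemma wf_check_tm: "wf_tm M \<Longrightarrow> wf_prog (7 + ntapes M) (check_tm M a)"
  by (simp add: check_tm_def Let_def wf_tracked)

text \<open>Bijectivity of h makes the preimage the only string that can pass, for either value of
  the bit. This is the source of unique witnesses.\<close>

lemma preimage_check_iff:
  assumes bij: "\<And>l. bij_betw h (strings l) (strings l)"
  shows "preimage_check h a u y \<longleftrightarrow>
      y = inv_into (strings (length u div 2)) h (evens u) \<and> gl_bit h u = a"
proof -
  let ?V = "strings (length u div 2)"
  have e: "evens u \<in> ?V" by (simp add: strings_def)
  have "length y = length u div 2 \<and> h y = evens u \<longleftrightarrow> y = inv_into ?V h (evens u)"
  proof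
    assume "length y = length u div 2 \<and> h y = evens u"
    then show "y = inv_into ?V h (evens u)"
      using bij[of "length u div 2"] by (metis (mono_tags, lifting) bij_betw_inv_into_left mem_Collect_eq strings_def)
  next
    assume y: "y = inv_into ?V h (evens u)"
    have "evens u \<in> h ` ?V" using e bij[of "length u div 2"] by (auto simp: bij_betw_def)
    from inv_into_into[OF this] f_inv_into_f[OF this] show "length y = length u div 2 \<and> h y = evens u"
      by (auto simp: y strings_def)
  qed
  then show ?thesis by (auto simp: preimage_check_def gl_bit_def)
qed

lemma NPcoNP_unique_gl_bit:
  assumes "polytime_fun h" and bij: "\<And>l. bij_betw h (strings l) (strings l)"
  shows "NPcoNP_unique (gl_bit h)" "polytime_rel (preimage_check h a)"
proof -
  have len: "length (h y) = length y" for y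
    using bij_betwE[OF bij[of "length y"]] by (auto simp: strings_def)
  from assms(1) obtain M b where wf: "wf_tm M"
    and M: "\<forall>(xs, w)\<in>{([x], h x) | x. True}. length xs \<le> ntapes M \<and>
      outputs_within M xs w (sum_list (map length xs) ^ b + b)"
    unfolding polytime_fun_def polytime_def by blast
  have out: "outputs_within M [y] (h y) (length y ^ b + b)" for y
    using bspec[OF M, of "([y], h y)"] by simp
  have rel: "polytime_rel (preimage_check h a)" for a
    unfolding polytime_rel_def
  proof (rule polytime_if_runs[OF wf_check_tm[OF wf, of a], of 2 "\<lambda>N. 12 * N + 3 * (N ^ b + b) + 20"])
    show "poly_bounded (\<lambda>N. 12 * N + 3 * (N ^ b + b) + 20)" by (intro poly_bounded_intros)
    fix xs w assume "(xs, w) \<in> {([u, y], [preimage_check h a u y]) | u y. True}"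
    then obtain u y where xs: "xs = [u, y]" "w = [preimage_check h a u y]" by blast
    from runs_check_tm[where h = h and u = u and a = a, OF wf out len] obtain \<sigma>' where
      \<sigma>': "runs (7 + ntapes M) (check_tm M a) (4 * length u + 8 * length y + 3 * (length y ^ b + b) + 20)
        (\<lambda>j. tape_of (if j < 2 then [u, y] ! j else [])) \<sigma>'"
      "snd (\<sigma>' 0) 0 = Some (preimage_check h a u y)" "snd (\<sigma>' 0) 1 = None" by blast
    have "length y ^ b \<le> (length u + length y) ^ b" by (rule power_mono) auto
    then have "runs (7 + ntapes M) (check_tm M a)
        (12 * sum_list (map length xs) + 3 * (sum_list (map length xs) ^ b + b) + 20)
        (\<lambda>j. tape_of (if j < 2 then xs ! j else [])) \<sigma>'"
      unfolding xs by (intro runs_mono[OF \<sigma>'(1)]) simp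
    with \<sigma>' show "length xs = 2 \<and> (\<exists>\<sigma>'. runs (7 + ntapes M) (check_tm M a)
        (12 * sum_list (map length xs) + 3 * (sum_list (map length xs) ^ b + b) + 20)
        (\<lambda>j. tape_of (if j < 2 then xs ! j else [])) \<sigma>' \<and>
        (\<forall>j<length w. snd (\<sigma>' 0) (int j) = Some (w ! j)) \<and> snd (\<sigma>' 0) (int (length w)) = None)"
      unfolding xs by (auto simp: less_Suc_eq)
  qed simp
  then show "polytime_rel (preimage_check h a)" .
  note check = preimage_check_iff[OF bij]
  have short: "length (inv_into (strings (length u div 2)) h (evens u)) \<le> length u ^ 1" for u
    using check[of "gl_bit h u" u "inv_into (strings (length u div 2)) h (evens u)"]
    by (auto simp: preimage_check_def)
  show "NPcoNP_unique (gl_bit h)"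
    unfolding NPcoNP_unique_def
    by (rule exI[of _ "preimage_check h"], rule exI[of _ 1]) (use rel short in \<open>auto simp: check\<close>)
qed

section \<open>Checking tables of tautologies\<close>

subsection \<open>Loops over stacks\<close>

definition rewrite :: "nat \<Rightarrow> (bool list list \<Rightarrow> bool list list) \<Rightarrow> bool list list \<Rightarrow> bool list list" where
  "rewrite d g S = map2 (@) (g (map (take d) S)) (map (drop d) S)"

lemma ex_rewrite:
  assumes "\<And>ts. length ts = n \<Longrightarrow> length (g ts) = n"
  shows "\<exists>M c. \<forall>S. length S = n \<longrightarrow> srun n M c S (rewrite d g S)"
  using ex_block[of "\<lambda>ts. if length ts = n then g ts else replicate n []" n d] assms
  by (simp add: rewrite_def cong: conj_cong)

text \<open>Symbols arrive on the target stacks in reverse order. A second drain restores the order,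
  and a drain onto two stacks makes a copy.\<close>

definition drained :: "nat \<Rightarrow> (bool \<Rightarrow> nat \<Rightarrow> bool list) \<Rightarrow> bool list list \<Rightarrow> bool list list" where
  "drained j h S = map (\<lambda>i. if i = j then [] else concat (map (\<lambda>x. h x i) (rev (S ! j))) @ S ! i) [0..<length S]"

lemma length_drained [simp]: "length (drained j h S) = length S"
  by (simp add: drained_def)

lemma ex_drain:
  assumes j: "j < n"
  shows "\<exists>M c. \<forall>S. length S = n \<longrightarrow> srun n M (c * (length (S ! j) + 1)) S (drained j h S)"
proof -
  define g where "g ts = map (\<lambda>i. if i = j then tl (ts ! i) else (if ts ! j = [] then [] else h (hd (ts ! j)) i) @ ts ! i)
    [0..<n]" for ts
  obtain M c where M: "\<And>S. length S = n \<Longrightarrow> srun n M c S (rewrite 1 g S)"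
    using ex_rewrite[of n g 1] by (auto simp: g_def)
  have wf: "wf_prog (Suc n) M" using M[of "replicate n []"] by (simp add: srun_def)
  let ?W = "swhile n (\<lambda>ts. ts ! j \<noteq> None) M"
  have main: "srun n ?W (length (S ! j) * (c + 1) + 1) S (drained j h S)" if "length S = n" for S
    using that
  proof (induction "S ! j" arbitrary: S)
    case Nil
    have "drained j h S = S"
      using Nil j by (intro nth_equalityI) (auto simp: drained_def simp flip: Nil.hyps)
    moreover have "srun n ?W 1 S S" using Nil j wf by (intro srun_while_false) (auto simp: tops_def)
    ultimately show ?case using Nil.hyps by simp
  next
    case (Cons x xs)
    let ?S = "rewrite 1 g S"
    have S: "?S ! i = (if i = j then xs else h x i @ S ! i)" if "i < n" for i
      using that Cons.prems Cons.hyps(2)[symmetric] j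
      by (cases "S ! i") (auto simp: rewrite_def g_def)
    have len: "length ?S = n" using Cons.prems by (simp add: rewrite_def g_def)
    have "drained j h ?S = drained j h S"
      using S j Cons.prems len Cons.hyps(2)[symmetric] by (intro nth_equalityI) (auto simp: drained_def)
    with Cons.hyps(1)[of ?S] S[OF j] len have "srun n ?W (length xs * (c + 1) + 1) ?S (drained j h S)" by simp
    from srun_while_true[OF _ M[OF Cons.prems] this] Cons.prems Cons.hyps(2)[symmetric] j
    show ?case by (auto simp: tops_def add_ac)
  qed
  have "srun n ?W ((c + 1) * (length (S ! j) + 1)) S (drained j h S)" if "length S = n" for S
    by (rule srun_mono[OF main[OF that]]) simp
  then show ?thesis by blast
qed

definition push_on :: "nat set \<Rightarrow> bool \<Rightarrow> nat \<Rightarrow> bool list" where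
  "push_on I x i = (if i \<in> I then [x] else [])"

lemma concat_singletons [simp]: "concat (map (\<lambda>x. [c]) xs) = replicate (length xs) c"
  by (induction xs) auto

text \<open>The stacks are: the witness \<open>y\<close>; the rest \<open>b\<close> of the table; the formula \<open>x\<close> and the
  assignment \<open>a\<close>, which together are a counter; the unread part \<open>p\<close> of the formula; the part \<open>q\<close>
  of the assignment already read; the tokens \<open>k\<close> of the formula; a variable \<open>w\<close>; a scratch stack
  \<open>z\<close>; values \<open>v\<close>; flags \<open>f\<close>; flags \<open>g\<close> of the lookup of a variable.\<close>

lemmas stack_simps = rewrite_def drained_def push_on_def tops_def eval_nat_numeral upt_rec

subsection \<open>Looking up a variable\<close>

text \<open>An assignment is a list of variables, each of them reversed and self-delimiting, followed by
  \<open>1\<close>s. The variable sought is \<open>rev z @ r\<close>; \<open>m\<close> tells whether the current entry agrees with it so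
  far.\<close>

fun lookup :: "bool list \<Rightarrow> bool list \<Rightarrow> bool list \<Rightarrow> bool \<Rightarrow> bool \<Rightarrow> bool" where
  "lookup (True # b # a) r z m fd = (if r \<noteq> [] \<and> hd r = b then lookup a (tl r) (b # z) m fd
     else lookup a r z False fd)"
| "lookup [True] r z m fd = fd"
| "lookup (False # a) r z m fd = lookup a (rev z @ r) [] True (fd \<or> (m \<and> r = []))"
| "lookup [] r z m fd = fd"

definition lookup_step :: "bool list list \<Rightarrow> bool list list" where
  "lookup_step ts = (let a = ts ! 3; q = ts ! 5; w = ts ! 7; z = ts ! 8; m = ts ! 11 ! 1; fd = ts ! 11 ! 2 in
     if a = [] then ts
     else if \<not> hd a then ts[3 := tl a, 5 := False # q, 11 := [True, True, fd \<or> (m \<and> w = [])]]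
     else if tl a = [] then ts[3 := [], 5 := True # q, 11 := [False, False, fd]]
     else if w \<noteq> [] \<and> hd w = hd (tl a)
       then ts[3 := drop 2 a, 5 := hd (tl a) # True # q, 7 := tl w, 8 := hd (tl a) # z, 11 := [False, m, fd]]
     else ts[3 := drop 2 a, 5 := hd (tl a) # True # q, 11 := [False, False, fd]])"

text \<open>The symbols of the sought variable only move between \<open>r\<close> and
  \<open>z\<close>, so \<open>N\<close> bounds every restoration. The time bound charges a full
  restoration to each symbol of the assignment.\<close>

lemma ex_lookup:
  "\<exists>M C. \<forall>y b x a p q k r z v f e m fd N. length r + length z \<le> N \<longrightarrow> (\<exists>r' z' e' m'.
     srun 12 M (length a * (C * (N + 1)) + 1) [y, b, x, a, p, q, k, r, z, v, f, [e, m, fd]]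
       [y, b, x, [], p, rev a @ q, k, r', z', v, f, [e', m', lookup a r z m fd]] \<and>
     length r' + length z' \<le> N)"
proof -
  have "length (lookup_step ts) = 12" if "length ts = 12" for ts
    using that by (simp add: lookup_step_def Let_def)
  then obtain M0 c0 where M0: "\<And>S. length S = 12 \<Longrightarrow> srun 12 M0 c0 S (rewrite 4 lookup_step S)"
    using ex_rewrite by blast
  obtain M1 c1 where M1: "\<And>S. length S = 12 \<Longrightarrow>
      srun 12 M1 (c1 * (length (S ! 8) + 1)) S (drained 8 (push_on {7}) S)"
    using ex_drain[of 8 12 "push_on {7}"] by auto
  have wf0: "wf_prog (Suc 12) M0" using M0[of "replicate 12 []"] unfolding srun_def by simp
  have wf1: "wf_prog (Suc 12) M1" using M1[of "replicate 12 []"] unfolding srun_def by simp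
  have wfs: "wf_prog (Suc 12) (skip 12)" using srun_skip[of "replicate 12 []" 12] unfolding srun_def by simp
  let ?B = "seqm M0 (sif 12 (\<lambda>ts. ts ! 11 = Some True) M1 (skip 12))"
  let ?W = "swhile 12 (\<lambda>ts. ts ! 3 \<noteq> None) ?B"
  have wfB: "wf_prog (Suc 12) ?B" by (intro wf_seqm wf_sif wf0 wf1 wfs)
  define C where "C = c0 + c1 + 3"
  have body: "srun 12 ?B (c0 + (1 + (c1 + 1) * (N + 1))) S S2"
    if "length S = 12" "S1 = rewrite 4 lookup_step S" "length (S1 ! 8) \<le> N"
      "S2 = (if tops S1 ! 11 = Some True then drained 8 (push_on {7}) S1 else S1)" for S S1 S2 N
  proof (rule srun_seqm[OF M0[OF that(1)]], rule srun_sif[OF wf1 wfs])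
    have len: "length (rewrite 4 lookup_step S) = 12" using srunD(2)[OF M0[OF that(1)]] .
    have "c1 * (length (S1 ! 8) + 1) \<le> (c1 + 1) * (N + 1)" using that(3) by (intro mult_mono) auto
    from srun_mono[OF M1[OF len] this[unfolded that(2)]]
      srun_mono[OF srun_skip[OF len], of "(c1 + 1) * (N + 1)"]
    show "if tops (rewrite 4 lookup_step S) ! 11 = Some True
        then srun 12 M1 ((c1 + 1) * (N + 1)) (rewrite 4 lookup_step S) S2
        else srun 12 (skip 12) ((c1 + 1) * (N + 1)) (rewrite 4 lookup_step S) S2"
      unfolding that(4) that(2) by auto
  qed
  have cost: "1 + (c0 + (1 + (c1 + 1) * (N + 1))) + (l * (C * (N + 1)) + 1) \<le> Suc l * (C * (N + 1)) + 1" for l N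
    by (simp add: C_def algebra_simps)
  have cost2: "1 + (c0 + (1 + (c1 + 1) * (N + 1))) + (length a * (C * (N + 1)) + 1)
      \<le> length (True # b' # a) * (C * (N + 1)) + 1" for a b' N
    using cost[of N "length a"] by simp
  have main: "\<exists>r' z' e' m'. srun 12 ?W (length a * (C * (N + 1)) + 1) [y, b, x, a, p, q, k, r, z, v, f, [e, m, fd]]
       [y, b, x, [], p, rev a @ q, k, r', z', v, f, [e', m', lookup a r z m fd]] \<and> length r' + length z' \<le> N"
    if "length r + length z \<le> N" for y b x a p q k r z v f e m fd N
    using that
  proof (induction a r z m fd arbitrary: q e rule: lookup.induct)
    case (1 b' a r z m fd)
    let ?S = "[y, b, x, True # b' # a, p, q, k, r, z, v, f, [e, m, fd]]"
    show ?case
    proof (cases "r \<noteq> [] \<and> hd r = b'")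
      case True
      then obtain r1 where r: "r = b' # r1" by (cases r) auto
      let ?T = "[y, b, x, a, p, b' # True # q, k, r1, b' # z, v, f, [False, m, fd]]"
      have "rewrite 4 lookup_step ?S = ?T"
        by (simp add: stack_simps lookup_step_def r)
      then have "srun 12 ?B (c0 + (1 + (c1 + 1) * (N + 1))) ?S ?T"
        using 1(3) by (intro body[of _ ?T]) (simp_all add: r tops_def)
      moreover from 1(1)[OF True, of "b' # True # q" False] 1(3) r obtain r' z' e' m' where
        "srun 12 ?W (length a * (C * (N + 1)) + 1) ?T
          [y, b, x, [], p, rev a @ b' # True # q, k, r', z', v, f, [e', m', lookup a r1 (b' # z) m fd]]"
        "length r' + length z' \<le> N" by auto
      ultimately have "srun 12 ?W (1 + (c0 + (1 + (c1 + 1) * (N + 1))) + (length a * (C * (N + 1)) + 1)) ?S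
          [y, b, x, [], p, rev a @ b' # True # q, k, r', z', v, f, [e', m', lookup a r1 (b' # z) m fd]]"
        by (intro srun_while_true) (simp_all add: tops_def)
      from srun_mono[OF this cost2] \<open>length r' + length z' \<le> N\<close> r show ?thesis by auto
    next
      case False
      let ?T = "[y, b, x, a, p, b' # True # q, k, r, z, v, f, [False, False, fd]]"
      have "rewrite 4 lookup_step ?S = ?T"
        using False by (cases r) (auto simp: stack_simps lookup_step_def)
      then have "srun 12 ?B (c0 + (1 + (c1 + 1) * (N + 1))) ?S ?T"
        using 1(3) by (intro body[of _ ?T]) (simp_all add: tops_def)
      moreover from 1(2)[OF False, of "b' # True # q" False] 1(3) obtain r' z' e' m' where
        "srun 12 ?W (length a * (C * (N + 1)) + 1) ?T
          [y, b, x, [], p, rev a @ b' # True # q, k, r', z', v, f, [e', m', lookup a r z False fd]]"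
        "length r' + length z' \<le> N" by auto
      ultimately have "srun 12 ?W (1 + (c0 + (1 + (c1 + 1) * (N + 1))) + (length a * (C * (N + 1)) + 1)) ?S
          [y, b, x, [], p, rev a @ b' # True # q, k, r', z', v, f, [e', m', lookup a r z False fd]]"
        by (intro srun_while_true) (simp_all add: tops_def)
      from srun_mono[OF this cost2] \<open>length r' + length z' \<le> N\<close> False show ?thesis by auto
    qed
  next
    case (2 r z m fd)
    let ?S = "[y, b, x, [True], p, q, k, r, z, v, f, [e, m, fd]]"
    let ?T = "[y, b, x, [], p, True # q, k, r, z, v, f, [False, False, fd]]"
    have "rewrite 4 lookup_step ?S = ?T" by (simp add: stack_simps lookup_step_def)
    then have "srun 12 ?B (c0 + (1 + (c1 + 1) * (N + 1))) ?S ?T"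
      using 2 by (intro body[of _ ?T]) (simp_all add: tops_def)
    moreover have "srun 12 ?W (0 * (C * (N + 1)) + 1) ?T ?T"
      using srun_while_false[OF wfB, of ?T "\<lambda>ts. ts ! 3 \<noteq> None"] by (simp add: tops_def)
    ultimately have "srun 12 ?W (1 + (c0 + (1 + (c1 + 1) * (N + 1))) + (0 * (C * (N + 1)) + 1)) ?S ?T"
      by (intro srun_while_true) (simp_all add: tops_def)
    then have "srun 12 ?W (length [True] * (C * (N + 1)) + 1) ?S ?T"
      by (rule srun_mono) (use cost[of N 0] in simp)
    with 2 show ?case by auto
  next
    case (3 a r z m fd)
    let ?S = "[y, b, x, False # a, p, q, k, r, z, v, f, [e, m, fd]]"
    let ?fd = "fd \<or> (m \<and> r = [])"
    let ?T1 = "[y, b, x, a, p, False # q, k, r, z, v, f, [True, True, ?fd]]"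
    let ?T = "[y, b, x, a, p, False # q, k, rev z @ r, [], v, f, [True, True, ?fd]]"
    have "rewrite 4 lookup_step ?S = ?T1" by (simp add: stack_simps lookup_step_def)
    moreover have "drained 8 (push_on {7}) ?T1 = ?T" by (simp add: stack_simps)
    ultimately have "srun 12 ?B (c0 + (1 + (c1 + 1) * (N + 1))) ?S ?T"
      using 3(2) by (intro body[of _ ?T1]) (simp_all add: tops_def)
    moreover from 3(1)[of "False # q" True] 3(2) obtain r' z' e' m' where
      "srun 12 ?W (length a * (C * (N + 1)) + 1) ?T
        [y, b, x, [], p, rev a @ False # q, k, r', z', v, f, [e', m', lookup a (rev z @ r) [] True ?fd]]"
      "length r' + length z' \<le> N" by (auto simp: add.commute)
    ultimately have "srun 12 ?W (1 + (c0 + (1 + (c1 + 1) * (N + 1))) + (length a * (C * (N + 1)) + 1)) ?S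
        [y, b, x, [], p, rev a @ False # q, k, r', z', v, f, [e', m', lookup a (rev z @ r) [] True ?fd]]"
      by (intro srun_while_true) (simp_all add: tops_def)
    then have "srun 12 ?W (length (False # a) * (C * (N + 1)) + 1) ?S
        [y, b, x, [], p, rev a @ False # q, k, r', z', v, f, [e', m', lookup a (rev z @ r) [] True ?fd]]"
      by (rule srun_mono) (use cost[of N "length a"] in simp)
    with \<open>length r' + length z' \<le> N\<close> show ?case by auto
  next
    case (4 r z m fd)
    have "srun 12 ?W 1 [y, b, x, [], p, q, k, r, z, v, f, [e, m, fd]] [y, b, x, [], p, q, k, r, z, v, f, [e, m, fd]]"
      by (intro srun_while_false wfB) (simp_all add: tops_def)
    with 4 show ?case by auto
  qed
  show ?thesis by (rule exI[of _ ?W], rule exI[of _ C], intro allI impI, rule main)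
qed

lemma concat_Nils [simp]: "concat (map (\<lambda>x. []) xs) = []"
  by simp

lemma srun_wf: "(\<And>S. length S = n \<Longrightarrow> srun n M (t S) S (R S)) \<Longrightarrow> wf_prog (Suc n) M"
  unfolding srun_def by (metis length_replicate)

text \<open>The name of the variable is collected in reverse, which is why the entries of an
  assignment are reversed names.\<close>

fun split_var :: "bool list \<Rightarrow> bool list \<Rightarrow> bool list \<times> bool list" where
  "split_var (True # b # p) w = split_var p (b # w)"
| "split_var [True] w = ([], w)"
| "split_var (False # p) w = (False # p, w)"
| "split_var [] w = ([], w)"

lemma length_split_var: "length (fst (split_var p w)) \<le> length p" "length (snd (split_var p w)) \<le> length p + length w"
  by (induction p w rule: split_var.induct) auto

definition split_var_step :: "bool list list \<Rightarrow> bool list list" where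
  "split_var_step ts = (let p = ts ! 4 in
     if tl p = [] then ts[4 := []] else ts[4 := drop 2 p, 7 := hd (tl p) # ts ! 7])"

lemma ex_split_var:
  "\<exists>M c. \<forall>y b x a p q k w z v f g. srun 12 M (c * (length p + 1)) [y, b, x, a, p, q, k, w, z, v, f, g]
     [y, b, x, a, fst (split_var p w), q, k, snd (split_var p w), z, v, f, g]"
proof -
  have "length (split_var_step ts) = 12" if "length ts = 12" for ts
    using that by (simp add: split_var_step_def Let_def)
  then obtain M0 c0 where M0: "\<And>S. length S = 12 \<Longrightarrow> srun 12 M0 c0 S (rewrite 4 split_var_step S)"
    using ex_rewrite by blast
  have wf: "wf_prog (Suc 12) M0" by (rule srun_wf[OF M0])
  let ?W = "swhile 12 (\<lambda>ts. ts ! 4 = Some True) M0"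
  have main: "srun 12 ?W ((c0 + 1) * (length p + 1)) [y, b, x, a, p, q, k, w, z, v, f, g]
     [y, b, x, a, fst (split_var p w), q, k, snd (split_var p w), z, v, f, g]" for y b x a p q k w z v f g
  proof (induction p w rule: split_var.induct)
    case (1 b' p w)
    have "srun 12 M0 c0 [y, b, x, a, True # b' # p, q, k, w, z, v, f, g] [y, b, x, a, p, q, k, b' # w, z, v, f, g]"
      using M0[of "[y, b, x, a, True # b' # p, q, k, w, z, v, f, g]"] by (simp add: stack_simps split_var_step_def)
    from srun_while_true[OF _ this 1] have "srun 12 ?W (1 + c0 + (c0 + 1) * (length p + 1))
        [y, b, x, a, True # b' # p, q, k, w, z, v, f, g]
        [y, b, x, a, fst (split_var p (b' # w)), q, k, snd (split_var p (b' # w)), z, v, f, g]"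
      by (simp add: tops_def)
    then show ?case by (simp only: split_var.simps) (rule srun_mono, assumption, simp)
  next
    case (2 w)
    have "srun 12 M0 c0 [y, b, x, a, [True], q, k, w, z, v, f, g] [y, b, x, a, [], q, k, w, z, v, f, g]"
      using M0[of "[y, b, x, a, [True], q, k, w, z, v, f, g]"] by (simp add: stack_simps split_var_step_def)
    from srun_while_true[OF _ this srun_while_false[OF wf]]
    have "srun 12 ?W (1 + c0 + 1) [y, b, x, a, [True], q, k, w, z, v, f, g] [y, b, x, a, [], q, k, w, z, v, f, g]"
      by (simp add: tops_def)
    then show ?case by (simp only: split_var.simps fst_conv snd_conv) (rule srun_mono, assumption, simp)
  next
    case (3 p w)
    have "srun 12 ?W 1 [y, b, x, a, False # p, q, k, w, z, v, f, g] [y, b, x, a, False # p, q, k, w, z, v, f, g]"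
      by (rule srun_while_false[OF wf]) (simp_all add: tops_def)
    then show ?case by (simp only: split_var.simps fst_conv snd_conv) (rule srun_mono, assumption, simp)
  next
    case (4 w)
    have "srun 12 ?W 1 [y, b, x, a, [], q, k, w, z, v, f, g] [y, b, x, a, [], q, k, w, z, v, f, g]"
      by (rule srun_while_false[OF wf]) (simp_all add: tops_def)
    then show ?case by (simp only: split_var.simps fst_conv snd_conv) (rule srun_mono, assumption, simp)
  qed
  show ?thesis by (rule exI[of _ ?W], rule exI[of _ "c0 + 1"], intro allI, rule main)
qed

definition var_value :: "bool list \<Rightarrow> bool list \<Rightarrow> bool" where
  "var_value a w = lookup a w [] True False"

text \<open>Depth 4 suffices throughout: no token prefix that is read at once and no group of flags
  has more than four symbols.\<close>

lemma ex_rewrite12: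
  assumes "\<And>ts. length (g ts) = length ts"
  obtains M c where "\<And>S. length S = 12 \<Longrightarrow> srun 12 M c S (rewrite 4 g S)"
  using ex_rewrite[of 12 g 4] assms by auto

lemma ex_drain12:
  assumes "j < 12"
  obtains M c where "\<And>S. length S = 12 \<Longrightarrow> srun 12 M (c * (length (S ! j) + 1)) S (drained j h S)"
  using ex_drain[OF assms] by blast

lemma ex_var_value:
  "\<exists>M C. \<forall>y b x a p k v f N. length a \<le> N \<longrightarrow> length p \<le> N \<longrightarrow>
     srun 12 M (C * (N + 1) ^ 2) [y, b, x, a, p, [], k, [], [], v, f, [True]]
       [y, b, x, a, tl (fst (split_var p [])), [], True # var_value a (snd (split_var p [])) # k, [], [], v, f, []]"
proof -
  obtain M1 c1 where M1: "\<And>y b x a p q k w z v f g. srun 12 M1 (c1 * (length p + 1)) [y, b, x, a, p, q, k, w, z, v, f, g]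
     [y, b, x, a, fst (split_var p w), q, k, snd (split_var p w), z, v, f, g]" using ex_split_var by blast
  obtain M2 c2 where M2: "\<And>S. length S = 12 \<Longrightarrow> srun 12 M2 c2 S
      (rewrite 4 (\<lambda>ts. ts[4 := tl (ts ! 4), 11 := [False, True, False]]) S)"
    using ex_rewrite12[of "\<lambda>ts. ts[4 := tl (ts ! 4), 11 := [False, True, False]]"] by auto
  obtain M3 c3 where M3: "\<And>y b x a p q k r z v f e m fd N. length r + length z \<le> N \<Longrightarrow> (\<exists>r' z' e' m'.
     srun 12 M3 (length a * (c3 * (N + 1)) + 1) [y, b, x, a, p, q, k, r, z, v, f, [e, m, fd]]
       [y, b, x, [], p, rev a @ q, k, r', z', v, f, [e', m', lookup a r z m fd]] \<and>
     length r' + length z' \<le> N)" using ex_lookup by blast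
  obtain M4 c4 where M4: "\<And>S. length S = 12 \<Longrightarrow> srun 12 M4 (c4 * (length (S ! 7) + 1)) S (drained 7 (push_on {}) S)"
    using ex_drain12[of 7 "push_on {}"] by auto
  obtain M5 c5 where M5: "\<And>S. length S = 12 \<Longrightarrow> srun 12 M5 (c5 * (length (S ! 8) + 1)) S (drained 8 (push_on {}) S)"
    using ex_drain12[of 8 "push_on {}"] by auto
  obtain M6 c6 where M6: "\<And>S. length S = 12 \<Longrightarrow> srun 12 M6 (c6 * (length (S ! 5) + 1)) S (drained 5 (push_on {3}) S)"
    using ex_drain12[of 5 "push_on {3}"] by auto
  obtain M7 c7 where M7: "\<And>S. length S = 12 \<Longrightarrow> srun 12 M7 c7 S
      (rewrite 4 (\<lambda>ts. ts[6 := True # ts ! 11 ! 2 # ts ! 6, 11 := []]) S)"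
    using ex_rewrite12[of "\<lambda>ts. ts[6 := True # ts ! 11 ! 2 # ts ! 6, 11 := []]"] by auto
  let ?M = "seqm M1 (seqm M2 (seqm M3 (seqm M4 (seqm M5 (seqm M6 M7)))))"
  define C where "C = c1 + c2 + c3 + 1 + c4 + c5 + c6 + c7"
  have "srun 12 ?M (C * (N + 1) ^ 2) [y, b, x, a, p, [], k, [], [], v, f, [True]]
       [y, b, x, a, tl (fst (split_var p [])), [], True # var_value a (snd (split_var p [])) # k, [], [], v, f, []]"
    if N: "length a \<le> N" "length p \<le> N" for y b x a p k v f N
  proof -
    let ?p = "fst (split_var p [])" and ?w = "snd (split_var p [])"
    have w: "length ?w + length ([] :: bool list) \<le> N" using length_split_var(2)[of p "[]"] N by simp
    have s2: "srun 12 M2 c2 [y, b, x, a, ?p, [], k, ?w, [], v, f, [True]]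
        [y, b, x, a, tl ?p, [], k, ?w, [], v, f, [False, True, False]]"
      using M2[of "[y, b, x, a, ?p, [], k, ?w, [], v, f, [True]]"] by (cases ?p) (simp_all add: stack_simps)
    from M3[OF w, of a y b x "tl ?p" "[]" k v f False True False] obtain r z e m where
      s3: "srun 12 M3 (length a * (c3 * (N + 1)) + 1) [y, b, x, a, tl ?p, [], k, ?w, [], v, f, [False, True, False]]
        [y, b, x, [], tl ?p, rev a, k, r, z, v, f, [e, m, var_value a ?w]]" and rz: "length r + length z \<le> N"
      by (auto simp: var_value_def)
    have s4: "srun 12 M4 (c4 * (length r + 1)) [y, b, x, [], tl ?p, rev a, k, r, z, v, f, [e, m, var_value a ?w]]
        [y, b, x, [], tl ?p, rev a, k, [], z, v, f, [e, m, var_value a ?w]]"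
      using M4[of "[y, b, x, [], tl ?p, rev a, k, r, z, v, f, [e, m, var_value a ?w]]"] by (simp add: stack_simps)
    have s5: "srun 12 M5 (c5 * (length z + 1)) [y, b, x, [], tl ?p, rev a, k, [], z, v, f, [e, m, var_value a ?w]]
        [y, b, x, [], tl ?p, rev a, k, [], [], v, f, [e, m, var_value a ?w]]"
      using M5[of "[y, b, x, [], tl ?p, rev a, k, [], z, v, f, [e, m, var_value a ?w]]"] by (simp add: stack_simps)
    \<comment> \<open>The lookup has left the assignment reversed on stack 5; draining brings it
      back into place.\<close>
    have s6: "srun 12 M6 (c6 * (length a + 1)) [y, b, x, [], tl ?p, rev a, k, [], [], v, f, [e, m, var_value a ?w]]
        [y, b, x, a, tl ?p, [], k, [], [], v, f, [e, m, var_value a ?w]]"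
      using M6[of "[y, b, x, [], tl ?p, rev a, k, [], [], v, f, [e, m, var_value a ?w]]"] by (simp add: stack_simps)
    have s7: "srun 12 M7 c7 [y, b, x, a, tl ?p, [], k, [], [], v, f, [e, m, var_value a ?w]]
        [y, b, x, a, tl ?p, [], True # var_value a ?w # k, [], [], v, f, []]"
      using M7[of "[y, b, x, a, tl ?p, [], k, [], [], v, f, [e, m, var_value a ?w]]"] by (simp add: stack_simps)
    note run = srun_seqm[OF M1 srun_seqm[OF s2 srun_seqm[OF s3 srun_seqm[OF s4 srun_seqm[OF s5 srun_seqm[OF s6 s7]]]]]]
    have "c1 * (length p + 1) + (c2 + (length a * (c3 * (N + 1)) + 1 + (c4 * (length r + 1) +
        (c5 * (length z + 1) + (c6 * (length a + 1) + c7))))) \<le> C * (N + 1) ^ 2"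
    proof -
      let ?E = "(N + 1) ^ 2"
      have E: "1 \<le> ?E" "N + 1 \<le> ?E" by (simp_all add: power2_eq_square)
      have lin: "c * (l + 1) \<le> c * ?E" if "l \<le> N" for c l
        using that E(2) by (intro mult_left_mono) auto
      have const: "c \<le> c * ?E" for c using E(1) by simp
      have "length a * (c3 * (N + 1)) \<le> (N + 1) * (c3 * (N + 1))" using N by (intro mult_right_mono) auto
      then have "length a * (c3 * (N + 1)) \<le> c3 * ?E" by (simp only: power2_eq_square mult_ac)
      with lin[OF N(2), of c1] const[of c2] E(1) lin[of "length r" c4] lin[of "length z" c5] lin[OF N(1), of c6] const[of c7] rz
      show ?thesis by (simp only: C_def add_mult_distrib mult_1) linarith
    qed
    from srun_mono[OF run this] show ?thesis .
  qed
  then show ?thesis by blast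
qed

subsection \<open>Evaluating a formula\<close>

text \<open>The tokens are put on a stack, so that the evaluation meets the arguments of a connective
  before the connective.\<close>

function tokens :: "bool list \<Rightarrow> bool list \<Rightarrow> bool list \<Rightarrow> bool list" where
  "tokens a (False # b # p) k = tokens a p (False # False # b # k)"
| "tokens a (True # False # False # p) k = tokens a p (False # True # k)"
| "tokens a (True # False # True # b # p) k = tokens a p (True # b # k)"
| "tokens a (True # True # p) k =
     tokens a (tl (fst (split_var p []))) (True # var_value a (snd (split_var p [])) # k)"
| "tokens a [] k = k"
| "tokens a [False] k = k"
| "tokens a [True] k = k"
| "tokens a [True, False] k = k"
| "tokens a [True, False, True] k = k"
  by pat_completeness auto
termination
proof (relation "Wellfounded.measure (\<lambda>(a, p, k). length p)")
  fix a :: "bool list" and p :: "bool list" and k :: "bool list"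
  have "length (tl (fst (split_var p []))) \<le> length p"
    using length_split_var(1)[of p "[]"] by (simp add: le_trans[OF diff_le_self])
  then show "((a, tl (fst (split_var p [])), True # var_value a (snd (split_var p [])) # k), a, True # True # p, k)
      \<in> Wellfounded.measure (\<lambda>(a, p, k). length p)" by simp
qed auto

lemma length_tokens: "length (tokens a p k) \<le> length k + 2 * length p"
proof (induction a p k rule: tokens.induct)
  case (4 a p k)
  then show ?case using length_split_var(1)[of p "[]"] by simp
qed auto

definition token_step :: "bool list list \<Rightarrow> bool list list" where
  "token_step ts = (case ts ! 4 of
      False # b # p \<Rightarrow> ts[4 := p, 6 := False # False # b # ts ! 6]
    | True # False # False # p \<Rightarrow> ts[4 := p, 6 := False # True # ts ! 6]
    | True # False # True # b # p \<Rightarrow> ts[4 := p, 6 := True # b # ts ! 6]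
    | True # True # p \<Rightarrow> ts[4 := p, 11 := [True]]
    | _ \<Rightarrow> ts[4 := []])"

lemma length_token_step: "length (token_step ts) = length ts"
  by (simp add: token_step_def split: list.split bool.split)

lemma ex_tokens:
  "\<exists>M C. \<forall>y b x a p k v f N. length a \<le> N \<longrightarrow> length p \<le> N \<longrightarrow>
     srun 12 M (length p * (C * (N + 1) ^ 2) + 1) [y, b, x, a, p, [], k, [], [], v, f, []]
       [y, b, x, a, [], [], tokens a p k, [], [], v, f, []]"
proof -
  obtain M1 c1 where M1: "\<And>S. length S = 12 \<Longrightarrow> srun 12 M1 c1 S (rewrite 4 token_step S)"
    using ex_rewrite12[OF length_token_step] by blast
  obtain M2 c2 where M2: "\<And>y b x a p k v f N. length a \<le> N \<Longrightarrow> length p \<le> N \<Longrightarrow>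
     srun 12 M2 (c2 * (N + 1) ^ 2) [y, b, x, a, p, [], k, [], [], v, f, [True]]
       [y, b, x, a, tl (fst (split_var p [])), [], True # var_value a (snd (split_var p [])) # k, [], [], v, f, []]"
    using ex_var_value by blast
  have wf1: "wf_prog (Suc 12) M1" by (rule srun_wf[OF M1])
  have wf2: "wf_prog (Suc 12) M2" using M2[of "[]" 0 "[]"] by (simp add: srun_def)
  have wf3: "wf_prog (Suc 12) (skip 12)" by (rule srun_wf[OF srun_skip])
  let ?B = "seqm M1 (sif 12 (\<lambda>ts. ts ! 11 = Some True) M2 (skip 12))"
  let ?W = "swhile 12 (\<lambda>ts. ts ! 4 \<noteq> None) ?B"
  have wfB: "wf_prog (Suc 12) ?B" by (intro wf_seqm wf_sif wf1 wf2 wf3)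
  define C where "C = c1 + c2 + 3"
  have simple: "srun 12 ?B (c1 + (1 + 1)) [y, b, x, a, p, [], k, [], [], v, f, []] [y, b, x, a, p', [], k', [], [], v, f, []]"
    if "rewrite 4 token_step [y, b, x, a, p, [], k, [], [], v, f, []] = [y, b, x, a, p', [], k', [], [], v, f, []]"
    for y b x a p k v f p' k'
  proof (rule srun_seqm)
    show "srun 12 M1 c1 [y, b, x, a, p, [], k, [], [], v, f, []] [y, b, x, a, p', [], k', [], [], v, f, []]"
      using M1[of "[y, b, x, a, p, [], k, [], [], v, f, []]"] that by simp
    show "srun 12 (sif 12 (\<lambda>ts. ts ! 11 = Some True) M2 (skip 12)) (1 + 1)
        [y, b, x, a, p', [], k', [], [], v, f, []] [y, b, x, a, p', [], k', [], [], v, f, []]"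
      by (rule srun_sif[OF wf2 wf3]) (simp add: tops_def srun_skip[unfolded One_nat_def])
  qed
  have cost1: "1 + (c1 + (1 + 1)) + (l * (C * (N + 1) ^ 2) + 1) \<le> l' * (C * (N + 1) ^ 2) + 1" if "Suc l \<le> l'" for l l' N
  proof -
    have "C \<le> C * (N + 1) ^ 2" by simp
    moreover have "Suc l * (C * (N + 1) ^ 2) \<le> l' * (C * (N + 1) ^ 2)" using that by (intro mult_right_mono) auto
    moreover have "c1 + 3 \<le> C" by (simp add: C_def)
    ultimately show ?thesis unfolding mult_Suc by linarith
  qed
  have loop: "srun 12 ?W (length p * (C * (N + 1) ^ 2) + 1) [y, b, x, a, p, [], k, [], [], v, f, []] R"
    if "rewrite 4 token_step [y, b, x, a, p, [], k, [], [], v, f, []] = [y, b, x, a, p', [], k', [], [], v, f, []]"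
      "srun 12 ?W (length p' * (C * (N + 1) ^ 2) + 1) [y, b, x, a, p', [], k', [], [], v, f, []] R"
      "length p' < length p" for y b x a p k v f p' k' N R
  proof -
    have "srun 12 ?W (1 + (c1 + (1 + 1)) + (length p' * (C * (N + 1) ^ 2) + 1)) [y, b, x, a, p, [], k, [], [], v, f, []] R"
      using that(3) by (intro srun_while_true[OF _ simple[OF that(1)] that(2)]) (auto simp: tops_def)
    then show ?thesis by (rule srun_mono[OF _ cost1]) (use that(3) in simp)
  qed
  have stop: "srun 12 ?W (length ([] :: bool list) * (C * (N + 1) ^ 2) + 1) [y, b, x, a, [], [], k, [], [], v, f, []]
      [y, b, x, a, [], [], k, [], [], v, f, []]" for y b x a k v f N
    using srun_while_false[OF wfB, of "[y, b, x, a, [], [], k, [], [], v, f, []]" "\<lambda>ts. ts ! 4 \<noteq> None"]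
    by (simp add: tops_def)
  have main: "srun 12 ?W (length p * (C * (N + 1) ^ 2) + 1) [y, b, x, a, p, [], k, [], [], v, f, []]
       [y, b, x, a, [], [], tokens a p k, [], [], v, f, []]"
    if "length a \<le> N" "length p \<le> N" for y b x a p k v f N
    using that
  proof (induction a p k rule: tokens.induct)
    case (1 a b' p k)
    show ?case unfolding tokens.simps by (rule loop[where p' = p and k' = "False # False # b' # k"])
      (use 1 in \<open>simp_all add: stack_simps token_step_def\<close>)
  next
    case (2 a p k)
    show ?case unfolding tokens.simps by (rule loop[where p' = p and k' = "False # True # k"])
      (use 2 in \<open>simp_all add: stack_simps token_step_def\<close>)
  next
    case (3 a b' p k)
    show ?case unfolding tokens.simps by (rule loop[where p' = p and k' = "True # b' # k"])
      (use 3 in \<open>simp_all add: stack_simps token_step_def\<close>)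
  next
    case (4 a p k)
    let ?p = "tl (fst (split_var p []))" and ?k = "True # var_value a (snd (split_var p [])) # k"
    let ?S = "[y, b, x, a, True # True # p, [], k, [], [], v, f, []]"
    have p: "length ?p \<le> length p" using length_split_var(1)[of p "[]"] by simp
    have "srun 12 M1 c1 ?S [y, b, x, a, p, [], k, [], [], v, f, [True]]"
      using M1[of ?S] by (simp add: stack_simps token_step_def)
    moreover have "srun 12 (sif 12 (\<lambda>ts. ts ! 11 = Some True) M2 (skip 12)) (1 + c2 * (N + 1) ^ 2)
        [y, b, x, a, p, [], k, [], [], v, f, [True]] [y, b, x, a, ?p, [], ?k, [], [], v, f, []]"
      using M2[of a N p] 4(2,3) by (intro srun_sif[OF wf2 wf3]) (simp add: tops_def)
    ultimately have "srun 12 ?B (c1 + (1 + c2 * (N + 1) ^ 2)) ?S [y, b, x, a, ?p, [], ?k, [], [], v, f, []]"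
      by (rule srun_seqm)
    moreover have "srun 12 ?W (length ?p * (C * (N + 1) ^ 2) + 1) [y, b, x, a, ?p, [], ?k, [], [], v, f, []]
        [y, b, x, a, [], [], tokens a ?p ?k, [], [], v, f, []]"
      using 4(2,3) p by (intro 4(1)) auto
    ultimately have "srun 12 ?W (1 + (c1 + (1 + c2 * (N + 1) ^ 2)) + (length ?p * (C * (N + 1) ^ 2) + 1)) ?S
        [y, b, x, a, [], [], tokens a (True # True # p) k, [], [], v, f, []]"
      unfolding tokens.simps by (intro srun_while_true) (simp_all add: tops_def)
    then show ?case
    proof (rule srun_mono)
      define E where "E = (N + 1) ^ 2"
      have arith: "1 + (c1 + (1 + u)) + (l + 1) \<le> r + 1" if "c1 + 3 \<le> s" "d + l \<le> r" "d = s + u"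
        for d l r s u :: nat
        using that by linarith
      have "Suc (length ?p) * (C * E) \<le> length (True # True # p) * (C * E)"
        using p by (intro mult_right_mono) auto
      then have "C * E + length ?p * (C * E) \<le> length (True # True # p) * (C * E)" by (simp only: mult_Suc)
      moreover have "C * E = (c1 + 3) * E + c2 * E" by (simp add: C_def algebra_simps)
      moreover have "(c1 + 3) * 1 \<le> (c1 + 3) * E" unfolding E_def by (intro mult_left_mono) auto
      then have "c1 + 3 \<le> (c1 + 3) * E" by (simp only: mult_1_right)
      ultimately show "1 + (c1 + (1 + c2 * (N + 1) ^ 2)) + (length ?p * (C * (N + 1) ^ 2) + 1)
          \<le> length (True # True # p) * (C * (N + 1) ^ 2) + 1"
        unfolding E_def[symmetric] by (intro arith)
    qed
  next
    case (5 a k)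
    then show ?case using stop by simp
  qed (rule loop[OF _ stop]; simp add: stack_simps token_step_def)+
  show ?thesis by (rule exI[of _ ?W], rule exI[of _ C], intro allI impI, rule main)
qed

text \<open>On the token stack, \<open>True # b\<close> is a value, \<open>False # True\<close> a
  negation and \<open>False # False # b\<close> a connective, disjunction iff \<open>b\<close>. The
  counter also runs through strings that are no codes, so missing values are tolerated.\<close>

fun eval_tokens :: "bool list \<Rightarrow> bool list \<Rightarrow> bool list" where
  "eval_tokens (True # b # k) v = eval_tokens k (b # v)"
| "eval_tokens (False # True # k) v = eval_tokens k (map Not (take 1 v) @ tl v)"
| "eval_tokens (False # False # b # k) v =
     eval_tokens k (take 1 (map2 (if b then (\<or>) else (\<and>)) v (tl v)) @ drop 2 v)"
| "eval_tokens [] v = v"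
| "eval_tokens [c] v = v"
| "eval_tokens [False, False] v = v"

definition eval_step :: "bool list list \<Rightarrow> bool list list" where
  "eval_step ts = (case ts ! 6 of
      True # b # k \<Rightarrow> ts[6 := k, 9 := b # ts ! 9]
    | False # True # k \<Rightarrow> ts[6 := k, 9 := map Not (take 1 (ts ! 9)) @ tl (ts ! 9)]
    | False # False # b # k \<Rightarrow> ts[6 := k, 9 := take 1 (map2 (if b then (\<or>) else (\<and>)) (ts ! 9) (tl (ts ! 9))) @ drop 2 (ts ! 9)]
    | _ \<Rightarrow> ts[6 := []])"

lemma length_eval_step: "length (eval_step ts) = length ts"
  by (simp add: eval_step_def split: list.split bool.split)

lemma length_eval_tokens: "length (eval_tokens k v) \<le> length k + length v"
  by (induction k v rule: eval_tokens.induct) auto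

lemma ex_eval_tokens:
  "\<exists>M c. \<forall>y b x a p q k w z v f g. srun 12 M (c * (length k + 1)) [y, b, x, a, p, q, k, w, z, v, f, g]
     [y, b, x, a, p, q, [], w, z, eval_tokens k v, f, g]"
proof -
  obtain M c where M: "\<And>S. length S = 12 \<Longrightarrow> srun 12 M c S (rewrite 4 eval_step S)"
    using ex_rewrite12[OF length_eval_step] by blast
  have wf: "wf_prog (Suc 12) M" by (rule srun_wf[OF M])
  let ?W = "swhile 12 (\<lambda>ts. ts ! 6 \<noteq> None) M"
  have loop: "srun 12 ?W ((c + 1) * (length k + 1)) [y, b, x, a, p, q, k, w, z, v, f, g] R"
    if "rewrite 4 eval_step [y, b, x, a, p, q, k, w, z, v, f, g] = [y, b, x, a, p, q, k', w, z, v', f, g]"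
      "srun 12 ?W ((c + 1) * (length k' + 1)) [y, b, x, a, p, q, k', w, z, v', f, g] R"
      "length k' < length k" for y b x a p q k w z v f g k' v' R
  proof -
    have "srun 12 M c [y, b, x, a, p, q, k, w, z, v, f, g] [y, b, x, a, p, q, k', w, z, v', f, g]"
      using M[of "[y, b, x, a, p, q, k, w, z, v, f, g]"] that(1) by simp
    moreover have "k \<noteq> []" using that(3) by auto
    ultimately have run: "srun 12 ?W (1 + c + (c + 1) * (length k' + 1)) [y, b, x, a, p, q, k, w, z, v, f, g] R"
      using that(2) by (intro srun_while_true) (simp_all add: tops_def)
    have "(c + 1) * (Suc (length k') + 1) \<le> (c + 1) * (length k + 1)" using that(3) by (intro mult_left_mono) auto
    then show ?thesis by (intro srun_mono[OF run]) simp
  qed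
  have stop: "srun 12 ?W ((c + 1) * (length ([] :: bool list) + 1)) [y, b, x, a, p, q, [], w, z, v, f, g]
      [y, b, x, a, p, q, [], w, z, v, f, g]" for y b x a p q w z v f g
    by (rule srun_mono[OF srun_while_false[OF wf]]) (simp_all add: tops_def)
  have main: "srun 12 ?W ((c + 1) * (length k + 1)) [y, b, x, a, p, q, k, w, z, v, f, g]
     [y, b, x, a, p, q, [], w, z, eval_tokens k v, f, g]" for y b x a p q k w z v f g
  proof (induction k v rule: eval_tokens.induct)
    case (1 b' k v)
    then show ?case unfolding eval_tokens.simps by (rule loop[rotated]) (simp_all add: stack_simps eval_step_def)
  next
    case (2 k v)
    then show ?case unfolding eval_tokens.simps
      by (rule loop[rotated]) (cases v; simp add: stack_simps eval_step_def)+
  next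
    case (3 b' k v)
    have "rewrite 4 eval_step [y, b, x, a, p, q, False # False # b' # k, w, z, v, f, g]
        = [y, b, x, a, p, q, k, w, z, take 1 (map2 (if b' then (\<or>) else (\<and>)) v (tl v)) @ drop 2 v, f, g]"
      by (cases v; cases "tl v") (simp_all add: stack_simps eval_step_def)
    from loop[OF this 3] show ?case by simp
  next
    case (4 v)
    then show ?case using stop by simp
  next
    case (5 b' v)
    show ?case unfolding eval_tokens.simps by (rule loop[OF _ stop]) (cases b'; simp add: stack_simps eval_step_def)+
  next
    case (6 v)
    show ?case unfolding eval_tokens.simps by (rule loop[OF _ stop]) (simp_all add: stack_simps eval_step_def)
  qed
  show ?thesis by (rule exI[of _ ?W], rule exI[of _ "c + 1"], intro allI, rule main)
qed

definition eval_code :: "bool list \<Rightarrow> bool list \<Rightarrow> bool" where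
  "eval_code x a \<longleftrightarrow> take 1 (eval_tokens (tokens a x []) []) = [True]"

lemma ex_eval_code:
  "\<exists>M C. \<forall>y b x a f N. length a \<le> N \<longrightarrow> length x \<le> N \<longrightarrow>
     srun 12 M (C * (N + 1) ^ 3) [y, b, x, a, [], [], [], [], [], [], f, []]
       [y, b, x, a, [], [], [], [], [], eval_tokens (tokens a x []) [], f, []]"
proof -
  obtain M1 c1 where M1: "\<And>S. length S = 12 \<Longrightarrow> srun 12 M1 (c1 * (length (S ! 2) + 1)) S (drained 2 (push_on {8}) S)"
    using ex_drain12[of 2 "push_on {8}"] by auto
  obtain M2 c2 where M2: "\<And>S. length S = 12 \<Longrightarrow> srun 12 M2 (c2 * (length (S ! 8) + 1)) S (drained 8 (push_on {2, 4}) S)"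
    using ex_drain12[of 8 "push_on {2, 4}"] by auto
  obtain M3 c3 where M3: "\<And>y b x a p k v f N. length a \<le> N \<Longrightarrow> length p \<le> N \<Longrightarrow>
     srun 12 M3 (length p * (c3 * (N + 1) ^ 2) + 1) [y, b, x, a, p, [], k, [], [], v, f, []]
       [y, b, x, a, [], [], tokens a p k, [], [], v, f, []]"
    using ex_tokens by blast
  obtain M4 c4 where M4: "\<And>y b x a p q k w z v f g. srun 12 M4 (c4 * (length k + 1)) [y, b, x, a, p, q, k, w, z, v, f, g]
     [y, b, x, a, p, q, [], w, z, eval_tokens k v, f, g]"
    using ex_eval_tokens by blast
  define C where "C = c1 + c2 + (c3 + 1) + 2 * c4"
  have "srun 12 (seqm M1 (seqm M2 (seqm M3 M4))) (C * (N + 1) ^ 3) [y, b, x, a, [], [], [], [], [], [], f, []]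
       [y, b, x, a, [], [], [], [], [], eval_tokens (tokens a x []) [], f, []]"
    if N: "length a \<le> N" "length x \<le> N" for y b x a f N
  proof -
    have s1: "srun 12 M1 (c1 * (length x + 1)) [y, b, x, a, [], [], [], [], [], [], f, []]
        [y, b, [], a, [], [], [], [], rev x, [], f, []]"
      using M1[of "[y, b, x, a, [], [], [], [], [], [], f, []]"] by (simp add: stack_simps)
    \<comment> \<open>The second drain restores \<open>x\<close> on stack 2 and at the same time
      puts the copy that is going to be consumed on stack 4.\<close>
    have s2: "srun 12 M2 (c2 * (length x + 1)) [y, b, [], a, [], [], [], [], rev x, [], f, []]
        [y, b, x, a, x, [], [], [], [], [], f, []]"
      using M2[of "[y, b, [], a, [], [], [], [], rev x, [], f, []]"] by (simp add: stack_simps)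
    note run = srun_seqm[OF s1 srun_seqm[OF s2 srun_seqm[OF M3[OF N] M4]]]
    have "c1 * (length x + 1) + (c2 * (length x + 1) + (length x * (c3 * (N + 1) ^ 2) + 1 +
        c4 * (length (tokens a x []) + 1))) \<le> C * (N + 1) ^ 3"
    proof -
      define E where "E = (N + 1) ^ 3"
      have N3: "N + 1 \<le> E" unfolding E_def by (rule self_le_power) auto
      then have E: "1 \<le> E" by linarith
      have lin: "c * (length x + 1) \<le> c * E" for c using N(2) N3 by (intro mult_left_mono) auto
      have "length x * (c3 * (N + 1) ^ 2) \<le> (N + 1) * (c3 * (N + 1) ^ 2)" using N by (intro mult_right_mono) auto
      also have "\<dots> = c3 * E" by (simp only: E_def power3_eq_cube power2_eq_square mult_ac)
      finally have "length x * (c3 * (N + 1) ^ 2) \<le> c3 * E" .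
      moreover have "c4 * (length (tokens a x []) + 1) \<le> c4 * (2 * E)"
        using length_tokens[of a x "[]"] N(2) N3 by (intro mult_left_mono) auto
      moreover have "C * E = c1 * E + (c2 * E + (c3 * E + E + c4 * (2 * E)))" by (simp add: C_def algebra_simps)
      ultimately show ?thesis
        unfolding E_def[symmetric] using lin[of c1] lin[of c2] E by linarith
    qed
    from srun_mono[OF run this] show ?thesis .
  qed
  then show ?thesis by blast
qed

text \<open>Binary counters, least significant bit first; the first argument and result are carries.\<close>

fun inc :: "bool \<Rightarrow> bool list \<Rightarrow> bool \<times> bool list" where
  "inc False xs = (False, xs)"
| "inc True [] = (True, [])"
| "inc True (False # xs) = (False, True # xs)"
| "inc True (True # xs) = (fst (inc True xs), False # snd (inc True xs))"

lemma length_inc [simp]: "length (snd (inc c xs)) = length xs"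
  by (induction c xs rule: inc.induct) auto

text \<open>The form in which the machine works: the ones before the first zero pass as zeros to the
  scratch stack, then that zero becomes a one. The carry leaves iff there is no zero.\<close>

lemma inc_eq:
  "inc True xs = (dropWhile id xs = [],
     replicate (length (takeWhile id xs)) False @ map (\<lambda>_. True) (take 1 (dropWhile id xs)) @ tl (dropWhile id xs))"
proof (induction xs)
  case (Cons x xs)
  then show ?case by (cases x) auto
qed simp

text \<open>On top of the flags the incoming carry is replaced by the outgoing one. Thus
  incrementing stack 3 and then stack 2 advances the joint counter of assignment and
  formula.\<close>

lemma ex_inc:
  assumes j: "j \<in> {2, 3}"
  shows "\<exists>M c. \<forall>S cy F. length S = 12 \<longrightarrow> S ! 8 = [] \<longrightarrow> S ! 10 = cy # F \<longrightarrow>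
     srun 12 M (c * (length (S ! j) + 1)) S
       (S[j := snd (inc cy (S ! j)), 10 := fst (inc cy (S ! j)) # F])"
proof -
  define g1 where "g1 ts = ts[j := tl (ts ! j), 8 := False # ts ! 8]" for ts :: "bool list list"
  define g2 where "g2 ts = (if hd (ts ! 10) \<and> ts ! j \<noteq> [] then ts[j := True # tl (ts ! j), 10 := False # tl (ts ! 10)] else ts)"
    for ts :: "bool list list"
  obtain M1 c1 where M1: "\<And>S. length S = 12 \<Longrightarrow> srun 12 M1 c1 S (rewrite 4 g1 S)"
    using ex_rewrite12[of g1] by (auto simp: g1_def)
  obtain M2 c2 where M2: "\<And>S. length S = 12 \<Longrightarrow> srun 12 M2 c2 S (rewrite 4 g2 S)"
  proof (rule ex_rewrite12)
    show "length (g2 ts) = length ts" for ts by (simp add: g2_def)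
  qed (rule that)
  obtain M3 c3 where M3: "\<And>S. length S = 12 \<Longrightarrow> srun 12 M3 (c3 * (length (S ! 8) + 1)) S (drained 8 (push_on {j}) S)"
    using ex_drain12[of 8 "push_on {j}"] by auto
  let ?W = "swhile 12 (\<lambda>ts. ts ! 10 = Some True \<and> ts ! j = Some True) M1"
  have wf1: "wf_prog (Suc 12) M1" by (rule srun_wf[OF M1])
  have j12: "j < 12" "j \<noteq> 8" "j \<noteq> 10" using j by auto
  have loop: "srun 12 ?W (length xs * (c1 + 1) + 1) S
      (S[j := dropWhile id xs, 8 := replicate (length (takeWhile id xs)) False @ S ! 8])"
    if "length S = 12" "S ! 10 = True # F" "S ! j = xs" for S F xs
    using that
  proof (induction xs arbitrary: S)
    case Nil
    then have "S[j := dropWhile id [], 8 := replicate (length (takeWhile id [])) False @ S ! 8] = S"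
      using j12 by (metis dropWhile.simps(1) length_0_conv list_update_id replicate_0 self_append_conv2 takeWhile.simps(1))
    moreover have "srun 12 ?W 1 S S" using Nil j12 by (intro srun_while_false wf1) (simp_all add: tops_def)
    ultimately show ?case by simp
  next
    case (Cons x xs)
    show ?case
    proof (cases x)
      case True
      let ?S = "S[j := xs, 8 := False # S ! 8]"
      have "rewrite 4 g1 S = ?S"
        using Cons.prems True j12 by (intro nth_equalityI) (auto simp: rewrite_def g1_def nth_list_update)
      then have "srun 12 M1 c1 S ?S" using M1[OF Cons.prems(1)] by simp
      moreover have "srun 12 ?W (length xs * (c1 + 1) + 1) ?S
          (?S[j := dropWhile id xs, 8 := replicate (length (takeWhile id xs)) False @ ?S ! 8])"
        using Cons.prems j12 by (intro Cons.IH) auto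
      moreover have "?S[j := dropWhile id xs, 8 := replicate (length (takeWhile id xs)) False @ ?S ! 8] =
          S[j := dropWhile id (x # xs), 8 := replicate (length (takeWhile id (x # xs))) False @ S ! 8]"
        using True Cons.prems j12 by (intro nth_equalityI) (auto simp: nth_list_update replicate_app_Cons_same)
      ultimately have "srun 12 ?W (1 + c1 + (length xs * (c1 + 1) + 1)) S
          (S[j := dropWhile id (x # xs), 8 := replicate (length (takeWhile id (x # xs))) False @ S ! 8])"
        using Cons.prems True j12 by (intro srun_while_true) (simp_all add: tops_def)
      then show ?thesis by (rule srun_mono) simp
    next
      case False
      then have eq: "S[j := dropWhile id (x # xs), 8 := replicate (length (takeWhile id (x # xs))) False @ S ! 8] = S"
        using Cons.prems j12 list_update_id[of S j] list_update_id[of S 8] by simp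
      have "srun 12 ?W 1 S S"
        using Cons.prems False j12 by (intro srun_while_false wf1) (simp_all add: tops_def)
      then have "srun 12 ?W (length (x # xs) * (c1 + 1) + 1) S S" by (rule srun_mono) simp
      then show ?thesis unfolding eq .
    qed
  qed
  define C where "C = c1 + c2 + c3 + 2"
  have main: "srun 12 (seqm ?W (seqm M2 M3)) (C * (length (S ! j) + 1)) S
       (S[j := snd (inc cy (S ! j)), 10 := fst (inc cy (S ! j)) # F])"
    if S: "length S = 12" "S ! 8 = []" "S ! 10 = cy # F" for S cy F
  proof (cases cy)
    case True
    let ?xs = "S ! j"
    define d where "d = dropWhile id ?xs"
    define r where "r = replicate (length (takeWhile id ?xs)) False"
    let ?S1 = "S[j := d, 8 := r]"
    let ?S2 = "S[j := map (\<lambda>_. True) (take 1 d) @ tl d, 8 := r, 10 := (d = []) # F]"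
    have s1: "srun 12 ?W (length ?xs * (c1 + 1) + 1) S ?S1" using loop[OF S(1) _ refl] S True by (simp add: d_def r_def)
    have "rewrite 4 g2 ?S1 = ?S2"
      using S True j12
    proof (cases d)
      case Nil
      then have "g2 (map (take 4) ?S1) = map (take 4) ?S1" using S j12 by (simp add: g2_def)
      then have "rewrite 4 g2 ?S1 = ?S1" unfolding rewrite_def by (intro nth_equalityI) simp_all
      also have "\<dots> = ?S2"
        using Nil S(3) True j12 list_update_id[of "S[j := [], 8 := r]" 10] by simp
      finally show ?thesis .
    next
      case (Cons d0 d')
      then have G: "g2 (map (take 4) ?S1) = (map (take 4) ?S1)[j := True # take 3 d', 10 := False # take 3 F]"
        using S True j12 by (simp add: g2_def)
      show ?thesis
      proof (rule nth_equalityI)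
        show "length (rewrite 4 g2 ?S1) = length ?S2" unfolding rewrite_def G by simp
        fix i assume "i < length (rewrite 4 g2 ?S1)"
        then have i: "i < 12" using S unfolding rewrite_def G by simp
        have "rewrite 4 g2 ?S1 ! i = (map (take 4) ?S1)[j := True # take 3 d', 10 := False # take 3 F] ! i @ drop 4 (?S1 ! i)"
          using i S unfolding rewrite_def G by simp
        moreover consider "i = j" | "i = 8" | "i = 10" | "i \<noteq> j" "i \<noteq> 8" "i \<noteq> 10" by blast
        then have "(map (take 4) ?S1)[j := True # take 3 d', 10 := False # take 3 F] ! i @ drop 4 (?S1 ! i) = ?S2 ! i"
          by cases (use i S j12 True Cons in \<open>simp_all\<close>)
        ultimately show "rewrite 4 g2 ?S1 ! i = ?S2 ! i" by simp
      qed
    qed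
    moreover have "length ?S1 = 12" using S by simp
    ultimately have s2: "srun 12 M2 c2 ?S1 ?S2" using M2[of ?S1] by simp
    have "drained 8 (push_on {j}) ?S2 = S[j := snd (inc cy ?xs), 10 := fst (inc cy ?xs) # F]"
    proof (rule nth_equalityI)
      show "length (drained 8 (push_on {j}) ?S2) = length (S[j := snd (inc cy ?xs), 10 := fst (inc cy ?xs) # F])"
        by simp
      fix i assume "i < length (drained 8 (push_on {j}) ?S2)"
      then have i: "i < 12" using S(1) by simp
      consider "i = j" | "i = 8" | "i = 10" | "i \<noteq> j" "i \<noteq> 8" "i \<noteq> 10" by blast
      then show "drained 8 (push_on {j}) ?S2 ! i = S[j := snd (inc cy ?xs), 10 := fst (inc cy ?xs) # F] ! i"
        by cases (use i S j12 True in \<open>simp_all add: drained_def push_on_def inc_eq d_def r_def\<close>)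
    qed
    moreover have "length ?S2 = 12" "length (?S2 ! 8) = length (takeWhile id ?xs)" using S j12 by (simp_all add: r_def)
    ultimately have s3: "srun 12 M3 (c3 * (length (takeWhile id ?xs) + 1)) ?S2
        (S[j := snd (inc cy ?xs), 10 := fst (inc cy ?xs) # F])"
      using M3[of ?S2] by simp
    have "c3 * (length (takeWhile id ?xs) + 1) \<le> c3 * (length ?xs + 1)"
      using length_takeWhile_le[of id ?xs] by (intro mult_left_mono) auto
    moreover have "C * (length ?xs + 1) = length ?xs * (c1 + 1) + 1 + (c2 + c3 * (length ?xs + 1)) +
        (c1 + c2 * length ?xs + length ?xs + 1)"
      by (simp add: C_def algebra_simps)
    ultimately have "length ?xs * (c1 + 1) + 1 + (c2 + c3 * (length (takeWhile id ?xs) + 1)) \<le> C * (length ?xs + 1)"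
      by linarith
    from srun_mono[OF srun_seqm[OF s1 srun_seqm[OF s2 s3]] this] show ?thesis .
  next
    case False
    have s1: "srun 12 ?W 1 S S" using S False by (intro srun_while_false wf1) (simp_all add: tops_def)
    have "rewrite 4 g2 S = S"
      using S False by (intro nth_equalityI) (auto simp: rewrite_def g2_def)
    then have s2: "srun 12 M2 c2 S S" using M2[OF S(1)] by simp
    have "drained 8 (push_on {j}) S = S"
      using S by (intro nth_equalityI) (auto simp: drained_def)
    then have s3: "srun 12 M3 c3 S S" using M3[OF S(1)] S(2) by simp
    have "S[j := snd (inc cy (S ! j)), 10 := fst (inc cy (S ! j)) # F] = S"
      using S False by (simp add: list_update_same_conv)
    moreover have "1 + (c2 + c3) \<le> C * (length (S ! j) + 1)" by (simp add: C_def)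
    ultimately show ?thesis using srun_mono[OF srun_seqm[OF s1 srun_seqm[OF s2 s3]]] by simp
  qed
  show ?thesis by (rule exI[of _ "seqm ?W (seqm M2 M3)"], rule exI[of _ C], intro allI impI, rule main)
qed

subsection \<open>The table\<close>

text \<open>\<open>acc\<close> is the conjunction of the values of \<open>x\<close> under the assignments before \<open>a\<close>.\<close>

fun table_run :: "bool list \<Rightarrow> bool list \<Rightarrow> bool list \<Rightarrow> bool \<Rightarrow> bool \<Rightarrow> bool \<Rightarrow> bool" where
  "table_run [] x a acc bad dn \<longleftrightarrow> \<not> bad \<and> dn"
| "table_run (\<beta> # b) x a acc bad dn \<longleftrightarrow>
     (let acc1 = acc \<and> eval_code x a; c = fst (inc True a); c' = fst (inc c x)
      in table_run b (snd (inc c x)) (snd (inc True a)) (acc1 \<or> c) (bad \<or> \<beta> \<noteq> acc1 \<or> (c' \<and> b \<noteq> [])) (dn \<or> c'))"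

text \<open>\<open>u\<close> puts the carry 1 for \<open>a\<close> in front of the flags. An
  overflow of \<open>a\<close> makes \<open>acc\<close> true, which restarts the conjunction for the
  next formula. An overflow of \<open>x\<close> marks the last entry: any entry left over makes the
  table bad, and without this overflow the table is too short.\<close>

lemma ex_table_loop:
  "\<exists>M C. \<forall>y b x a acc bad dn N. length a \<le> N \<longrightarrow> length x \<le> N \<longrightarrow>
     (\<exists>x' a' acc' bad' dn'. srun 12 M (length b * (C * (N + 1) ^ 3) + 1)
         [y, b, x, a, [], [], [], [], [], [], [acc, bad, dn], []]
         [y, [], x', a', [], [], [], [], [], [], [acc', bad', dn'], []] \<and>
       table_run b x a acc bad dn = (\<not> bad' \<and> dn'))"
proof -
  define u where "u ts = (let e = (take 1 (ts ! 9) = [True]); acc = ts ! 10 ! 0 \<and> e in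
      ts[1 := tl (ts ! 1), 10 := [True, acc, ts ! 10 ! 1 \<or> take 1 (ts ! 1) \<noteq> [acc], ts ! 10 ! 2]])" for ts :: "bool list list"
  define u1 where "u1 ts = (let f = ts ! 10 in ts[10 := [f ! 0, f ! 1 \<or> f ! 0, f ! 2, f ! 3]])" for ts :: "bool list list"
  define u2 where "u2 ts = (let f = ts ! 10 in ts[10 := [f ! 1, f ! 2 \<or> (f ! 0 \<and> ts ! 1 \<noteq> []), f ! 3 \<or> f ! 0]])"
    for ts :: "bool list list"
  obtain M0 c0 where M0: "\<And>y b x a f N. length a \<le> N \<Longrightarrow> length x \<le> N \<Longrightarrow>
     srun 12 M0 (c0 * (N + 1) ^ 3) [y, b, x, a, [], [], [], [], [], [], f, []]
       [y, b, x, a, [], [], [], [], [], eval_tokens (tokens a x []) [], f, []]"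
    using ex_eval_code by blast
  obtain M1 c1 where M1: "\<And>S. length S = 12 \<Longrightarrow> srun 12 M1 c1 S (rewrite 4 u S)"
    using ex_rewrite12[of u] by (auto simp: u_def Let_def)
  obtain M2 c2 where M2: "\<And>S. length S = 12 \<Longrightarrow> srun 12 M2 (c2 * (length (S ! 9) + 1)) S (drained 9 (push_on {}) S)"
    using ex_drain12[of 9 "push_on {}"] by auto
  obtain M3 c3 where M3: "\<And>S cy F. length S = 12 \<Longrightarrow> S ! 8 = [] \<Longrightarrow> S ! 10 = cy # F \<Longrightarrow>
     srun 12 M3 (c3 * (length (S ! 3) + 1)) S (S[3 := snd (inc cy (S ! 3)), 10 := fst (inc cy (S ! 3)) # F])"
    using ex_inc[of 3] by blast
  obtain M4 c4 where M4: "\<And>S. length S = 12 \<Longrightarrow> srun 12 M4 c4 S (rewrite 4 u1 S)"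
    using ex_rewrite12[of u1] by (auto simp: u1_def Let_def)
  obtain M5 c5 where M5: "\<And>S cy F. length S = 12 \<Longrightarrow> S ! 8 = [] \<Longrightarrow> S ! 10 = cy # F \<Longrightarrow>
     srun 12 M5 (c5 * (length (S ! 2) + 1)) S (S[2 := snd (inc cy (S ! 2)), 10 := fst (inc cy (S ! 2)) # F])"
    using ex_inc[of 2] by blast
  obtain M6 c6 where M6: "\<And>S. length S = 12 \<Longrightarrow> srun 12 M6 c6 S (rewrite 4 u2 S)"
    using ex_rewrite12[of u2] by (auto simp: u2_def Let_def)
  let ?B = "seqm M0 (seqm M1 (seqm M2 (seqm M3 (seqm M4 (seqm M5 M6)))))"
  let ?W = "swhile 12 (\<lambda>ts. ts ! 1 \<noteq> None) ?B"
  define C where "C = c0 + c1 + 2 * c2 + c3 + c4 + c5 + c6 + 1"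
  have body: "srun 12 ?B ((c0 + c1 + 2 * c2 + c3 + c4 + c5 + c6) * (N + 1) ^ 3)
      [y, \<beta> # b, x, a, [], [], [], [], [], [], [acc, bad, dn], []]
      [y, b, snd (inc c x), snd (inc True a), [], [], [], [], [], [],
        [acc1 \<or> c, bad \<or> \<beta> \<noteq> acc1 \<or> (c' \<and> b \<noteq> []), dn \<or> c'], []]"
    if N: "length a \<le> N" "length x \<le> N" and acc1: "acc1 = (acc \<and> eval_code x a)"
      and c: "c = fst (inc True a)" "c' = fst (inc c x)"
    for y \<beta> b x a acc bad dn N acc1 c c'
  proof -
    let ?v = "eval_tokens (tokens a x []) []"
    have s1: "srun 12 M1 c1 [y, \<beta> # b, x, a, [], [], [], [], [], ?v, [acc, bad, dn], []]
        [y, b, x, a, [], [], [], [], [], ?v, [True, acc1, bad \<or> \<beta> \<noteq> acc1, dn], []]"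
      using M1[of "[y, \<beta> # b, x, a, [], [], [], [], [], ?v, [acc, bad, dn], []]"]
      by (simp add: stack_simps u_def Let_def acc1 eval_code_def take_map)
    have s2: "srun 12 M2 (c2 * (length ?v + 1)) [y, b, x, a, [], [], [], [], [], ?v, [True, acc1, bad \<or> \<beta> \<noteq> acc1, dn], []]
        [y, b, x, a, [], [], [], [], [], [], [True, acc1, bad \<or> \<beta> \<noteq> acc1, dn], []]"
      using M2[of "[y, b, x, a, [], [], [], [], [], ?v, [True, acc1, bad \<or> \<beta> \<noteq> acc1, dn], []]"]
      by (simp add: stack_simps)
    have s3: "srun 12 M3 (c3 * (length a + 1)) [y, b, x, a, [], [], [], [], [], [], [True, acc1, bad \<or> \<beta> \<noteq> acc1, dn], []]
        [y, b, x, snd (inc True a), [], [], [], [], [], [], [c, acc1, bad \<or> \<beta> \<noteq> acc1, dn], []]"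
      using M3[of "[y, b, x, a, [], [], [], [], [], [], [True, acc1, bad \<or> \<beta> \<noteq> acc1, dn], []]"]
      by (simp add: eval_nat_numeral c)
    have s4: "srun 12 M4 c4 [y, b, x, snd (inc True a), [], [], [], [], [], [], [c, acc1, bad \<or> \<beta> \<noteq> acc1, dn], []]
        [y, b, x, snd (inc True a), [], [], [], [], [], [], [c, acc1 \<or> c, bad \<or> \<beta> \<noteq> acc1, dn], []]"
      using M4[of "[y, b, x, snd (inc True a), [], [], [], [], [], [], [c, acc1, bad \<or> \<beta> \<noteq> acc1, dn], []]"]
      by (simp add: stack_simps u1_def Let_def)
    have s5: "srun 12 M5 (c5 * (length x + 1)) [y, b, x, snd (inc True a), [], [], [], [], [], [], [c, acc1 \<or> c, bad \<or> \<beta> \<noteq> acc1, dn], []]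
        [y, b, snd (inc c x), snd (inc True a), [], [], [], [], [], [], [c', acc1 \<or> c, bad \<or> \<beta> \<noteq> acc1, dn], []]"
      using M5[of "[y, b, x, snd (inc True a), [], [], [], [], [], [], [c, acc1 \<or> c, bad \<or> \<beta> \<noteq> acc1, dn], []]"]
      by (simp add: eval_nat_numeral c(2))
    have s6: "srun 12 M6 c6 [y, b, snd (inc c x), snd (inc True a), [], [], [], [], [], [], [c', acc1 \<or> c, bad \<or> \<beta> \<noteq> acc1, dn], []]
        [y, b, snd (inc c x), snd (inc True a), [], [], [], [], [], [],
          [acc1 \<or> c, bad \<or> \<beta> \<noteq> acc1 \<or> (c' \<and> b \<noteq> []), dn \<or> c'], []]"
      using M6[of "[y, b, snd (inc c x), snd (inc True a), [], [], [], [], [], [], [c', acc1 \<or> c, bad \<or> \<beta> \<noteq> acc1, dn], []]"]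
      by (simp add: stack_simps u2_def Let_def disj_ac)
    note run = srun_seqm[OF M0[OF N] srun_seqm[OF s1 srun_seqm[OF s2 srun_seqm[OF s3 srun_seqm[OF s4 srun_seqm[OF s5 s6]]]]]]
    define E where "E = (N + 1) ^ 3"
    have N3: "N + 1 \<le> E" unfolding E_def by (rule self_le_power) auto
    then have E: "1 \<le> E" by linarith
    have "length ?v + 1 \<le> 2 * E"
      using length_eval_tokens[of "tokens a x []" "[]"] length_tokens[of a x "[]"] N N3 by simp
    then have le2: "c2 * (length ?v + 1) \<le> c2 * (2 * E)" by (rule mult_left_mono) simp
    have le: "c * (l + 1) \<le> c * E" if "l \<le> N" for c l
      using that N3 by (intro mult_left_mono) auto
    note le35 = le[OF N(1), of c3] le[OF N(2), of c5]
    have le1: "c \<le> c * E" for c using E by simp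
    have "c0 * E + (c1 + (c2 * (length ?v + 1) + (c3 * (length a + 1) + (c4 + (c5 * (length x + 1) + c6)))))
        \<le> c0 * E + (c1 * E + (c2 * (2 * E) + (c3 * E + (c4 * E + (c5 * E + c6 * E)))))"
      by (intro add_mono order_refl le1 le2 le35)
    also have "\<dots> = (c0 + c1 + 2 * c2 + c3 + c4 + c5 + c6) * E" by (simp add: algebra_simps)
    finally show ?thesis using srun_mono[OF run] unfolding E_def by blast
  qed
  have wfB: "wf_prog (Suc 12) ?B" using srunD(3)[OF body[of "[]" 0 "[]", OF _ _ refl refl refl]] by simp
  have main: "\<exists>x' a' acc' bad' dn'. srun 12 ?W (length b * (C * (N + 1) ^ 3) + 1)
         [y, b, x, a, [], [], [], [], [], [], [acc, bad, dn], []]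
         [y, [], x', a', [], [], [], [], [], [], [acc', bad', dn'], []] \<and>
       table_run b x a acc bad dn = (\<not> bad' \<and> dn')"
    if "length a \<le> N" "length x \<le> N" for y b x a acc bad dn N
    using that
  proof (induction b arbitrary: x a acc bad dn)
    case Nil
    have "srun 12 ?W 1 [y, [], x, a, [], [], [], [], [], [], [acc, bad, dn], []] [y, [], x, a, [], [], [], [], [], [], [acc, bad, dn], []]"
      by (rule srun_while_false[OF wfB]) (simp_all add: tops_def)
    then have "srun 12 ?W (length ([] :: bool list) * (C * (N + 1) ^ 3) + 1)
        [y, [], x, a, [], [], [], [], [], [], [acc, bad, dn], []] [y, [], x, a, [], [], [], [], [], [], [acc, bad, dn], []]"
      by simp
    then show ?case unfolding table_run.simps by blast
  next
    case (Cons \<beta> b)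
    let ?acc1 = "acc \<and> eval_code x a" and ?c = "fst (inc True a)"
    let ?c' = "fst (inc ?c x)"
    have "length (snd (inc True a)) \<le> N" "length (snd (inc ?c x)) \<le> N" using Cons.prems by simp_all
    from Cons.IH[OF this, of "?acc1 \<or> ?c" "bad \<or> \<beta> \<noteq> ?acc1 \<or> (?c' \<and> b \<noteq> [])" "dn \<or> ?c'"]
    obtain x' a' acc' bad' dn' where
      run: "srun 12 ?W (length b * (C * (N + 1) ^ 3) + 1)
         [y, b, snd (inc ?c x), snd (inc True a), [], [], [], [], [], [],
           [?acc1 \<or> ?c, bad \<or> \<beta> \<noteq> ?acc1 \<or> (?c' \<and> b \<noteq> []), dn \<or> ?c'], []]
         [y, [], x', a', [], [], [], [], [], [], [acc', bad', dn'], []]"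
      and res: "table_run b (snd (inc ?c x)) (snd (inc True a)) (?acc1 \<or> ?c) (bad \<or> \<beta> \<noteq> ?acc1 \<or> (?c' \<and> b \<noteq> [])) (dn \<or> ?c')
        = (\<not> bad' \<and> dn')" by blast
    have "srun 12 ?W (1 + (c0 + c1 + 2 * c2 + c3 + c4 + c5 + c6) * (N + 1) ^ 3 + (length b * (C * (N + 1) ^ 3) + 1))
         [y, \<beta> # b, x, a, [], [], [], [], [], [], [acc, bad, dn], []]
         [y, [], x', a', [], [], [], [], [], [], [acc', bad', dn'], []]"
      by (rule srun_while_true[OF _ body[OF Cons.prems refl refl refl] run]) (simp add: tops_def)
    moreover have "1 + (c0 + c1 + 2 * c2 + c3 + c4 + c5 + c6) * (N + 1) ^ 3 + (length b * (C * (N + 1) ^ 3) + 1)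
        \<le> length (\<beta> # b) * (C * (N + 1) ^ 3) + 1"
    proof -
      define E where "E = (N + 1) ^ 3"
      have "1 \<le> E" by (simp add: E_def)
      then have "1 + (c0 + c1 + 2 * c2 + c3 + c4 + c5 + c6) * E \<le> C * E" by (simp add: C_def algebra_simps)
      then show ?thesis unfolding E_def[symmetric] by simp
    qed
    ultimately have "srun 12 ?W (length (\<beta> # b) * (C * (N + 1) ^ 3) + 1)
         [y, \<beta> # b, x, a, [], [], [], [], [], [], [acc, bad, dn], []]
         [y, [], x', a', [], [], [], [], [], [], [acc', bad', dn'], []]"
      by (rule srun_mono)
    moreover have "table_run (\<beta> # b) x a acc bad dn = (\<not> bad' \<and> dn')"
      unfolding table_run.simps Let_def by (rule res)
    ultimately show ?case by blast
  qed
  show ?thesis by (rule exI[of _ ?W], rule exI[of _ C], intro allI impI, rule main)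
qed

text \<open>Only the length of the witness \<open>y\<close> is used. It guesses k - k0 in unary, so
  that k \<ge> k0 needs no test.\<close>

definition table_check :: "nat \<Rightarrow> bool list \<Rightarrow> bool list \<Rightarrow> bool" where
  "table_check k0 b y \<longleftrightarrow>
     table_run b (replicate (length y + k0) False) (replicate (length y + k0) False) True False False"

lemma polytime_rel_table_check: "polytime_rel (table_check k0)"
proof -
  define g1 where "g1 ts = ts[2 := replicate k0 False @ ts ! 2, 3 := replicate k0 False @ ts ! 3, 10 := [True, False, False]]"
    for ts :: "bool list list"
  define g2 where "g2 ts = ts[10 := [\<not> ts ! 10 ! 1 \<and> ts ! 10 ! 2]]" for ts :: "bool list list"
  define h where "h x i = (if i \<in> {2, 3} then [False] else [])" for x :: bool and i :: nat
  obtain M1 c1 where M1: "\<And>S. length S = 12 \<Longrightarrow> srun 12 M1 c1 S (rewrite 4 g1 S)"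
    using ex_rewrite12[of g1] by (auto simp: g1_def)
  obtain M2 c2 where M2: "\<And>S. length S = 12 \<Longrightarrow> srun 12 M2 (c2 * (length (S ! 0) + 1)) S (drained 0 h S)"
    using ex_drain12[of 0 h] by auto
  obtain M3 c3 where M3: "\<And>y b x a acc bad dn N. length a \<le> N \<Longrightarrow> length x \<le> N \<Longrightarrow>
     (\<exists>x' a' acc' bad' dn'. srun 12 M3 (length b * (c3 * (N + 1) ^ 3) + 1)
         [y, b, x, a, [], [], [], [], [], [], [acc, bad, dn], []]
         [y, [], x', a', [], [], [], [], [], [], [acc', bad', dn'], []] \<and>
       table_run b x a acc bad dn = (\<not> bad' \<and> dn'))" using ex_table_loop by blast
  obtain M4 c4 where M4: "\<And>S. length S = 12 \<Longrightarrow> srun 12 M4 c4 S (rewrite 4 g2 S)"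
    using ex_rewrite12[of g2] by (auto simp: g2_def)
  let ?P = "seqm M1 (seqm M2 (seqm M3 M4))"
  \<comment> \<open>There are at most N entries, and each is evaluated in time cubic in the length N
    + k0 of the counters, up to constants.\<close>
  define T where "T N = c1 + (c2 * (N + 1) + (N * (c3 * (N + k0 + 1) ^ 3) + 1 + c4))" for N
  have prog: "\<exists>x a. srun 12 ?P (T (length b + length y)) [y, b, [], [], [], [], [], [], [], [], [], []]
      [[], [], x, a, [], [], [], [], [], [], [table_check k0 b y], []]" for b y
  proof -
    let ?k = "length y + k0" and ?N = "length b + length y"
    let ?z = "replicate ?k False"
    have s1: "srun 12 M1 c1 [y, b, [], [], [], [], [], [], [], [], [], []]
        [y, b, replicate k0 False, replicate k0 False, [], [], [], [], [], [], [True, False, False], []]"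
      using M1[of "[y, b, [], [], [], [], [], [], [], [], [], []]"] by (simp add: stack_simps g1_def)
    have s2: "srun 12 M2 (c2 * (length y + 1)) [y, b, replicate k0 False, replicate k0 False, [], [], [], [], [], [], [True, False, False], []]
        [[], b, ?z, ?z, [], [], [], [], [], [], [True, False, False], []]"
      using M2[of "[y, b, replicate k0 False, replicate k0 False, [], [], [], [], [], [], [True, False, False], []]"]
      by (simp add: stack_simps h_def replicate_add map_replicate_const)
    have "length ?z \<le> ?k" by simp
    from M3[OF this this, of b "[]" True False False] obtain x' a' acc' bad' dn' where
      s3: "srun 12 M3 (length b * (c3 * (?k + 1) ^ 3) + 1) [[], b, ?z, ?z, [], [], [], [], [], [], [True, False, False], []]
         [[], [], x', a', [], [], [], [], [], [], [acc', bad', dn'], []]"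
      and res': "table_run b ?z ?z True False False = (\<not> bad' \<and> dn')" by blast
    then have res: "table_check k0 b y = (\<not> bad' \<and> dn')" by (simp add: table_check_def)
    have s4: "srun 12 M4 c4 [[], [], x', a', [], [], [], [], [], [], [acc', bad', dn'], []]
        [[], [], x', a', [], [], [], [], [], [], [table_check k0 b y], []]"
      using M4[of "[[], [], x', a', [], [], [], [], [], [], [acc', bad', dn'], []]"]
      by (simp add: stack_simps g2_def res)
    have "c2 * (length y + 1) \<le> c2 * (?N + 1)" by (intro mult_left_mono) auto
    moreover have "length b * (c3 * (?k + 1) ^ 3) \<le> ?N * (c3 * (?N + k0 + 1) ^ 3)"
      by (intro mult_mono power_mono) auto
    ultimately have "c1 + (c2 * (length y + 1) + (length b * (c3 * (?k + 1) ^ 3) + 1 + c4)) \<le> T ?N"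
      unfolding T_def by linarith
    from srun_mono[OF srun_seqm[OF s1 srun_seqm[OF s2 srun_seqm[OF s3 s4]]] this] show ?thesis by blast
  qed
  let ?O1 = "prim 13 (\<lambda>\<rho> l. if l = 0 then (Some (\<rho> 11 = Some True), MoveRight) else (\<rho> l, Stay))"
  let ?O2 = "prim 13 (\<lambda>\<rho> l. (if l = 0 then None else \<rho> l, Stay))"
  let ?M = "seqm (copy_tape 13 0 2) (seqm ?P (seqm ?O1 ?O2))"
  have Suc_12: "Suc 12 = 13" by simp
  have wfP: "wf_prog 13 ?P"
    using prog[of "[]" "[]"] by (elim exE) (drule srunD(3), simp only: Suc_12)
  have wf: "wf_prog 13 ?M"
    by (rule wf_seqm[OF wf_copy_tape wf_seqm[OF wfP wf_seqm[OF wf_prim wf_prim]]]) simp_all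
  show ?thesis
    unfolding polytime_rel_def
  proof (rule polytime_if_runs[OF wf, of 2 "\<lambda>N. 4 * N + 6 + T N"])
    show "poly_bounded (\<lambda>N. 4 * N + 6 + T N)" unfolding T_def by (intro poly_bounded_intros)
    fix xs w assume "(xs, w) \<in> {([b, y], [table_check k0 b y]) | b y. True}"
    then obtain b y where xs: "xs = [b, y]" "w = [table_check k0 b y]" by blast
    let ?N = "length b + length y" and ?r = "table_check k0 b y"
    define \<sigma>0 where "\<sigma>0 = (\<lambda>j. tape_of (if j < 2 then [b, y] ! j else []))"
    \<comment> \<open>The witness stays on tape 1, which is stack 0, and the table has been copied
      to tape 2. Written from cell 0 on, both are stacks that end at their lengths; the blank tapes
      are empty stacks ending at 0.\<close>
    define E where "E j = (if j = 0 then int (length y) else if j = 1 then int (length b) else 0)" for j :: nat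
    let ?S = "[y, b, [], [], [], [], [], [], [], [], [], []]"
    have r1: "runs 13 (copy_tape 13 0 2) (4 * length b + 4) \<sigma>0 (\<sigma>0(2 := tape_of b))"
      by (rule runs_copy_tape) (auto simp: \<sigma>0_def)
    have eq: "(\<sigma>0(2 := tape_of b)) i = conf (tape_of b) E ?S i" if "i < 13" for i
    proof (cases i)
      case 0
      then show ?thesis by (simp add: \<sigma>0_def)
    next
      case (Suc j)
      with that have "j \<in> {0, 1, 2, 3, 4, 5, 6, 7, 8, 9, 10, 11}"
        unfolding insert_iff empty_iff by presburger
      then show ?thesis unfolding Suc by (auto simp: \<sigma>0_def E_def tape_of_stk)
    qed
    obtain x a where xa: "srun 12 ?P (T ?N) ?S [[], [], x, a, [], [], [], [], [], [], [?r], []]" using prog by blast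
    define \<sigma>2 where "\<sigma>2 = conf (tape_of b) E [[], [], x, a, [], [], [], [], [], [], [?r], []]"
    have r2: "runs 13 ?P (T ?N) (\<sigma>0(2 := tape_of b)) \<sigma>2"
      by (rule runs_cong[OF srunD(4)[OF xa, of "tape_of b" E, unfolded Suc_12]])
        (rule eq[symmetric], assumption, simp only: \<sigma>2_def)
    have \<sigma>2: "\<sigma>2 0 = tape_of b" "\<sigma>2 (Suc 10) = stk (E 10) [?r]"
      unfolding \<sigma>2_def conf_simps by simp_all
    define \<sigma>3 where "\<sigma>3 = \<sigma>2(0 := (1, (snd (tape_of b))(0 := Some ?r)))"
    have "reads 13 \<sigma>2 (Suc 10) = Some ?r" using \<sigma>2(2) by (simp del: Suc_numeral)
    then have rd11: "reads 13 \<sigma>2 11 = Some ?r" by simp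
    have r3: "runs 13 ?O1 1 \<sigma>2 \<sigma>3"
    proof (rule runs_prim, unfold rd11)
      fix i :: nat assume i: "i < 13"
      show "\<sigma>3 i = act (if i = 0 then (Some (Some ?r = Some True), MoveRight) else (reads 13 \<sigma>2 i, Stay)) (\<sigma>2 i)"
      proof (cases "i = 0")
        case True
        then show ?thesis by (simp add: \<sigma>3_def \<sigma>2(1) act_eq)
      next
        case False
        with i show ?thesis by (simp add: \<sigma>3_def)
      qed
    qed
    define \<sigma>4 where "\<sigma>4 = \<sigma>3(0 := (1, (snd (tape_of b))(0 := Some ?r, 1 := None)))"
    have r4: "runs 13 ?O2 1 \<sigma>3 \<sigma>4"
    proof (rule runs_prim)
      fix i :: nat assume i: "i < 13"
      show "\<sigma>4 i = act (if i = 0 then None else reads 13 \<sigma>3 i, Stay) (\<sigma>3 i)"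
      proof (cases "i = 0")
        case True
        then show ?thesis by (simp add: \<sigma>4_def \<sigma>3_def act_eq)
      next
        case False
        with i show ?thesis by (simp add: \<sigma>4_def)
      qed
    qed
    have "runs 13 ?M (4 * ?N + 6 + T ?N) \<sigma>0 \<sigma>4"
      by (rule runs_mono[OF runs_seqm[OF r1 runs_seqm[OF r2 runs_seqm[OF r3 r4]]]]) simp
    then show "length xs = 2 \<and> (\<exists>\<sigma>'. runs 13 ?M (4 * sum_list (map length xs) + 6 + T (sum_list (map length xs)))
        (\<lambda>j. tape_of (if j < 2 then xs ! j else [])) \<sigma>' \<and>
        (\<forall>j<length w. snd (\<sigma>' 0) (int j) = Some (w ! j)) \<and> snd (\<sigma>' 0) (int (length w)) = None)"
      unfolding xs by (intro conjI exI[of _ \<sigma>4]) (simp_all add: \<sigma>4_def \<sigma>0_def)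
  qed simp
qed

subsection \<open>Correctness of the evaluation\<close>

definition pairs :: "bool list \<Rightarrow> bool list" where
  "pairs v = concat (map (\<lambda>b. [True, b]) v)"

lemma pairs_simps [simp]: "pairs [] = []" "pairs (b # v) = True # b # pairs v"
  by (simp_all add: pairs_def)

lemma length_pairs [simp]: "length (pairs v) = 2 * length v"
  by (induction v) auto

lemma split_var_pairs: "split_var (pairs v @ False # s) w = (False # s, rev v @ w)"
  by (induction v arbitrary: w) auto

fun rev_tokens :: "(bool list \<Rightarrow> bool) \<Rightarrow> fm \<Rightarrow> bool list" where
  "rev_tokens e (FVar v) = [True, e v]"
| "rev_tokens e (FConst b) = [True, b]"
| "rev_tokens e (FNot A) = rev_tokens e A @ [False, True]"
| "rev_tokens e (FAnd A B) = rev_tokens e B @ rev_tokens e A @ [False, False, False]"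
| "rev_tokens e (FOr A B) = rev_tokens e B @ rev_tokens e A @ [False, False, True]"

lemma tokens_code:
  "tokens a (code A @ s) k = tokens a s (rev_tokens (\<lambda>v. var_value a (rev v)) A @ k)"
proof (induction A arbitrary: s k)
  case (FVar v)
  have "code (FVar v) @ s = True # True # pairs v @ False # s" by (simp add: pairs_def)
  then show ?case by (simp add: split_var_pairs)
qed simp_all

lemma eval_rev_tokens: "eval_tokens (rev_tokens e A @ k) v = eval_tokens k (fval e A # v)"
  by (induction A arbitrary: k v) simp_all

lemma eval_code_code: "eval_code (code A) a = fval (\<lambda>v. var_value a (rev v)) A"
  using tokens_code[of a A "[]" "[]"] eval_rev_tokens[of "\<lambda>v. var_value a (rev v)" A "[]" "[]"]
  by (simp add: eval_code_def)

text \<open>An assignment lists the names of the variables that are true; all others are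
  false.\<close>

definition encode_vars :: "bool list list \<Rightarrow> bool list" where
  "encode_vars vs = concat (map (\<lambda>v. pairs (rev v) @ [False]) vs)"

lemma lookup_entry:
  "lookup (pairs u @ False # a) r z m fd = lookup a (rev z @ r) [] True (fd \<or> (m \<and> r = u))"
proof (induction u arbitrary: r z m)
  case (Cons b u)
  show ?case
  proof (cases "r \<noteq> [] \<and> hd r = b")
    case True
    then obtain r' where "r = b # r'" by (cases r) auto
    then show ?thesis using Cons[of r' "b # z" m] by simp
  next
    case False
    then have "r \<noteq> b # u" by auto
    then show ?thesis
      using Cons[of r z False] unfolding pairs_simps append_Cons lookup.simps if_not_P[OF False] by simp
  qed
qed simp

text \<open>Entries end with a zero, so ones never complete an entry. The induction goes by two
  because \<open>lookup\<close> consumes the ones in pairs.\<close>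

lemma lookup_padding: "lookup (replicate n True) r z m fd = fd"
proof (induction n arbitrary: r z m rule: induct_nat_012)
  case (ge2 n)
  show ?case unfolding replicate_Suc lookup.simps ge2.IH(1) by simp
qed simp_all

lemma encode_vars_simps: "encode_vars [] = []" "encode_vars (v # vs) = pairs (rev v) @ False # encode_vars vs"
  by (simp_all add: encode_vars_def)

lemma lookup_encode_vars:
  "lookup (encode_vars vs @ replicate n True) w [] True fd \<longleftrightarrow> fd \<or> rev w \<in> set vs"
proof (induction vs arbitrary: fd)
  case Nil
  show ?case unfolding encode_vars_simps append_Nil lookup_padding by simp
next
  case (Cons v vs)
  have "lookup (encode_vars (v # vs) @ replicate n True) w [] True fd =
      lookup (encode_vars vs @ replicate n True) w [] True (fd \<or> (True \<and> w = rev v))"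
    unfolding encode_vars_simps append_assoc append_Cons lookup_entry rev.simps(1) append_Nil ..
  also have "\<dots> \<longleftrightarrow> (fd \<or> (True \<and> w = rev v)) \<or> rev w \<in> set vs" by (rule Cons.IH)
  finally show ?case by (simp add: rev_swap)
qed

fun vars :: "fm \<Rightarrow> bool list list" where
  "vars (FVar v) = [v]"
| "vars (FConst b) = []"
| "vars (FNot A) = vars A"
| "vars (FAnd A B) = vars A @ vars B"
| "vars (FOr A B) = vars A @ vars B"

lemma fval_cong: "(\<And>v. v \<in> set (vars A) \<Longrightarrow> e v = e' v) \<Longrightarrow> fval e A = fval e' A"
  by (induction A) auto

lemma length_encode_vars_code: "length (encode_vars (vars A)) \<le> length (code A)"
proof (induction A)
  case (FVar v)
  have "length (code (FVar v)) = 2 * length v + 3" by (simp flip: pairs_def)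
  then show ?case by (simp add: encode_vars_def)
qed (auto simp: encode_vars_def)

lemma length_encode_vars_filter: "length (encode_vars (filter P vs)) \<le> length (encode_vars vs)"
  by (induction vs) (auto simp: encode_vars_def)

text \<open>Every string is read as some assignment, which gives one direction. Conversely, the true
  variables of \<open>A\<close> fit into k bits, since an occurrence of v takes 2 |v| + 3 bits in
  the code and its entry only 2 |v| + 1.\<close>

lemma tautology_iff_eval_code:
  assumes k: "length (code A) = k"
  shows "tautology A \<longleftrightarrow> (\<forall>a\<in>strings k. eval_code (code A) a)"
proof
  assume "tautology A"
  then show "\<forall>a\<in>strings k. eval_code (code A) a" by (simp add: tautology_def eval_code_code)
next
  assume all: "\<forall>a\<in>strings k. eval_code (code A) a"
  show "tautology A"
    unfolding tautology_def
  proof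
    fix e
    \<comment> \<open>Only true variables that occur in \<open>A\<close> are listed; infinitely many
      others may be true under \<open>e\<close>.\<close>
    define vs where "vs = filter e (vars A)"
    define a where "a = encode_vars vs @ replicate (k - length (encode_vars vs)) True"
    have "length (encode_vars vs) \<le> k"
      using length_encode_vars_filter[of e "vars A"] length_encode_vars_code[of A] k by (simp add: vs_def)
    then have "a \<in> strings k" by (simp add: a_def strings_def)
    with all have "fval (\<lambda>v. var_value a (rev v)) A" by (simp add: eval_code_code)
    moreover have "var_value a (rev v) = e v" if "v \<in> set (vars A)" for v
      using that lookup_encode_vars[of vs _ "rev v" False] by (simp add: var_value_def a_def vs_def)
    ultimately show "fval e A" using fval_cong[of A "\<lambda>v. var_value a (rev v)" e] by simp
  qed
qed

subsection \<open>Correctness of the table check\<close>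

lemma length_bin [simp]: "length (bin d i) = d"
  by (simp add: bin_def)

lemma bin_0 [simp]: "bin 0 i = []"
  by (simp add: bin_def)

lemma bin_Suc: "bin (Suc d) i = odd i # bin d (i div 2)"
proof -
  have "bin (Suc d) i = bit i 0 # map (\<lambda>n. bit i (Suc n)) [0..<d]"
    by (simp add: bin_def map_upt_Suc del: upt_Suc)
  then show ?thesis by (simp add: bin_def bit_Suc bit_0)
qed

lemma bin_zero: "bin d 0 = replicate d False"
  by (induction d) (simp_all add: bin_Suc)

lemma ex_bin: "length u = d \<Longrightarrow> \<exists>i<2 ^ d. bin d i = u"
proof (induction d arbitrary: u)
  case (Suc d)
  then obtain b u' where u: "u = b # u'" "length u' = d" by (cases u) auto
  from Suc.IH[OF this(2)] obtain i where i: "i < 2 ^ d" "bin d i = u'" by blast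
  have "bin (Suc d) (2 * i + of_bool b) = u" using u i by (cases b) (auto simp: bin_Suc)
  moreover have "2 * i + of_bool b < 2 ^ Suc d" using i by (cases b) auto
  ultimately show ?case by blast
qed simp

lemma bin_split: "bin (k + l) i = bin k i @ bin l (i div 2 ^ k)"
  by (induction k arbitrary: i) (simp_all add: bin_Suc div_mult2_eq)

lemma bin_inj: "i < 2 ^ d \<Longrightarrow> j < 2 ^ d \<Longrightarrow> bin d i = bin d j \<Longrightarrow> i = j"
proof (induction d arbitrary: i j)
  case (Suc d)
  then have "odd i = odd j" "i div 2 = j div 2" by (auto simp: bin_Suc less_mult_imp_div_less)
  then show ?case by presburger
qed simp

lemma inc_bin:
  "fst (inc True (bin d i)) \<longleftrightarrow> 2 ^ d dvd Suc i" "snd (inc True (bin d i)) = bin d (Suc i)"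
proof (induction d arbitrary: i)
  case (Suc d)
  {
    case 1
    show ?case
    proof (cases "odd i")
      case True
      then have "Suc i = 2 * Suc (i div 2)" by presburger
      then have "2 ^ Suc d dvd Suc i \<longleftrightarrow> 2 ^ d dvd Suc (i div 2)"
        by (simp only: power_Suc nat_mult_dvd_cancel_disj) simp
      with True show ?thesis using Suc.IH(1)[of "i div 2"] by (simp add: bin_Suc)
    next
      case False
      then have "\<not> 2 ^ Suc d dvd Suc i" by (metis even_Suc dvd_trans dvd_triv_left power_Suc)
      with False show ?thesis by (simp add: bin_Suc)
    qed
  next
    case 2
    show ?case
    proof (cases "odd i")
      case True
      then have "Suc i div 2 = Suc (i div 2)" by presburger
      with True show ?thesis using Suc.IH(2)[of "i div 2"] by (simp add: bin_Suc)
    next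
      case False
      then have "Suc i div 2 = i div 2" by presburger
      with False show ?thesis by (simp add: bin_Suc)
    qed
  }
qed auto

text \<open>With the least significant bit first, the low half of the index is the assignment and
  the high half the formula.\<close>

definition table_entry :: "nat \<Rightarrow> nat \<Rightarrow> bool" where
  "table_entry k i \<longleftrightarrow> (\<forall>j\<le>i mod 2 ^ k. eval_code (bin k (i div 2 ^ k)) (bin k j))"

lemma table_run_bad: "\<not> table_run b x a acc True dn"
  by (induction b arbitrary: x a acc dn) (simp_all add: Let_def)

text \<open>The loop invariant at index i: the two stacks hold the halves of i, the accumulator is
  the conjunction over earlier assignments, and the end of the counter has not been passed.\<close>

lemma table_run_iff:
  assumes "i < 2 ^ (2 * k)"
  shows "table_run b (bin k (i div 2 ^ k)) (bin k i)
      (\<forall>j<i mod 2 ^ k. eval_code (bin k (i div 2 ^ k)) (bin k j)) bad False \<longleftrightarrow>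
    \<not> bad \<and> length b = 2 ^ (2 * k) - i \<and> (\<forall>j<length b. b ! j = table_entry k (i + j))"
  using assms
proof (induction b arbitrary: i bad)
  case Nil
  then show ?case by simp
next
  case (Cons \<beta> b)
  let ?m = "2 ^ k :: nat"
  let ?x = "bin k (i div ?m)" and ?c = "?m dvd Suc i"
  have m: "?m > 0" by simp
  \<comment> \<open>\<open>bin\<close> cuts off the higher bits, so the assignment half of the
    counter may be written \<open>bin k i\<close> without reducing i.\<close>
  have bink: "bin k i = bin k (i mod ?m)"
    using bin_def by (auto simp: bin_def bit_take_bit_iff simp flip: take_bit_eq_mod)
  have acc1: "((\<forall>j<i mod ?m. eval_code ?x (bin k j)) \<and> eval_code ?x (bin k i)) = table_entry k i"
    unfolding table_entry_def using bink by (auto simp: le_less)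
  have x: "snd (inc ?c ?x) = bin k (Suc i div ?m)"
  proof (cases ?c)
    case True
    then have "Suc i div ?m = Suc (i div ?m)" by (simp add: div_Suc dvd_eq_mod_eq_0)
    with True show ?thesis by (simp add: inc_bin)
  next
    case False
    then have "Suc i div ?m = i div ?m" by (simp add: div_Suc dvd_eq_mod_eq_0)
    with False show ?thesis by simp
  qed
  \<comment> \<open>The carry leaves the formula exactly when the whole counter of 2 k bits
    overflows. As i is below 2^(2 k), this happens at the last index only.\<close>
  have c': "fst (inc ?c ?x) \<longleftrightarrow> Suc i = 2 ^ (2 * k)"
  proof (cases ?c)
    case True
    then have "Suc i = Suc (i div ?m) * ?m" by (metis div_Suc dvd_div_mult_self dvd_eq_mod_eq_0)
    moreover have "fst (inc ?c ?x) \<longleftrightarrow> ?m dvd Suc (i div ?m)" using True by (simp add: inc_bin)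
    moreover have "?m dvd Suc (i div ?m) \<longleftrightarrow> ?m * ?m dvd Suc (i div ?m) * ?m"
      unfolding mult.commute[of "Suc (i div ?m)"] nat_mult_dvd_cancel_disj by simp
    ultimately have "fst (inc ?c ?x) \<longleftrightarrow> 2 ^ (2 * k) dvd Suc i" by (metis mult_2 power_add)
    also have "\<dots> \<longleftrightarrow> Suc i = 2 ^ (2 * k)"
      using Cons.prems by (metis Suc_leI dvd_imp_le dvd_refl le_antisym zero_less_Suc)
    finally show ?thesis .
  next
    case False
    then have "\<not> 2 ^ (2 * k) dvd Suc i" by (metis dvd_trans le_imp_power_dvd mult_2 le_add1)
    with False show ?thesis by auto
  qed
  \<comment> \<open>After an overflow of the assignment no assignment precedes the current one, and
    the empty conjunction is true.\<close>
  have acc2: "(table_entry k i \<or> ?c) = (\<forall>j<Suc i mod ?m. eval_code (bin k (Suc i div ?m)) (bin k j))"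
  proof (cases ?c)
    case False
    then have "Suc i mod ?m = Suc (i mod ?m)" "Suc i div ?m = i div ?m"
      by (auto simp: mod_Suc div_Suc dvd_eq_mod_eq_0)
    with False show ?thesis by (simp add: table_entry_def less_Suc_eq_le)
  qed auto
  have step: "table_run (\<beta> # b) ?x (bin k i) (\<forall>j<i mod ?m. eval_code ?x (bin k j)) bad False \<longleftrightarrow>
      table_run b (bin k (Suc i div ?m)) (bin k (Suc i))
        (\<forall>j<Suc i mod ?m. eval_code (bin k (Suc i div ?m)) (bin k j))
        (bad \<or> \<beta> \<noteq> table_entry k i \<or> (Suc i = 2 ^ (2 * k) \<and> b \<noteq> [])) (Suc i = 2 ^ (2 * k))"
    unfolding table_run.simps Let_def acc1 inc_bin x c' acc2 by simp
  show ?case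
  proof (cases "Suc i = 2 ^ (2 * k)")
    case True
    have 1: "2 ^ (2 * k) - i = 1" unfolding True[symmetric] by simp
    have T: "(Suc i = 2 ^ (2 * k)) = True" using True by simp
    show ?thesis
    proof (cases "b = []")
      case b: True
      show ?thesis unfolding step T 1 unfolding b by simp
    next
      case b: False
      then have "table_run b x a acc (bad \<or> \<beta> \<noteq> table_entry k i \<or> (True \<and> b \<noteq> [])) dn = False" for x a acc dn
        using table_run_bad by simp
      moreover have "length (\<beta> # b) \<noteq> 1" using b by simp
      ultimately show ?thesis unfolding step T 1 by simp
    qed
  next
    case False
    then have F: "(Suc i = 2 ^ (2 * k)) = False" by simp
    from False Cons.prems have Si: "Suc i < 2 ^ (2 * k)" by linarith
    have len: "length (\<beta> # b) = 2 ^ (2 * k) - i \<longleftrightarrow> length b = 2 ^ (2 * k) - Suc i" using Si by auto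
    have all: "(\<forall>j<length (\<beta> # b). (\<beta> # b) ! j = table_entry k (i + j)) \<longleftrightarrow>
        \<beta> = table_entry k i \<and> (\<forall>j<length b. b ! j = table_entry k (Suc i + j))"
      by (simp add: All_less_Suc2)
    show ?thesis unfolding step F Cons.IH[OF Si] len all by blast
  qed
qed

lemma eq_map_upt_iff: "b = map f [0..<N] \<longleftrightarrow> length b = N \<and> (\<forall>j<length b. b ! j = f j)"
  by (auto intro: nth_equalityI)

lemma table_check_iff:
  "table_check k0 b y \<longleftrightarrow> b = map (table_entry (length y + k0)) [0..<2 ^ (2 * (length y + k0))]"
proof -
  let ?k = "length y + k0"
  have eq: "bin ?k (0 div 2 ^ ?k) = replicate ?k False" "bin ?k 0 = replicate ?k False"
    and acc: "(\<forall>j<0 mod 2 ^ ?k. eval_code (bin ?k (0 div 2 ^ ?k)) (bin ?k j)) = True"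
    by (simp_all add: bin_zero)
  have "table_check k0 b y \<longleftrightarrow> \<not> False \<and> length b = 2 ^ (2 * ?k) - 0 \<and> (\<forall>j<length b. b ! j = table_entry ?k (0 + j))"
    unfolding table_check_def by (rule table_run_iff[of 0 ?k b False, unfolded acc, unfolded eq]) simp
  then have "table_check k0 b y \<longleftrightarrow> length b = 2 ^ (2 * ?k) \<and> (\<forall>j<length b. b ! j = table_entry ?k j)"
    by (simp only: not_False_eq_True simp_thms diff_zero add_0)
  also have "\<dots> \<longleftrightarrow> b = map (table_entry ?k) [0..<2 ^ (2 * ?k)]"
    by (rule eq_map_upt_iff[symmetric])
  finally show ?thesis .
qed

definition tables :: "nat \<Rightarrow> bool list set" where
  "tables k0 = {b. \<exists>k\<ge>k0. b = map (table_entry k) [0..<2 ^ (2 * k)]}"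

text \<open>The witness in unary is short, because k is less than 2^(2 k), the length of the
  table.\<close>

lemma NP_set_tables: "NP_set (tables k0)"
  unfolding NP_set_def
proof (intro exI conjI allI)
  show "polytime_rel (table_check k0)" by (rule polytime_rel_table_check)
  fix b
  show "b \<in> tables k0 \<longleftrightarrow> (\<exists>y. length y \<le> length b ^ 1 + 1 \<and> table_check k0 b y)"
  proof
    assume "b \<in> tables k0"
    then obtain k where k: "k \<ge> k0" "b = map (table_entry k) [0..<2 ^ (2 * k)]" by (auto simp: tables_def)
    have "k < 2 ^ k" by (rule less_exp)
    also have "(2::nat) ^ k \<le> 2 ^ (2 * k)" by (intro power_increasing) auto
    finally have "k - k0 \<le> length b ^ 1 + 1" using k(2) by simp
    with k show "\<exists>y. length y \<le> length b ^ 1 + 1 \<and> table_check k0 b y"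
      by (intro exI[of _ "replicate (k - k0) False"]) (simp add: table_check_iff)
  next
    assume "\<exists>y. length y \<le> length b ^ 1 + 1 \<and> table_check k0 b y"
    then obtain y where "table_check k0 b y" by blast
    then show "b \<in> tables k0" unfolding table_check_iff tables_def
      by (intro CollectI exI[of _ "length y + k0"] conjI) simp_all
  qed
qed

lemma table_entry_tautology:
  assumes A: "length (code A) = k" and i: "bin (2 * k) i = ones k @ code A"
  shows "table_entry k i \<longleftrightarrow> tautology A"
proof -
  have "bin k i @ bin k (i div 2 ^ k) = ones k @ code A" using i bin_split[of k k i] by (simp add: mult_2)
  then have bins: "bin k i = ones k" "bin k (i div 2 ^ k) = code A" by simp_all
  \<comment> \<open>The assignment of ones is the last one before an overflow. Its index is 2^k - 1,
    so the conjunction in the entry is over all assignments.\<close>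
  have "fst (inc True (ones k))" by (induction k) auto
  then have "2 ^ k dvd Suc i" using inc_bin(1)[of k i] bins(1) by simp
  then have mod: "j \<le> i mod 2 ^ k \<longleftrightarrow> j < 2 ^ k" for j
    by (auto simp: dvd_eq_mod_eq_0 mod_Suc split: if_splits)
  have "(\<forall>j<2 ^ k. eval_code (code A) (bin k j)) \<longleftrightarrow> (\<forall>a\<in>strings k. eval_code (code A) a)"
  proof
    assume *: "\<forall>j<2 ^ k. eval_code (code A) (bin k j)"
    show "\<forall>a\<in>strings k. eval_code (code A) a"
    proof
      fix a assume "a \<in> strings k"
      then obtain j where "j < 2 ^ k" "bin k j = a" using ex_bin[of a k] by (auto simp: strings_def)
      with * show "eval_code (code A) a" by blast
    qed
  qed (simp add: strings_def)
  then show ?thesis unfolding table_entry_def mod bins(2) tautology_iff_eval_code[OF A] .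
qed

section \<open>Tautologies from a table in the range of the generator\<close>

text \<open>The block \<open>y\<close> of a Cert input may be longer than a witness. Only its first
  bits are tested, and any padding extends a witness to the required length.\<close>

lemma ex_preimage_check_iff:
  assumes bij: "\<And>l. bij_betw h (strings l) (strings l)" and q: "length u div 2 \<le> q"
  shows "(\<exists>y\<in>strings q. preimage_check h True u (take (length u div 2) y)) \<longleftrightarrow> gl_bit h u"
proof
  assume "\<exists>y\<in>strings q. preimage_check h True u (take (length u div 2) y)"
  then show "gl_bit h u" unfolding preimage_check_iff[OF bij] by blast
next
  let ?v = "inv_into (strings (length u div 2)) h (evens u)"
  assume "gl_bit h u"
  then have v: "preimage_check h True u ?v" unfolding preimage_check_iff[OF bij] by simp
  then have len: "length ?v = length u div 2" by (simp add: preimage_check_def)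
  have "take (length u div 2) (?v @ ones (q - length u div 2)) = ?v" using len by simp
  moreover have "?v @ ones (q - length u div 2) \<in> strings q" using len q by (simp add: strings_def)
  ultimately show "\<exists>y\<in>strings q. preimage_check h True u (take (length u div 2) y)"
    using v by (intro bexI[of _ "?v @ ones (q - length u div 2)"]) (simp_all only:)
qed

text \<open>Position p supplies bit t iff it belongs to \<open>J\<close> and exactly t elements of
  \<open>J\<close> precede it. This reduces selection to counting, which circuits can do even if
  \<open>J\<close> varies with the input.\<close>

lemma nth_nths:
  "t < length (nths z J) \<Longrightarrow>
   nths z J ! t \<longleftrightarrow> (\<exists>p<length z. z ! p \<and> p \<in> J \<and> length (filter (\<lambda>q. q \<in> J) [0..<p]) = t)"
proof (induction z arbitrary: t rule: rev_induct)
  case Nil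
  then show ?case by simp
next
  case (snoc a z)
  define cnt where "cnt p = length (filter (\<lambda>q. q \<in> J) [0..<p])" for p
  note IH = snoc.IH[folded cnt_def]
  have Suc: "cnt (Suc p) = cnt p + of_bool (p \<in> J)" for p by (simp add: cnt_def)
  have len: "length (nths z J) = cnt (length z)"
  proof (induction z rule: rev_induct)
    case (snoc a z)
    then show ?case by (simp only: nths_append length_append Suc length_Cons list.size add_0_right add_Suc_right nths_singleton)
        (simp add: Suc)
  qed (simp add: cnt_def)
  have mono: "cnt p \<le> cnt p'" if "p \<le> p'" for p p'
    by (rule lift_Suc_mono_le[OF _ that]) (simp add: Suc)
  have less: "cnt p < cnt (length z)" if "p < length z" "p \<in> J" for p
    using mono[of "Suc p" "length z"] that by (simp add: Suc)
  have eq: "(\<exists>p<length (z @ [a]). (z @ [a]) ! p \<and> p \<in> J \<and> cnt p = t) \<longleftrightarrow>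
      (\<exists>p<length z. z ! p \<and> p \<in> J \<and> cnt p = t) \<or> (a \<and> length z \<in> J \<and> cnt (length z) = t)"
    unfolding length_append_singleton Ex_less_Suc nth_append_length by (auto simp: nth_append cong: conj_cong)
  show ?case
    unfolding cnt_def[symmetric] eq
  proof (cases "t < cnt (length z)")
    case True
    then have "nths (z @ [a]) J ! t = nths z J ! t" by (simp add: nths_append nth_append len)
    also have "\<dots> \<longleftrightarrow> (\<exists>p<length z. z ! p \<and> p \<in> J \<and> cnt p = t)" by (rule IH) (simp add: len True)
    finally show "nths (z @ [a]) J ! t \<longleftrightarrow>
        (\<exists>p<length z. z ! p \<and> p \<in> J \<and> cnt p = t) \<or> (a \<and> length z \<in> J \<and> cnt (length z) = t)"
      using True by simp
  next
    case False
    have "length (nths (z @ [a]) J) = cnt (length z) + of_bool (length z \<in> J)"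
      by (simp add: nths_append len)
    with False snoc.prems have J: "length z \<in> J" "cnt (length z) = t" by (cases "length z \<in> J"; simp)+
    then have "nths (z @ [a]) J ! t = a" by (simp add: nths_append nth_append len)
    moreover have "cnt p \<noteq> t" if "p < length z" "p \<in> J" for p using less[OF that] J(2) by simp
    ultimately show "nths (z @ [a]) J ! t \<longleftrightarrow>
        (\<exists>p<length z. z ! p \<and> p \<in> J \<and> cnt p = t) \<or> (a \<and> length z \<in> J \<and> cnt (length z) = t)"
      using J by blast
  qed
qed

definition select_cost :: "nat \<Rightarrow> nat" where
  "select_cost n = n * (2 * (n * ((n + 2) * 2) + (n + 2)) + 6) + 1"

context encoded_domain
begin

lemma ext_nth_nths:
  assumes F: "(\<lambda>p x. char_vec m (J x) ! p) ` {..<m} \<subseteq> F"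
    and z: "length z = m" and t: "\<And>x. x \<in> X \<Longrightarrow> t < length (nths z (J x))" "t \<le> m"
  shows "ext (select_cost m) F {\<lambda>x. nths z (J x) ! t}"
proof -
  let ?g = "\<lambda>p x. char_vec m (J x) ! p"
  let ?fs = "\<lambda>p. map ?g [0..<p]"
  let ?c = "m * ((m + 2) * 2) + (m + 2)"
  have mem: "?g p \<in> F" if "p < m" for p by (rule subsetD[OF F], rule imageI) (use that in simp)
  have g: "ext 0 F {?g p}" if "p < m" for p
    by (rule ext_subset) (use mem[OF that] in simp)
  have th: "ext ?c F {at_least c (?fs p)}" if "p < m" "c \<le> m + 1" for p c
  proof -
    have "ext (length (?fs p) * 0 + (length (?fs p) * ((c + 1) * 2) + (c + 1))) F {at_least c (?fs p)}"
    proof (rule ext_threshold)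
      fix f assume "f \<in> set (?fs p)"
      then obtain q where "q < p" "f = ?g q" unfolding set_map set_upt by (elim imageE) simp
      with that g[of q] show "ext 0 F {f}" by simp
    qed
    then show ?thesis
    proof (rule ext_mono[OF _ _ order_refl order_refl])
      have "length (?fs p) * ((c + 1) * 2) \<le> m * ((m + 2) * 2)"
        using that by (intro mult_le_mono) simp_all
      then show "length (?fs p) * 0 + (length (?fs p) * ((c + 1) * 2) + (c + 1)) \<le> ?c"
        using that by linarith
    qed
  qed
  \<comment> \<open>Here \<open>z\<close> is constant and \<open>J x\<close> is given on wires. Two
    adjacent thresholds express that exactly t elements of \<open>J x\<close> lie below p.\<close>
  have "ext (m * ((1 + (0 + (?c + (?c + 1) + 1) + 1) + 1) + 1) + 1) F
      {\<lambda>x. \<exists>p\<in>{..<m}. z ! p \<and> ?g p x \<and> at_least t (?fs p) x \<and> \<not> at_least (t + 1) (?fs p) x}"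
  proof (rule ext_Bex[where I = "{..<m}", unfolded card_lessThan])
    fix p assume "p \<in> {..<m}"
    then have p: "p < m" by simp
    show "ext (1 + (0 + (?c + (?c + 1) + 1) + 1) + 1) F
      {\<lambda>x. z ! p \<and> ?g p x \<and> at_least t (?fs p) x \<and> \<not> at_least (t + 1) (?fs p) x}"
      using t(2) p by (intro ext_conj[OF ext_const ext_conj[OF g ext_conj[OF th ext_not[OF th]]]]) simp_all
  qed simp
  then have "ext (select_cost m) F
      {\<lambda>x. \<exists>p\<in>{..<m}. z ! p \<and> ?g p x \<and> at_least t (?fs p) x \<and> \<not> at_least (t + 1) (?fs p) x}"
    by (rule ext_mono[OF _ _ order_refl order_refl]) (simp add: select_cost_def algebra_simps)
  then show ?thesis
  proof (rule ext_cong1)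
    fix x assume x: "x \<in> X"
    have card: "length (filter (\<lambda>f. f x) (?fs p)) = length (filter (\<lambda>q. q \<in> J x) [0..<p])" if "p < m" for p
    proof -
      have "filter (\<lambda>q. ?g q x) [0..<p] = filter (\<lambda>q. q \<in> J x) [0..<p]"
        using that by (intro filter_cong refl) (auto simp: char_vec_def)
      then show ?thesis by (simp add: filter_map o_def)
    qed
    have "(z ! p \<and> ?g p x \<and> at_least t (?fs p) x \<and> \<not> at_least (t + 1) (?fs p) x) \<longleftrightarrow>
        (z ! p \<and> p \<in> J x \<and> length (filter (\<lambda>q. q \<in> J x) [0..<p]) = t)" if "p < m" for p
      unfolding at_least_def card[OF that] using that by (auto simp: char_vec_def)
    then show "(\<exists>p\<in>{..<m}. z ! p \<and> ?g p x \<and> at_least t (?fs p) x \<and> \<not> at_least (t + 1) (?fs p) x) =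
        nths z (J x) ! t"
      unfolding nth_nths[OF t(1)[OF x]] z by auto
  qed
qed

end

section \<open>The parameters of the generator\<close>

lemma nw_l_le: "nw_l n \<le> n"
proof (cases "n = 0")
  case False
  then have "real n powr (1 / 3) \<le> real n powr 1" by (intro powr_mono) auto
  then have "\<lfloor>real n powr (1 / 3)\<rfloor> \<le> \<lfloor>real n\<rfloor>" by (intro floor_mono) simp
  then show ?thesis by (simp add: nw_l_def)
qed (simp add: nw_l_def)

lemma nw_d_le: "\<delta> \<le> 1 / 3 \<Longrightarrow> nw_d \<delta> n \<le> n"
proof (cases "n = 0")
  case False
  assume "\<delta> \<le> 1 / 3"
  with False have "real n powr \<delta> \<le> real n powr 1" by (intro powr_mono) auto
  then have "\<lfloor>real n powr \<delta>\<rfloor> \<le> \<lfloor>real n\<rfloor>" by (intro floor_mono) simp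
  then show ?thesis by (simp add: nw_d_def)
qed (simp add: nw_d_def)

text \<open>Table lengths 2^(2 k) have to occur among the output lengths m(n). They do because
  n^\<delta> grows so slowly that rounding skips no value.\<close>

lemma ex_nw_d:
  assumes K: "K \<ge> 1" and \<delta>: "0 < \<delta>" "\<delta> \<le> 1 / 3"
  shows "\<exists>n\<ge>1. nw_d \<delta> n = K"
proof -
  define s where "s = 1 / \<delta>"
  define r where "r = real K powr s"
  define n where "n = nat \<lceil>r\<rceil>"
  have s: "s \<ge> 1" "\<delta> * s = 1" "s * \<delta> = 1" using \<delta> by (simp_all add: s_def field_simps)
  have r1: "r \<ge> 1" unfolding r_def using K s by (intro ge_one_powr_ge_zero) auto
  have n: "r \<le> real n" "real n < r + 1" using r1 by (simp_all add: n_def) linarith+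
  \<comment> \<open>Since s \<ge> 1, the powers K^s and (K + 1)^s differ by at least 1. Hence K^s,
    rounded up, is still below (K + 1)^s.\<close>
  have "real K powr s + 1 \<le> real (K + 1) powr s"
  proof -
    have split: "x powr s = x * x powr (s - 1)" if "x > 0" for x :: real
      using that by (simp add: powr_diff)
    have 1: "1 \<le> real K powr (s - 1)" using K s by (intro ge_one_powr_ge_zero) auto
    have 2: "real K powr (s - 1) \<le> real (K + 1) powr (s - 1)" using s by (intro powr_mono2) auto
    have "real K * real K powr (s - 1) + 1 \<le> real (K + 1) * real K powr (s - 1)"
      using 1 by (simp add: algebra_simps)
    also have "\<dots> \<le> real (K + 1) * real (K + 1) powr (s - 1)" using 2 by (intro mult_left_mono) auto
    finally show ?thesis using split[of "real K"] split[of "real (K + 1)"] K by simp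
  qed
  with n(2) have upper: "real n < real (K + 1) powr s" by (simp add: r_def)
  have "real n powr \<delta> < (real (K + 1) powr s) powr \<delta>"
    using upper \<delta> by (intro powr_less_mono2) auto
  also have "\<dots> = real (K + 1)" by (simp only: powr_powr s) simp
  finally have u: "real n powr \<delta> < real K + 1" by simp
  have "real K = r powr \<delta>" using K by (simp add: r_def powr_powr s)
  also have "\<dots> \<le> real n powr \<delta>" using n(1) r1 \<delta> by (intro powr_mono2) auto
  finally have "\<lfloor>real n powr \<delta>\<rfloor> = int K" using u by (intro floor_unique) auto
  moreover have "n \<ge> 1" using n(1) r1 by linarith
  ultimately show ?thesis by (intro exI[of _ n]) (simp add: nw_d_def)
qed

text \<open>For fixed \<delta> this bounds n by a polynomial in d, so that costs polynomial in n
  become polynomial in k.\<close>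

lemma less_nw_d_power:
  assumes "0 < \<delta>" "n \<ge> 1"
  shows "n < (nw_d \<delta> n + 1) ^ nat \<lceil>1 / \<delta>\<rceil>"
proof -
  let ?D = "real (nw_d \<delta> n + 1)"
  have "real n powr \<delta> < ?D" unfolding nw_d_def by simp linarith
  then have "(real n powr \<delta>) powr (1 / \<delta>) < ?D powr (1 / \<delta>)"
    using assms by (intro powr_less_mono2) auto
  moreover have "(real n powr \<delta>) powr (1 / \<delta>) = real n" using assms by (simp add: powr_powr)
  moreover have "?D powr (1 / \<delta>) \<le> ?D powr real (nat \<lceil>1 / \<delta>\<rceil>)"
    using assms by (intro powr_mono) auto
  moreover have "?D powr real (nat \<lceil>1 / \<delta>\<rceil>) = ?D ^ nat \<lceil>1 / \<delta>\<rceil>" by (intro powr_realpow) simp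
  ultimately have "real n < real ((nw_d \<delta> n + 1) ^ nat \<lceil>1 / \<delta>\<rceil>)" by simp
  then show ?thesis by (simp only: of_nat_less_iff)
qed

lemma infinite_tables:
  assumes "0 < \<delta>" "\<delta> \<le> 1 / 3"
  shows "infinite {b \<in> tables k0. \<exists>n\<ge>1. length b = nw_m \<delta> n}"
proof -
  define tb where "tb k = map (table_entry k) [0..<2 ^ (2 * k)]" for k
  have len: "length (tb k) = 2 ^ (2 * k)" for k by (simp add: tb_def)
  have "inj_on tb {Suc k0..}"
  proof (rule inj_onI)
    fix k k' assume "tb k = tb k'"
    then have "(2::nat) ^ (2 * k) = 2 ^ (2 * k')" by (metis len)
    then show "k = k'" by simp
  qed
  then have "infinite (tb ` {Suc k0..})" using finite_imageD infinite_Ici by blast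
  moreover have "tb ` {Suc k0..} \<subseteq> {b \<in> tables k0. \<exists>n\<ge>1. length b = nw_m \<delta> n}"
  proof (rule image_subsetI)
    fix k assume k: "k \<in> {Suc k0..}"
    then obtain n where "n \<ge> 1" "nw_d \<delta> n = 2 * k" using ex_nw_d[OF _ assms, of "2 * k"] by auto
    then have "\<exists>n\<ge>1. length (tb k) = nw_m \<delta> n" by (intro exI[of _ n]) (simp add: len nw_m_def)
    moreover have "tb k \<in> tables k0" using k unfolding tables_def tb_def by (intro CollectI exI[of _ k]) simp
    ultimately show "tb k \<in> {b \<in> tables k0. \<exists>n\<ge>1. length b = nw_m \<delta> n}" by blast
  qed
  ultimately show ?thesis using infinite_super by blast
qed

text \<open>Three stages: the design machine is simulated on the index that consists of ones and the
  formula, the bits of z at the resulting set are selected by counting, and the verifier is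
  simulated on them and a prefix of y. All costs are polynomial in n alone, so the exponent precedes
  n, k and z.\<close>

lemma ex_certificate_circuit:
  assumes A: "design_family A" and \<delta>: "0 < \<delta>" "\<delta> \<le> 1 / 3" and h: "polytime_rel (preimage_check h True)"
  shows "\<exists>e. \<forall>n\<ge>1. \<forall>k q s. \<forall>z\<in>strings n. nw_d \<delta> n = 2 * k \<and> nw_l n div 2 \<le> q \<and> (n + 2) ^ e \<le> s \<longrightarrow>
    (\<exists>D. is_circuit (k + q) 1 D \<and> csize D = s \<and>
      (\<forall>i<nw_m \<delta> n. \<forall>\<phi>\<in>strings k. \<forall>y\<in>strings q. bin (2 * k) i = ones k @ \<phi> \<longrightarrow>
        ceval D (\<phi> @ y) = [preimage_check h True (nths z (A \<delta> n i)) (take (nw_l n div 2) y)]))"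
proof -
  have design: "design (nw_d \<delta> n) (nw_l n) n (nw_m \<delta> n) (A \<delta> n)" if "n \<ge> 1" for n
    using A \<delta> that unfolding design_family_def by blast
  have "polytime {([bin (nw_d \<delta> n) i, ones n], char_vec n (A \<delta> n i)) | n i. n \<ge> 1 \<and> i < nw_m \<delta> n}"
    using A \<delta> unfolding design_family_def by blast
  then obtain M1 a1 where M1: "wf_tm M1" and
    out1: "\<forall>(xs, w)\<in>{([bin (nw_d \<delta> n) i, ones n], char_vec n (A \<delta> n i)) | n i. n \<ge> 1 \<and> i < nw_m \<delta> n}.
      length xs \<le> ntapes M1 \<and> outputs_within M1 xs w (sum_list (map length xs) ^ a1 + a1)"
    unfolding polytime_def by blast
  obtain M2 a2 where M2: "wf_tm M2" and
    out2: "\<forall>(xs, w)\<in>{([u, y], [preimage_check h True u y]) | u y. True}.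
      length xs \<le> ntapes M2 \<and> outputs_within M2 xs w (sum_list (map length xs) ^ a2 + a2)"
    using h unfolding polytime_rel_def polytime_def by blast
  define T1 where "T1 n = (nw_d \<delta> n + n) ^ a1 + a1" for n
  define T2 where "T2 n = (nw_l n + nw_l n div 2) ^ a2 + a2" for n
  \<comment> \<open>The cell bound of each simulation is its time plus its output length, which are
    n and 1. The extra 1 pays for the constant bits in the input of the design machine.\<close>
  define cost where "cost n = (1 + tm_cost M1 (T1 n) (T1 n + n)) + n * select_cost n +
    tm_cost M2 (T2 n) (T2 n + 1)" for n
  have "poly_bounded (nw_d \<delta>)" "poly_bounded nw_l" "poly_bounded (\<lambda>n. nw_l n div 2)"
    using nw_d_le[OF \<delta>(2)] nw_l_le by (auto intro!: poly_bounded_mono[OF poly_bounded_id] intro: order_trans[OF div_le_dividend])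
  then have "poly_bounded (\<lambda>n. (nw_d \<delta> n + n) ^ a1 + a1)"
    and "poly_bounded (\<lambda>n. (nw_l n + nw_l n div 2) ^ a2 + a2)"
    by (auto intro!: poly_bounded_power poly_bounded_add)
  then have "poly_bounded T1" "poly_bounded T2" unfolding T1_def T2_def by (simp_all only:)
  then have "poly_bounded cost"
    unfolding cost_def select_cost_def by (auto intro!: poly_bounded_tm_cost poly_bounded_add poly_bounded_mult poly_bounded_Suc)
  then obtain e where e: "cost n \<le> (n + 2) ^ e" for n unfolding poly_bounded_def by blast
  show ?thesis
  proof (intro exI[of _ e] allI ballI impI, elim conjE)
    fix n k q s z
    assume n: "1 \<le> n" and z: "z \<in> strings n" and k: "nw_d \<delta> n = 2 * k" and q: "nw_l n div 2 \<le> q"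
      and s: "(n + 2) ^ e \<le> s"
    let ?l = "nw_l n" and ?v = "nw_l n div 2"
    define X where "X = strings k \<times> strings q"
    define enc where "enc = (\<lambda>x :: bool list \<times> bool list. fst x @ snd x)"
    \<comment> \<open>As \<open>bin\<close> is injective below 2^(2 k), the index is determined by
      the formula part of the input, and the choice is harmless.\<close>
    define J where "J x = A \<delta> n (SOME i. i < 2 ^ (2 * k) \<and> bin (2 * k) i = ones k @ fst x)"
      for x :: "bool list \<times> bool list"
    have X: "length (fst x) = k" "length (snd x) = q" if "x \<in> X" for x
      using that by (auto simp: X_def strings_def)
    interpret encoded_domain "k + q" enc X
      by unfold_locales (simp add: enc_def X)
    have J: "\<exists>i<nw_m \<delta> n. bin (2 * k) i = ones k @ fst x \<and> J x = A \<delta> n i" if "x \<in> X" for x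
    proof -
      have "length (ones k @ fst x) = 2 * k" using X(1)[OF that] by simp
      from someI_ex[OF ex_bin[OF this]] show ?thesis unfolding J_def nw_m_def k by blast
    qed
    have J': "J x = A \<delta> n i" if "i < nw_m \<delta> n" "bin (2 * k) i = ones k @ fst x" for x i
    proof -
      have "(SOME i. i < 2 ^ (2 * k) \<and> bin (2 * k) i = ones k @ fst x) = i"
        using that bin_inj unfolding nw_m_def k by (intro some_equality) auto
      then show ?thesis by (simp add: J_def)
    qed
    have lenJ: "length (nths z (J x)) = ?l" if x: "x \<in> X" for x
    proof -
      obtain i where "i < nw_m \<delta> n" "J x = A \<delta> n i" using J[OF x] by blast
      then have Jx: "J x \<subseteq> {0..<n}" "card (J x) = ?l" using design[OF n] by (auto simp: design_def)
      then have "{i. i < length z \<and> i \<in> J x} = J x" using z by (auto simp: strings_def)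
      with Jx(2) show ?thesis by (simp add: length_nths)
    qed
    let ?F0 = "(\<lambda>i x. enc x ! i) ` {..<k + q}"
    let ?G = "(\<lambda>p x. char_vec n (J x) ! p) ` {..<n}"
    define xs where "xs x = [ones k @ fst x, ones n]" for x :: "bool list \<times> bool list"
    \<comment> \<open>The input bits of the design machine are bits of the formula or constant ones,
      so a single gate provides them all.\<close>
    define F1 where "F1 = {\<lambda>x. xs x ! j ! p | j p. j < 2 \<and> p < [2 * k, n] ! j}"
    define us where "us x = [nths z (J x), take ?v (snd x)]" for x :: "bool list \<times> bool list"
    define F2 where "F2 = {\<lambda>x. us x ! j ! p | j p. j < 2 \<and> p < [?l, ?v] ! j}"
    define U where "U = (\<Union>t\<in>{..<?l}. {\<lambda>x. nths z (J x) ! t})"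
    have enc1: "enc x ! p = fst x ! p" if "x \<in> X" "p < k" for x p
      using X[OF that(1)] that(2) by (simp add: enc_def nth_append)
    have enc2: "enc x ! (k + p) = snd x ! p" if "x \<in> X" for x p
      using X[OF that(1)] by (simp add: enc_def nth_append)
    have "ext 1 ?F0 F1"
    proof (rule ext_cong)
      have "ext (0 + 1) ?F0 (?F0 \<union> {\<lambda>x. True})" by (rule ext_Un[OF ext_subset[OF order_refl] ext_const])
      then show "ext 1 ?F0 (?F0 \<union> {\<lambda>x. True})" by (simp only: add_0)
      fix g assume "g \<in> F1"
      then obtain j p where jp: "j < 2" "p < [2 * k, n] ! j" and g: "g = (\<lambda>x. xs x ! j ! p)"
        unfolding F1_def mem_Collect_eq by (elim exE conjE)
      consider (bit) "j = 0" "p \<ge> k" "p < 2 * k" | (one) "j = 0" "p < k" | (one') "j = 1" "p < n"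
        using jp by (cases "p < k") (auto simp: less_2_cases_iff)
      then show "\<exists>g'\<in>?F0 \<union> {\<lambda>x. True}. \<forall>x\<in>X. g' x = g x"
      proof cases
        case bit
        have "\<forall>x\<in>X. enc x ! (p - k) = g x"
          using bit enc1[of _ "p - k"] unfolding g by (simp add: xs_def nth_append)
        moreover have "(\<lambda>x. enc x ! (p - k)) \<in> ?F0 \<union> {\<lambda>x. True}"
          using bit by (intro UnI1 imageI) simp
        ultimately show ?thesis by (intro bexI[where x = "\<lambda>x. enc x ! (p - k)"])
      next
        case one
        then have "\<forall>x\<in>X. True = g x" unfolding g by (simp add: xs_def nth_append)
        then show ?thesis by (intro bexI[where x = "\<lambda>x. True"] UnI2 singletonI)
      next
        case one'
        then have "\<forall>x\<in>X. True = g x" unfolding g by (simp add: xs_def)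
        then show ?thesis by (intro bexI[where x = "\<lambda>x. True"] UnI2 singletonI)
      qed
    qed
    moreover have "ext (tm_cost M1 (T1 n) (T1 n + n)) F1 ?G"
    proof (rule ext_tm[where xs = xs and Ls = "[2 * k, n]", OF M1])
      fix x assume x: "x \<in> X"
      show "map length (xs x) = [2 * k, n]" using X(1)[OF x] by (simp add: xs_def)
      obtain i where i: "i < nw_m \<delta> n" "bin (2 * k) i = ones k @ fst x" "J x = A \<delta> n i"
        using J[OF x] by blast
      have "([bin (nw_d \<delta> n) i, ones n], char_vec n (A \<delta> n i)) \<in>
          {([bin (nw_d \<delta> n) i, ones n], char_vec n (A \<delta> n i)) | n i. n \<ge> 1 \<and> i < nw_m \<delta> n}"
        using n i(1) by blast
      from bspec[OF out1 this] show "outputs_within M1 (xs x) (char_vec n (J x)) (T1 n) \<and> length (char_vec n (J x)) = n"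
        using X(1)[OF x] i by (simp add: xs_def k T1_def char_vec_def mult_2)
    next
      fix j p assume "j < length [2 * k, n]" "p < [2 * k, n] ! j"
      then show "(\<lambda>x. xs x ! j ! p) \<in> F1" unfolding F1_def mem_Collect_eq by (intro exI[of _ j] exI[of _ p]) simp
    qed simp_all
    ultimately have G: "ext (1 + tm_cost M1 (T1 n) (T1 n + n)) ?F0 ?G" by (rule ext_comp)
    have "ext (card {..<?l} * select_cost n) (?F0 \<union> ?G) U"
      unfolding U_def
    proof (rule ext_UN)
      fix t assume "t \<in> {..<?l}"
      then have t: "t < ?l" by simp
      show "ext (select_cost n) (?F0 \<union> ?G) {\<lambda>x. nths z (J x) ! t}"
      proof (rule ext_nth_nths)
        show "length z = n" using z by (simp add: strings_def)
        show "t \<le> n" using t nw_l_le[of n] by linarith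
        show "t < length (nths z (J x))" if "x \<in> X" for x using lenJ[OF that] t by simp
      qed (rule Un_upper2)
    qed simp
    then have "ext (n * select_cost n) (?F0 \<union> ?G) U"
      by (rule ext_mono[OF _ _ order_refl order_refl]) (simp add: nw_l_le)
    from ext_trans[OF G this]
    have "ext (1 + tm_cost M1 (T1 n) (T1 n + n) + n * select_cost n) ?F0 (?G \<union> U)" .
    from ext_Un[OF this ext_subset[OF order_refl], of 0]
    have "ext (1 + tm_cost M1 (T1 n) (T1 n + n) + n * select_cost n) ?F0 ((?G \<union> U) \<union> ?F0)" by (simp only: add_0_right)
    then have "ext (1 + tm_cost M1 (T1 n) (T1 n + n) + n * select_cost n) ?F0 F2"
    proof (rule ext_cong)
      fix g assume "g \<in> F2"
      then obtain j p where jp: "j < 2" "p < [?l, ?v] ! j" and g: "g = (\<lambda>x. us x ! j ! p)"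
        unfolding F2_def mem_Collect_eq by (elim exE conjE)
      consider "j = 0" "p < ?l" | "j = 1" "p < ?v" using jp by (auto simp: less_2_cases_iff)
      then show "\<exists>g'\<in>(?G \<union> U) \<union> ?F0. \<forall>x\<in>X. g' x = g x"
      proof cases
        case 1
        have "(\<lambda>x. nths z (J x) ! p) \<in> U" unfolding U_def using 1(2) by (intro UN_I[of p]) simp_all
        then have "(\<lambda>x. nths z (J x) ! p) \<in> (?G \<union> U) \<union> ?F0" by (intro UnI1 UnI2)
        moreover have "\<forall>x\<in>X. nths z (J x) ! p = g x" unfolding g 1(1) by (simp add: us_def)
        ultimately show ?thesis by (intro bexI[where x = "\<lambda>x. nths z (J x) ! p"])
      next
        case 2
        have "(\<lambda>x. enc x ! (k + p)) \<in> (?G \<union> U) \<union> ?F0" using 2(2) q by (intro UnI2 imageI) simp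
        moreover have "\<forall>x\<in>X. enc x ! (k + p) = g x" unfolding g 2(1) using enc2 2(2) by (simp add: us_def)
        ultimately show ?thesis by (intro bexI[where x = "\<lambda>x. enc x ! (k + p)"])
      qed
    qed
    moreover have "ext (tm_cost M2 (T2 n) (T2 n + 1)) F2
        ((\<lambda>i x. [preimage_check h True (nths z (J x)) (take ?v (snd x))] ! i) ` {..<1})"
    proof (rule ext_tm[where xs = us and Ls = "[?l, ?v]", OF M2])
      fix x assume x: "x \<in> X"
      show len: "map length (us x) = [?l, ?v]" using X(2)[OF x] lenJ[OF x] q by (simp add: us_def)
      have "(us x, [preimage_check h True (nths z (J x)) (take ?v (snd x))]) \<in>
          {([u, y], [preimage_check h True u y]) | u y. True}" unfolding us_def by blast
      from bspec[OF out2 this]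
      show "outputs_within M2 (us x) [preimage_check h True (nths z (J x)) (take ?v (snd x))] (T2 n) \<and>
          length [preimage_check h True (nths z (J x)) (take ?v (snd x))] = 1"
        using len by (simp add: T2_def)
    next
      fix j p assume "j < length [?l, ?v]" "p < [?l, ?v] ! j"
      then show "(\<lambda>x. us x ! j ! p) \<in> F2" unfolding F2_def mem_Collect_eq by (intro exI[of _ j] exI[of _ p]) simp
    qed simp_all
    ultimately have "ext (cost n) ?F0 ((\<lambda>i x. [preimage_check h True (nths z (J x)) (take ?v (snd x))] ! i) ` {..<1})"
      unfolding cost_def by (rule ext_comp)
    then have "ext (cost n) ?F0 (set [\<lambda>x. preimage_check h True (nths z (J x)) (take ?v (snd x))])"
      by (simp add: lessThan_Suc)
    from ext_circuit[OF this order_trans[OF e s]] obtain D where D: "is_circuit (k + q) 1 D" "csize D = s"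
      "\<And>x. x \<in> X \<Longrightarrow> ceval D (enc x) = [preimage_check h True (nths z (J x)) (take ?v (snd x))]"
      by (auto simp: length_Cons)
    show "\<exists>D. is_circuit (k + q) 1 D \<and> csize D = s \<and>
      (\<forall>i<nw_m \<delta> n. \<forall>\<phi>\<in>strings k. \<forall>y\<in>strings q. bin (2 * k) i = ones k @ \<phi> \<longrightarrow>
        ceval D (\<phi> @ y) = [preimage_check h True (nths z (A \<delta> n i)) (take ?v y)])"
    proof (rule exI[of _ D], intro conjI allI ballI impI)
      fix i \<phi> y assume i: "i < nw_m \<delta> n" and \<phi>: "\<phi> \<in> strings k" and y: "y \<in> strings q"
        and b: "bin (2 * k) i = ones k @ \<phi>"
      have "J (\<phi>, y) = A \<delta> n i" using J'[OF i, of "(\<phi>, y)"] b by simp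
      then show "ceval D (\<phi> @ y) = [preimage_check h True (nths z (A \<delta> n i)) (take ?v y)]"
        using D(3)[of "(\<phi>, y)"] \<phi> y by (simp add: X_def enc_def)
    qed (use D in simp_all)
  qed
qed

text \<open>A solution would be a formula at which satisfiability of D and being a tautology
  disagree. Here the two agree at every formula of size k, both being the bit of the generator at
  its index.\<close>

lemma certificate_circuit_no_solution:
  assumes bij: "\<And>l. bij_betw h (strings l) (strings l)" and k: "length z = n" "nw_d \<delta> n = 2 * k"
    and design: "design (nw_d \<delta> n) (nw_l n) n (nw_m \<delta> n) J"
    and b: "NW J (nw_m \<delta> n) (gl_bit h) z = map (table_entry k) [0..<2 ^ (2 * k)]"
    and q: "nw_l n div 2 \<le> k ^ c"
    and D: "\<And>i \<phi> y. i < nw_m \<delta> n \<Longrightarrow> \<phi> \<in> strings k \<Longrightarrow> y \<in> strings (k ^ c) \<Longrightarrow> bin (2 * k) i = ones k @ \<phi> \<Longrightarrow>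
      ceval D (\<phi> @ y) = [preimage_check h True (nths z (J i)) (take (nw_l n div 2) y)]"
  shows "\<not> cert_solution c k D B"
proof
  assume sol: "cert_solution c k D B"
  then have len: "length (code B) = k" by (simp add: cert_solution_def)
  then have "length (ones k @ code B) = 2 * k" by simp
  from ex_bin[OF this] obtain i where i: "i < 2 ^ (2 * k)" "bin (2 * k) i = ones k @ code B" by blast
  then have im: "i < nw_m \<delta> n" by (simp add: nw_m_def k)
  let ?u = "nths z (J i)"
  have "J i \<subseteq> {0..<n}" "card (J i) = nw_l n" using design im by (auto simp: design_def)
  moreover from this have "{j. j < length z \<and> j \<in> J i} = J i" using k by auto
  ultimately have u: "length ?u = nw_l n" by (simp add: length_nths)
  have "NW J (nw_m \<delta> n) (gl_bit h) z ! i = gl_bit h ?u" using im by (simp add: NW_def)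
  then have taut: "gl_bit h ?u \<longleftrightarrow> tautology B"
    unfolding b using i(1) table_entry_tautology[OF len i(2)] by simp
  have "satisfiable_in_y c k D (code B) \<longleftrightarrow>
      (\<exists>y\<in>strings (k ^ c). preimage_check h True ?u (take (length ?u div 2) y))"
    unfolding satisfiable_in_y_def u using D[OF im _ _ i(2)] len by (intro bex_cong refl) (simp add: strings_def)
  also have "\<dots> \<longleftrightarrow> gl_bit h ?u" by (rule ex_preimage_check_iff[OF bij]) (simp add: u q)
  finally have "satisfiable_in_y c k D (code B) \<longleftrightarrow> tautology B" using taut by simp
  with sol show False by (auto simp: cert_solution_def falsifiable_def tautology_def)
qed

theorem corollary6p2:
  fixes A :: "real \<Rightarrow> nat \<Rightarrow> nat \<Rightarrow> nat set"
  assumes "design_family A"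
    and "Conjecture_NW A"
    and "\<exists>h. exp_hard_owp h"
  shows "\<exists>c::nat. c \<ge> 1 \<and>
    infinite {k. k \<ge> 1 \<and> (\<exists>D. cert_input c k D \<and> \<not> (\<exists>A. cert_solution c k D A))}"
proof -
  obtain h where h: "exp_hard_owp h" using assms(3) by blast
  then have pt: "polytime_fun h" and bij: "\<And>l. bij_betw h (strings l) (strings l)"
    by (auto simp: exp_hard_owp_def)
  have "NPcoNP_unique (gl_bit h)" "exp_hard (gl_bit h)"
    by (rule NPcoNP_unique_gl_bit(1)[OF pt bij], rule exp_hard_gl_bit[OF h])
  with assms(2) obtain \<delta> where \<delta>: "0 < \<delta>" "\<delta> \<le> 1 / 3" and
    conj: "\<And>R. NP_set R \<Longrightarrow> infinite R \<Longrightarrow> infinite {b \<in> R. \<exists>n\<ge>1. length b = nw_m \<delta> n} \<Longrightarrow>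
      \<exists>n\<ge>1. Rng_NW A \<delta> n (gl_bit h) \<inter> R \<noteq> {}"
    unfolding Conjecture_NW_def by blast
  obtain e where e: "\<And>n k q s z. n \<ge> 1 \<Longrightarrow> z \<in> strings n \<Longrightarrow> nw_d \<delta> n = 2 * k \<Longrightarrow> nw_l n div 2 \<le> q \<Longrightarrow> (n + 2) ^ e \<le> s \<Longrightarrow>
    \<exists>D. is_circuit (k + q) 1 D \<and> csize D = s \<and>
      (\<forall>i<nw_m \<delta> n. \<forall>\<phi>\<in>strings k. \<forall>y\<in>strings q. bin (2 * k) i = ones k @ \<phi> \<longrightarrow>
        ceval D (\<phi> @ y) = [preimage_check h True (nths z (A \<delta> n i)) (take (nw_l n div 2) y)])"
    using ex_certificate_circuit[OF assms(1) \<delta> NPcoNP_unique_gl_bit(2)[OF pt bij]] by meson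
  \<comment> \<open>Chosen for n + 2 \<le> k^r. With s = 1 / \<delta> rounded up, n < (2 k + 1)^s,
    and 2 k + 1 \<le> k^3 for k \<ge> 2; the last factor k absorbs the summand 2.\<close>
  define r where "r = 3 * nat \<lceil>1 / \<delta>\<rceil> + 1"
  \<comment> \<open>\<open>c \<ge> r\<close> makes the block y long enough for witnesses, and
    \<open>c \<ge> r * e\<close> gives \<open>c ^ 2 \<ge> r * e\<close>, which is what the size of
    the circuit needs.\<close>
  define c where "c = r * (e + 1)"
  have r: "r \<ge> 1" and c: "c \<ge> r" by (simp_all add: r_def c_def)
  have "\<exists>k\<ge>K. k \<ge> 1 \<and> (\<exists>D. cert_input c k D \<and> \<not> (\<exists>A. cert_solution c k D A))" for K
  proof -
    \<comment> \<open>The set varies with \<open>K\<close> while \<open>c\<close> is already fixed.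
      The maximum with 2 ensures k \<ge> 2 for the estimates in powers of k.\<close>
    let ?R = "tables (max K 2)"
    have inf: "infinite {b \<in> ?R. \<exists>n\<ge>1. length b = nw_m \<delta> n}" by (rule infinite_tables[OF \<delta>])
    then have "infinite ?R" using finite_subset[of "{b \<in> ?R. \<exists>n\<ge>1. length b = nw_m \<delta> n}" ?R] by blast
    from conj[OF NP_set_tables this inf] obtain n z where n: "n \<ge> 1" and z: "z \<in> strings n"
      and "NW (A \<delta> n) (nw_m \<delta> n) (gl_bit h) z \<in> ?R"
      unfolding Rng_NW_def by blast
    then obtain k where k: "k \<ge> K" "k \<ge> 2"
      and b: "NW (A \<delta> n) (nw_m \<delta> n) (gl_bit h) z = map (table_entry k) [0..<2 ^ (2 * k)]"
      unfolding tables_def by auto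
    have "nw_m \<delta> n = 2 ^ (2 * k)" using arg_cong[OF b, of length] by (simp add: NW_def)
    then have d: "nw_d \<delta> n = 2 * k" by (simp add: nw_m_def)
    have n2: "n + 2 \<le> k ^ r"
    proof -
      let ?s = "nat \<lceil>1 / \<delta>\<rceil>"
      have k3: "2 * k + 1 \<le> k ^ 3"
      proof -
        have "4 * k \<le> k * k * k" using k(2) mult_le_mono[OF k(2) k(2)] by (intro mult_right_mono) auto
        moreover have "2 * k + 1 \<le> 4 * k" using k(2) by linarith
        ultimately show ?thesis unfolding power3_eq_cube by linarith
      qed
      have "n < (2 * k + 1) ^ ?s" using less_nw_d_power[OF \<delta>(1) n] by (simp add: d)
      also have "\<dots> \<le> (k ^ 3) ^ ?s" using k3 by (intro power_mono) auto
      finally have "n < k ^ (3 * ?s)" by (simp add: power_mult)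
      then have "n + 2 \<le> 2 * k ^ (3 * ?s)" by linarith
      also have "\<dots> \<le> k * k ^ (3 * ?s)" using k(2) by (intro mult_right_mono) auto
      finally show ?thesis by (simp add: r_def)
    qed
    have "nw_l n div 2 \<le> n + 2" using nw_l_le[of n] by linarith
    also have "\<dots> \<le> k ^ r" by (rule n2)
    also have "\<dots> \<le> k ^ c" using k(2) c by (intro power_increasing) auto
    finally have q: "nw_l n div 2 \<le> k ^ c" .
    have "(n + 2) ^ e \<le> (k ^ r) ^ e" using n2 by (rule power_mono) simp
    also have "\<dots> = k ^ (r * e)" by (simp add: power_mult)
    also have "\<dots> \<le> k ^ (c ^ 2)"
    proof (rule power_increasing)
      have "r * e \<le> c" by (simp add: c_def)
      also have "c \<le> c * c" by (rule le_square)
      finally show "r * e \<le> c ^ 2" by (simp only: power2_eq_square)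
    qed (use k in simp)
    finally obtain D where D: "is_circuit (k + k ^ c) 1 D" "csize D = k ^ (c ^ 2)"
      "\<And>i \<phi> y. i < nw_m \<delta> n \<Longrightarrow> \<phi> \<in> strings k \<Longrightarrow> y \<in> strings (k ^ c) \<Longrightarrow> bin (2 * k) i = ones k @ \<phi> \<Longrightarrow>
        ceval D (\<phi> @ y) = [preimage_check h True (nths z (A \<delta> n i)) (take (nw_l n div 2) y)]"
      using e[OF n z d q] by blast
    have "length z = n" using z by (simp add: strings_def)
    moreover have "design (nw_d \<delta> n) (nw_l n) n (nw_m \<delta> n) (A \<delta> n)"
      using assms(1) \<delta> n unfolding design_family_def by blast
    ultimately have "\<not> cert_solution c k D B" for B
      by (rule certificate_circuit_no_solution[OF bij _ d _ b q D(3)])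
    moreover have "cert_input c k D" using D by (simp add: cert_input_def)
    ultimately show ?thesis using k by (intro exI[of _ k]) auto
  qed
  then have "infinite {k. k \<ge> 1 \<and> (\<exists>D. cert_input c k D \<and> \<not> (\<exists>A. cert_solution c k D A))}"
    unfolding infinite_nat_iff_unbounded_le by blast
  then show ?thesis using r c by (intro exI[of _ c]) auto
qed

end
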